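(* Let $X\subset\mathbb{R}^m$ be a subanalytic subset with $0\in X$. If $X$ is Lipschitz normally embedded at $0$, then $X$ has reduced tangent cone at $0$; that is, $k_X(x)=1$ for all $x\in Smp(\partial X')$.
   Context: All subsets of Euclidean space carry the induced Euclidean metric. Lipschitz normal embedding: for a path connected subset $Y\subset\mathbb{R}^m$ and $x_1,x_2\in Y$, the inner distance $d_Y(x_1,x_2)$ is the infimum of the lengths of paths on $Y$ connecting $x_1$ to $x_2$. A (path connected) subset $Y\subset\mathbb{R}^m$ is Lipschitz normally embedded if there exists $\lambda\ge1$ such that $d_Y(x_1,x_2)\le\lambda\|x_1-x_2\|$ for all $x_1,x_2\in Y$. Given $p\in X$, $X$ is Lipschitz normally embedded at $p$ if there is an open neighborhood $U\subset\mathbb{R}^m$ of $p$ such that $X\cap U$ is Lipschitz normally embedded. Spherical blowing-up: $\rho_m\colon\mathbb{S}^{m-1}\times[0,+\infty)\to\mathbb{R}^m$, $\rho_m(x,r)=rx$; it restricts to a homeomorphism $\mathbb{S}^{m-1}\times(0,+\infty)\to\mathbb{R}^m\setminus\{0\}$ with inverse $x\mapsto(\frac{x}{\|x\|},\|x\|)$. Put $X'=\overline{\rho_m^{-1}(X\setminus\{0\})}$ and $\partial X'=X'\cap(\mathbb{S}^{m-1}\times\{0\})$. Simple points: let $X\subset\mathbb{R}^m$ be subanalytic with $0\in X$. A point $x\in\partial X'$ is a simple point of $\partial X'$ if there is an open $U\subset\mathbb{R}^{m+1}$ with $x\in U$ such that: (a) the connected components $X_1,\dots,X_r$ of $(X'\cap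 U)\setminus\partial X'$ are topological manifolds with $\dim X_i=\dim X$ for all $i=1,\dots,r$; (b) $(X_i\cup\partial X')\cap U$ is a topological manifold with boundary for all $i=1,\dots,r$. The set of simple points is denoted $Smp(\partial X')$. The function $k_X\colon Smp(\partial X')\to\mathbb{N}$ is defined by letting $k_X(x)$ be the number of connected components of $\rho_m^{-1}(X\setminus\{0\})\cap U$, where $U$ is a sufficiently small open neighborhood of $x$. The set $X$ has reduced tangent cone at $0$ if $k_X(x)=1$ for all $x\in Smp(\partial X')$. *)

theory Defs
  imports "HOL-Analysis.Analysis"
begin

section \<open>Semianalytic and subanalytic sets\<close>

text \<open>
  The definition of a subanalytic set quantifies existentially over the dimension \<open>p\<close> of an
  auxiliary factor of \<open>\<real>\<^sup>m \<times> \<real>\<^sup>p\<close>, so the number of coordinates cannot be a type here.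
  For a finite index set \<open>I\<close>, the space \<open>\<real>\<^sup>I\<close> is the set of extensional functions
  \<open>PiE I (\<lambda>_. UNIV)\<close> with the product topology.
\<close>

abbreviation coord_space :: "'i set \<Rightarrow> ('i \<Rightarrow> real) topology" where
  "coord_space I \<equiv> product_topology (\<lambda>_. euclideanreal) I"

text \<open>Near every point \<open>a\<close> of \<open>U\<close>, \<open>f\<close> is the sum of an (unconditionally convergent) power
  series in \<open>x - a\<close>; the multi-indices are the elements of \<open>PiE I (\<lambda>_. UNIV)\<close>.\<close>

definition real_analytic_on :: "'i set \<Rightarrow> ('i \<Rightarrow> real) set \<Rightarrow> (('i \<Rightarrow> real) \<Rightarrow> real) \<Rightarrow> bool" where
  "real_analytic_on I U f \<longleftrightarrow>
     (\<forall>a\<in>U. \<exists>c. \<exists>\<epsilon>>0. \<forall>x\<in>U. (\<forall>i\<in>I. \<bar>x i - a i\<bar> < \<epsilon>) \<longrightarrow>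
        ((\<lambda>\<alpha>. c \<alpha> * (\<Prod>i\<in>I. (x i - a i) ^ \<alpha> i)) has_sum f x) (PiE I (\<lambda>_. UNIV :: nat set)))"

text \<open>Locally at every point of the ambient space (not only at points of \<open>A\<close>), \<open>A\<close> is a finite
  union of sets, each given by finitely many analytic equations \<open>f = 0\<close> (\<open>f \<in> Z\<close>) and
  inequalities \<open>g > 0\<close> (\<open>g \<in> P\<close>).\<close>

definition semianalytic :: "'i set \<Rightarrow> ('i \<Rightarrow> real) set \<Rightarrow> bool" where
  "semianalytic I A \<longleftrightarrow>
     A \<subseteq> topspace (coord_space I) \<and>
     (\<forall>a\<in>topspace (coord_space I). \<exists>U F.
        openin (coord_space I) U \<and> a \<in> U \<and> finite F \<and>
        (\<forall>(Z, P)\<in>F. finite Z \<and> finite P \<and> (\<forall>f\<in>Z \<union> P. real_analytic_on I U f)) \<and>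
        A \<inter> U = {x\<in>U. \<exists>(Z, P)\<in>F. (\<forall>f\<in>Z. f x = 0) \<and> (\<forall>g\<in>P. 0 < g x)})"

text \<open>Locally at every point of \<open>\<real>\<^sup>m\<close>, \<open>X\<close> is the projection of a relatively compact semianalytic
  subset of \<open>\<real>\<^sup>m \<times> \<real>\<^sup>p\<close> for some \<open>p\<close>.\<close>

definition subanalytic :: "(real ^ 'm) set \<Rightarrow> bool" where
  "subanalytic X \<longleftrightarrow>
     (\<forall>a. \<exists>U p A. open U \<and> a \<in> U \<and>
        (let I = (UNIV :: 'm set) <+> {..<p::nat} in
          semianalytic I A \<and> compactin (coord_space I) (coord_space I closure_of A) \<and>
          X \<inter> U = {x. \<exists>y\<in>A. \<forall>i. x $ i = y (Inl i)}))"


section \<open>Dimension\<close>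

definition analytic_map_on :: "(real ^ 'm) set \<Rightarrow> (real ^ 'm \<Rightarrow> real ^ 'm) \<Rightarrow> bool" where
  "analytic_map_on U f \<longleftrightarrow>
     (\<forall>i. real_analytic_on UNIV (vec_nth ` U) (\<lambda>y. f (vec_lambda y) $ i))"

text \<open>\<open>S\<close> is locally straightened by a bianalytic chart \<open>\<phi>\<close> to a \<open>d\<close>-dimensional coordinate
  subspace.\<close>

definition analytic_submanifold :: "nat \<Rightarrow> (real ^ 'm) set \<Rightarrow> bool" where
  "analytic_submanifold d S \<longleftrightarrow>
     (\<forall>a\<in>S. \<exists>U V \<phi> \<psi> J.
        open U \<and> a \<in> U \<and> open V \<and> homeomorphism U V \<phi> \<psi> \<and>
        analytic_map_on U \<phi> \<and> analytic_map_on V \<psi> \<and>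
        card J = d \<and> S \<inter> U = {x\<in>U. \<forall>i. i \<notin> J \<longrightarrow> \<phi> x $ i = 0})"

definition set_dim :: "(real ^ 'm) set \<Rightarrow> nat" where
  "set_dim X = Max {d. \<exists>S. S \<noteq> {} \<and> S \<subseteq> X \<and> analytic_submanifold d S}"


section \<open>Topological manifolds\<close>

text \<open>Subsets of Euclidean space are automatically Hausdorff and second countable.\<close>

definition topological_manifold :: "nat \<Rightarrow> 'a::euclidean_space set \<Rightarrow> bool" where
  "topological_manifold n M \<longleftrightarrow>
     (\<forall>x\<in>M. \<exists>V W. openin (top_of_set M) V \<and> x \<in> V \<and> openin (Euclidean_space n) W \<and>
        top_of_set V homeomorphic_space subtopology (Euclidean_space n) W)"

text \<open>For \<open>n = 0\<close> the half space is the one-point space. The boundary may be empty.\<close>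

definition half_space :: "nat \<Rightarrow> (nat \<Rightarrow> real) topology" where
  "half_space n = subtopology (Euclidean_space n) {x. 0 \<le> x 0}"

definition topological_manifold_with_boundary :: "nat \<Rightarrow> 'a::euclidean_space set \<Rightarrow> bool" where
  "topological_manifold_with_boundary n M \<longleftrightarrow>
     (\<forall>x\<in>M. \<exists>V W. openin (top_of_set M) V \<and> x \<in> V \<and> openin (half_space n) W \<and>
        top_of_set V homeomorphic_space subtopology (half_space n) W)"


section \<open>Lipschitz normal embedding\<close>

text \<open>The length is the supremum of the lengths of inscribed polygons; it may be infinite.\<close>

definition path_length :: "(real \<Rightarrow> 'a::metric_space) \<Rightarrow> ennreal" where
  "path_length g =
     (SUP ts\<in>{ts. sorted ts \<and> set ts \<subseteq> {0..1}}.
        \<Sum>i<length ts - 1. ennreal (dist (g (ts ! i)) (g (ts ! Suc i))))"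

definition inner_dist :: "'a::metric_space set \<Rightarrow> 'a \<Rightarrow> 'a \<Rightarrow> ennreal" where
  "inner_dist Y x1 x2 =
     (INF g\<in>{g. path g \<and> path_image g \<subseteq> Y \<and> pathstart g = x1 \<and> pathfinish g = x2}. path_length g)"

definition lipschitz_normally_embedded :: "'a::real_normed_vector set \<Rightarrow> bool" where
  "lipschitz_normally_embedded Y \<longleftrightarrow>
     path_connected Y \<and>
     (\<exists>L::real. L \<ge> 1 \<and> (\<forall>x1\<in>Y. \<forall>x2\<in>Y. inner_dist Y x1 x2 \<le> ennreal (L * norm (x1 - x2))))"

definition lipschitz_normally_embedded_at :: "'a::real_normed_vector set \<Rightarrow> 'a \<Rightarrow> bool" where
  "lipschitz_normally_embedded_at X p \<longleftrightarrow>
     p \<in> X \<and> (\<exists>U. open U \<and> p \<in> U \<and> lipschitz_normally_embedded (X \<inter> U))"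


section \<open>Spherical blowing-up and simple points\<close>

text \<open>\<open>\<real>\<^sup>m\<^sup>+\<^sup>1\<close> is the product type \<open>(real ^ 'm) \<times> real\<close>, whose metric is the Euclidean one.\<close>

definition blowup_map :: "(real ^ 'm) \<times> real \<Rightarrow> real ^ 'm" where
  "blowup_map = (\<lambda>(x, r). r *\<^sub>R x)"

definition blowup_preimage :: "(real ^ 'm) set \<Rightarrow> ((real ^ 'm) \<times> real) set" where
  "blowup_preimage X = {z \<in> sphere 0 1 \<times> {0..}. blowup_map z \<in> X - {0}}"

text \<open>The closure may be taken in \<open>\<real>\<^sup>m\<^sup>+\<^sup>1\<close>, since the domain of the blowing-up is closed there.\<close>

definition strict_transform :: "(real ^ 'm) set \<Rightarrow> ((real ^ 'm) \<times> real) set" where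
  "strict_transform X = closure (blowup_preimage X)"

definition blowup_boundary :: "(real ^ 'm) set \<Rightarrow> ((real ^ 'm) \<times> real) set" where
  "blowup_boundary X = strict_transform X \<inter> (sphere 0 1 \<times> {0})"

definition simple_points :: "(real ^ 'm) set \<Rightarrow> ((real ^ 'm) \<times> real) set" where
  "simple_points X = {x \<in> blowup_boundary X. \<exists>U. open U \<and> x \<in> U \<and>
     (let \<C> = components (strict_transform X \<inter> U - blowup_boundary X) in
       finite \<C> \<and>
       (\<forall>C\<in>\<C>. topological_manifold (set_dim X) C) \<and>
       (\<forall>C\<in>\<C>. \<exists>n. topological_manifold_with_boundary n ((C \<union> blowup_boundary X) \<inter> U)))}"

text \<open>A "sufficiently small open neighborhood" is an open ball of sufficiently small radius:
  for arbitrary open sets the number of components would not stabilise.\<close>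

definition tangent_multiplicity :: "(real ^ 'm) set \<Rightarrow> (real ^ 'm) \<times> real \<Rightarrow> nat" where
  "tangent_multiplicity X x =
     (THE k. \<forall>\<^sub>F \<epsilon> in at_right 0.
        finite (components (blowup_preimage X \<inter> ball x \<epsilon>)) \<and>
        card (components (blowup_preimage X \<inter> ball x \<epsilon>)) = k)"

definition reduced_tangent_cone :: "(real ^ 'm) set \<Rightarrow> bool" where
  "reduced_tangent_cone X \<longleftrightarrow> (\<forall>x\<in>simple_points X. tangent_multiplicity X x = 1)"

end

theory Submission
  imports Defs "HOL-Complex_Analysis.Complex_Analysis" "Jordan_Normal_Form.Determinant"
begin

text \<open>
That \<open>k\<^sub>X(x) = 1\<close> at a point \<open>x = (u0, 0)\<close> of \<open>blowup_boundary X\<close> follows by combining one fact about subanalytic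
sets with one fact about Lipschitz normal embedding. Put \<open>Y = blowup_preimage X\<close>.

The subanalytic fact (\<open>blowup_descends\<close>) is a curve selection lemma with a good parametrisation: every
point of \<open>Y\<close> close to \<open>x\<close> lies on a path in \<open>Y\<close> along which the squared distance to \<open>x\<close> is the
parameter, decreasing to \<open>0\<close>. So inside each small ball around \<open>x\<close> every point of \<open>Y\<close> can be
moved arbitrarily close to \<open>x\<close>, and on the way all small radii \<open>r\<close> are attained.

The metric fact (\<open>lipschitz_link\<close>): two points \<open>(u1, h)\<close>, \<open>(u2, h)\<close> of \<open>Y\<close> with \<open>u1\<close>, \<open>u2\<close> close to
\<open>u0\<close> correspond to points \<open>h u1\<close>, \<open>h u2\<close> of \<open>X\<close> at distance \<open>h |u1 - u2|\<close>, which is small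
compared with \<open>h\<close>. Lipschitz normal embedding joins them in \<open>X\<close> by a path whose length is small
compared with \<open>h\<close>; such a path stays in a thin cone around \<open>u0\<close> away from the origin, and so it
lifts to \<open>Y\<close> inside a small ball around \<open>x\<close>. Moving two given points of \<open>Y\<close> down to the same height
and linking them there shows that \<open>Y\<close> meets every small ball around \<open>x\<close> in a connected nonempty set
(\<open>connected_blowup_ball\<close>), which is \<open>k\<^sub>X(x) = 1\<close>.

Most of the text proves curve selection (\<open>curve_selection\<close>). By compactness of the closure of the
semianalytic set that projects onto \<open>X\<close>, it suffices to argue near one point of the fibre over \<open>x\<close>
(\<open>local_descent\<close>); there all data are finitely many convergent power series, and the parameter \<open>t\<close>
(the squared distance) is added as coordinate number \<open>0\<close> together with the equation defining it.
What is needed is: for finitely many power series \<open>F\<close> near \<open>0\<close> in \<open>\<real>\<^bsup>n+1\<^esup>\<close>, every point \<open>a\<close> close to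
\<open>0\<close> with \<open>t(a) > 0\<close> lies on a path \<open>\<gamma>\<close> over \<open>(0, t(a)]\<close> with \<open>t(\<gamma>(s)) = s\<close> along which every \<open>F\<close> is
either identically zero or nowhere zero. This is an induction on the number of coordinates other than
\<open>t\<close>, in the spirit of cylindrical decomposition with \<open>t\<close> eliminated last. Powers of \<open>t\<close> are divided
out, so that no \<open>F\<close> vanishes identically on \<open>t = 0\<close> (\<open>hol_divide_power\<close>); a shear that preserves
\<open>t\<close> makes the product of all \<open>F\<close> regular in the last coordinate. The number of distinct zeros in
the last coordinate is then governed by the vanishing of Hankel determinants of the power sums of
the zeros (\<open>zero_count_functions\<close>), and these are again power series in the remaining coordinates. Along
a path selected for them by the induction hypothesis the number of distinct zeros is constant. So
the zeros move continuously without collisions, the real ones stay real because the zero set is closed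
under conjugation, and the path is lifted either along a real zero or at a fixed proportion between two
neighbouring ones (\<open>real_section\<close>).

Holomorphic functions are used in place of real power series because the zeros have to be counted by
contour integrals.
\<close>

section \<open>Holomorphic functions of several variables\<close>

text \<open>
The number of coordinates changes during the induction on dimension, so points are sequences of which only
the coordinates \<open>0, \<dots>, n\<close> matter.
\<close>

definition polydisc :: "nat \<Rightarrow> real \<Rightarrow> (nat \<Rightarrow> complex) set" where
  "polydisc n R = {z. \<forall>i\<le>n. norm (z i) < R}"

text \<open>
Holomorphy is required along every complex line, not only along the coordinate axes. For continuous functions
the two notions agree by Osgood's lemma; with this one, closure under linear changes of coordinates and under
parameter integrals is immediate.
\<close>

definition hol :: "nat \<Rightarrow> real \<Rightarrow> ((nat \<Rightarrow> complex) \<Rightarrow> complex) \<Rightarrow> bool" where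
  "hol n R F \<longleftrightarrow>
     continuous_on (polydisc n R) F \<and>
     (\<forall>z w. (\<lambda>s. F (\<lambda>i. z i + s * w i)) holomorphic_on {s. (\<lambda>i. z i + s * w i) \<in> polydisc n R}) \<and>
     (\<forall>z z'. (\<forall>i\<le>n. z i = z' i) \<longrightarrow> F z = F z')"

lemma continuous_on_coord: "continuous_on S (\<lambda>x::'b \<Rightarrow> 'c::topological_space. x i)"
  by (rule continuous_on_product_then_coordinatewise[OF continuous_on_id])

lemma continuous_on_fun_upd [continuous_intros]:
  fixes f :: "'a::topological_space \<Rightarrow> 'b \<Rightarrow> 'c::topological_space"
  assumes "continuous_on S f" "continuous_on S g"
  shows "continuous_on S (\<lambda>x. (f x)(k := g x))"
proof (rule continuous_on_coordinatewise_then_product)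
  fix i show "continuous_on S (\<lambda>x. ((f x)(k := g x)) i)"
    using assms continuous_on_product_then_coordinatewise[OF assms(1), of i] by (cases "i = k") auto
qed

lemma open_polydisc: "open (polydisc n R)"
proof -
  have "polydisc n R = (\<Inter>i\<in>{..n}. {z. norm (z i) < R})"
    by (auto simp: polydisc_def)
  moreover have "open {z::nat \<Rightarrow> complex. norm (z i) < R}" for i
    by (intro open_Collect_less continuous_intros continuous_on_coord)
  ultimately show ?thesis by (auto intro!: open_INT)
qed

lemma polydisc_mono: "n \<le> n' \<Longrightarrow> R' \<le> R \<Longrightarrow> polydisc n' R' \<subseteq> polydisc n R"
  unfolding polydisc_def by auto (meson le_trans order_less_le_trans)

lemma hol_mono:
  assumes "hol n R F" "n \<le> n'" "R' \<le> R"
  shows "hol n' R' F"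
proof -
  have *: "polydisc n' R' \<subseteq> polydisc n R" using assms polydisc_mono by auto
  show ?thesis
    unfolding hol_def
  proof (intro conjI allI impI)
    show "continuous_on (polydisc n' R') F"
      using assms(1) * continuous_on_subset[of "polydisc n R" F] unfolding hol_def by blast
  next
    fix z w
    show "(\<lambda>s. F (\<lambda>i. z i + s * w i)) holomorphic_on {s. (\<lambda>i. z i + s * w i) \<in> polydisc n' R'}"
      by (rule holomorphic_on_subset[of _ "{s. (\<lambda>i. z i + s * w i) \<in> polydisc n R}"])
         (use assms(1) * in \<open>auto simp: hol_def\<close>)
  next
    fix z z' :: "nat \<Rightarrow> complex" assume "\<forall>i\<le>n'. z i = z' i"
    then show "F z = F z'" using assms(1,2) unfolding hol_def by (metis le_trans)
  qed
qed

lemma hol_cong_point: "hol n R F \<Longrightarrow> (\<And>i. i \<le> n \<Longrightarrow> z i = z' i) \<Longrightarrow> F z = F z'"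
  unfolding hol_def by blast

lemma hol_continuous_on:
  assumes "hol n R F" "continuous_on S g" "\<And>x. x \<in> S \<Longrightarrow> g x \<in> polydisc n R"
  shows "continuous_on S (\<lambda>x. F (g x))"
  using continuous_on_compose2[of "polydisc n R" F S g] assms unfolding hol_def by blast

lemma hol_const [simp]: "hol n R (\<lambda>z. c)"
  by (auto simp: hol_def)

lemma holI:
  assumes "continuous_on (polydisc n R) F"
    "\<And>z w. (\<lambda>s. F (\<lambda>i. z i + s * w i)) holomorphic_on {s. (\<lambda>i. z i + s * w i) \<in> polydisc n R}"
    "\<And>z z'. (\<And>i. i \<le> n \<Longrightarrow> z i = z' i) \<Longrightarrow> F z = F z'"
  shows "hol n R F"
  unfolding hol_def by (intro conjI allI impI; (rule assms(1) assms(2) assms(3); blast?))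

lemma holD:
  assumes "hol n R F"
  shows "continuous_on (polydisc n R) F"
    "(\<lambda>s. F (\<lambda>i. z i + s * w i)) holomorphic_on {s. (\<lambda>i. z i + s * w i) \<in> polydisc n R}"
  using assms unfolding hol_def by blast+

lemma hol_coord: "k \<le> n \<Longrightarrow> hol n R (\<lambda>z. z k)"
  by (rule holI, rule continuous_on_coord, intro holomorphic_intros, blast)

lemma hol_add:
  assumes "hol n R F" "hol n R G" shows "hol n R (\<lambda>z. F z + G z)"
proof (rule holI)
  show "F z + G z = F z' + G z'" if "\<And>i. i \<le> n \<Longrightarrow> z i = z' i" for z z'
    using hol_cong_point[OF assms(1), of z z', OF that] hol_cong_point[OF assms(2), of z z', OF that] by simp
qed (intro continuous_on_add holomorphic_on_add holD assms)+

lemma hol_diff: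
  assumes "hol n R F" "hol n R G" shows "hol n R (\<lambda>z. F z - G z)"
proof (rule holI)
  show "F z - G z = F z' - G z'" if "\<And>i. i \<le> n \<Longrightarrow> z i = z' i" for z z'
    using hol_cong_point[OF assms(1), of z z', OF that] hol_cong_point[OF assms(2), of z z', OF that] by simp
qed (intro continuous_on_diff holomorphic_on_diff holD assms)+

lemma hol_mult:
  assumes "hol n R F" "hol n R G" shows "hol n R (\<lambda>z. F z * G z)"
proof (rule holI)
  show "F z * G z = F z' * G z'" if "\<And>i. i \<le> n \<Longrightarrow> z i = z' i" for z z'
    using hol_cong_point[OF assms(1), of z z', OF that] hol_cong_point[OF assms(2), of z z', OF that] by simp
qed (intro continuous_on_mult holomorphic_on_mult holD assms)+

lemma hol_divide:
  assumes "hol n R F" "hol n R G" "\<And>z. z \<in> polydisc n R \<Longrightarrow> G z \<noteq> 0"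
  shows "hol n R (\<lambda>z. F z / G z)"
proof (rule holI)
  show "F z / G z = F z' / G z'" if "\<And>i. i \<le> n \<Longrightarrow> z i = z' i" for z z'
    using hol_cong_point[OF assms(1), of z z', OF that] hol_cong_point[OF assms(2), of z z', OF that] by simp
qed (intro continuous_on_divide holomorphic_on_divide holD assms; simp add: assms)+

lemma hol_power: "hol n R F \<Longrightarrow> hol n R (\<lambda>z. F z ^ k)"
  by (induction k) (auto intro: hol_mult)

lemma hol_sum: "(\<And>x. x \<in> A \<Longrightarrow> hol n R (F x)) \<Longrightarrow> hol n R (\<lambda>z. \<Sum>x\<in>A. F x z)"
  by (induction A rule: infinite_finite_induct) (auto intro: hol_add)

lemma hol_prod: "(\<And>x. x \<in> A \<Longrightarrow> hol n R (F x)) \<Longrightarrow> hol n R (\<lambda>z. \<Prod>x\<in>A. F x z)"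
  by (induction A rule: infinite_finite_induct) (auto intro: hol_mult)

lemma open_line_polydisc: "open {s::complex. (\<lambda>i. z i + s * w i) \<in> polydisc n R}"
proof -
  have "continuous_on UNIV (\<lambda>s::complex. (\<lambda>i. z i + s * w i))"
    by (intro continuous_on_coordinatewise_then_product continuous_intros)
  then have "open ((\<lambda>s::complex. (\<lambda>i. z i + s * w i)) -` polydisc n R)"
    using open_polydisc continuous_on_open_vimage[of UNIV] by auto
  then show ?thesis by (simp add: vimage_def)
qed

lemma cnj_image_eq_vimage: "cnj ` A = cnj -` A"
proof (rule Set.set_eqI)
  fix x show "x \<in> cnj ` A \<longleftrightarrow> x \<in> cnj -` A"
    unfolding image_iff vimage_eq by (metis complex_cnj_cnj)
qed

text \<open>
The reflected function takes the conjugate values at real points; multiplying by it makes zero sets symmetric under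
conjugation.
\<close>

lemma hol_cnj:
  assumes "hol n R F"
  shows "hol n R (\<lambda>z. cnj (F (\<lambda>i. cnj (z i))))"
  unfolding hol_def
proof (intro conjI allI impI)
  show "continuous_on (polydisc n R) (\<lambda>z. cnj (F (\<lambda>i. cnj (z i))))"
    by (intro continuous_on_cnj hol_continuous_on[OF assms] continuous_on_coordinatewise_then_product
        continuous_on_coord) (auto simp: polydisc_def)
next
  fix z w :: "nat \<Rightarrow> complex"
  let ?S = "{s. (\<lambda>i. z i + s * w i) \<in> polydisc n R}"
  let ?T = "{s. (\<lambda>i. cnj (z i) + s * cnj (w i)) \<in> polydisc n R}"
  have S: "cnj s \<in> ?S \<longleftrightarrow> s \<in> ?T" for s
  proof -
    have "norm (cnj (z i) + s * cnj (w i)) = norm (z i + cnj s * w i)" for i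
      using complex_mod_cnj[of "z i + cnj s * w i"] by simp
    then show ?thesis by (simp add: polydisc_def)
  qed
  have eq: "cnj ` ?S = ?T"
    unfolding cnj_image_eq_vimage by (rule Set.set_eqI, unfold vimage_eq, rule S)
  have "(\<lambda>s. F (\<lambda>i. cnj (z i) + s * cnj (w i))) holomorphic_on cnj ` ?S"
    unfolding eq using assms unfolding hol_def by auto
  then have "(cnj \<circ> (\<lambda>s. F (\<lambda>i. cnj (z i) + s * cnj (w i))) \<circ> cnj) holomorphic_on ?S"
    by (intro holomorphic_on_compose_cnj_cnj open_line_polydisc)
  then show "(\<lambda>s. cnj (F (\<lambda>i. cnj (z i + s * w i)))) holomorphic_on ?S"
    by (simp add: o_def)
next
  fix z z' :: "nat \<Rightarrow> complex" assume "\<forall>i\<le>n. z i = z' i"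
  then have "F (\<lambda>i. cnj (z i)) = F (\<lambda>i. cnj (z' i))"
    by (intro hol_cong_point[OF assms]) auto
  then show "cnj (F (\<lambda>i. cnj (z i))) = cnj (F (\<lambda>i. cnj (z' i)))" by simp
qed

lemma hol_compose_affine:
  assumes F: "hol n R F"
    and T: "\<And>z. z \<in> polydisc n' R' \<Longrightarrow> T z \<in> polydisc n R"
    and contT: "continuous_on UNIV T"
    and aff: "\<And>z w s. T (\<lambda>i. z i + s * w i) = (\<lambda>i. T z i + s * T' w i)"
    and dep: "\<And>z z' i. (\<forall>i\<le>n'. z i = z' i) \<Longrightarrow> i \<le> n \<Longrightarrow> T z i = T z' i"
  shows "hol n' R' (\<lambda>z. F (T z))"
  unfolding hol_def
proof (intro conjI allI impI)
  show "continuous_on (polydisc n' R') (\<lambda>z. F (T z))"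
    using hol_continuous_on[OF F] contT T continuous_on_subset by blast
next
  fix z w :: "nat \<Rightarrow> complex"
  have "(\<lambda>s. F (\<lambda>i. T z i + s * T' w i)) holomorphic_on {s. (\<lambda>i. T z i + s * T' w i) \<in> polydisc n R}"
    using F unfolding hol_def by auto
  then have "(\<lambda>s. F (T (\<lambda>i. z i + s * w i))) holomorphic_on {s. T (\<lambda>i. z i + s * w i) \<in> polydisc n R}"
    by (simp only: aff)
  then show "(\<lambda>s. F (T (\<lambda>i. z i + s * w i))) holomorphic_on {s. (\<lambda>i. z i + s * w i) \<in> polydisc n' R'}"
    by (rule holomorphic_on_subset) (auto intro: T)
next
  fix z z' :: "nat \<Rightarrow> complex" assume "\<forall>i\<le>n'. z i = z' i"
  then show "F (T z) = F (T z')" by (intro hol_cong_point[OF F]) (auto dest: dep)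
qed

text \<open>
Morera's theorem: integrating over the boundary of a triangle commutes with the integral over the parameter.
\<close>

lemma holomorphic_on_integral_param:
  assumes S: "open S"
    and cont: "continuous_on (S \<times> {0..1}) (\<lambda>(s, \<theta>). g s \<theta>)"
    and hol: "\<And>\<theta>. \<theta> \<in> {0..1} \<Longrightarrow> (\<lambda>s. g s \<theta>) holomorphic_on S"
  shows "(\<lambda>s. integral {0..1::real} (g s) :: complex) holomorphic_on S"
proof -
  define G where "G s z = g s (Re z)" for s and z :: complex
  have pi: "path_image (linepath 0 (1::complex)) = of_real ` {0..1}"
    by (simp add: path_image_def linepath_def scaleR_conv_of_real)
  have G_int: "contour_integral (linepath 0 1) (G s) = integral {0..1} (g s)" for s
    unfolding contour_integral_integral by (simp add: G_def linepath_def)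
  have contG: "continuous_on (S \<times> path_image (linepath 0 1)) (\<lambda>(s, z). G s z)"
    unfolding G_def case_prod_unfold
    by (rule continuous_on_compose2[OF cont[unfolded case_prod_unfold], of _ "\<lambda>x. (fst x, Re (snd x))", simplified])
       (use pi in \<open>auto intro!: continuous_intros\<close>)
  have cint: "continuous_on S (\<lambda>s. integral {0..1} (g s))"
    using integral_continuous_on_param[of S "0::real" 1 g] cont by (simp add: case_prod_unfold)
  show ?thesis
  proof (rule analytic_imp_holomorphic, rule Morera_triangle[OF cint S], rule impI)
    fix a b c assume abc: "convex hull {a, b, c} \<subseteq> S"
    then have seg: "closed_segment a b \<subseteq> S" "closed_segment b c \<subseteq> S" "closed_segment c a \<subseteq> S"
      by (meson dual_order.trans segments_subset_convex_hull)+
    have swap: "contour_integral (linepath x y) (\<lambda>s. integral {0..1} (g s))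
        = contour_integral (linepath 0 1) (\<lambda>z. contour_integral (linepath x y) (\<lambda>s. G s z))"
      if "closed_segment x y \<subseteq> S" for x y
      unfolding G_int[symmetric]
      by (rule contour_integral_swap)
         (auto intro!: continuous_on_subset[OF contG] continuous_intros simp: Sigma_mono dest: that[THEN subsetD])
    have conti: "continuous_on (path_image (linepath 0 1)) (\<lambda>z. contour_integral (linepath x y) (\<lambda>s. G s z))"
      if "closed_segment x y \<subseteq> S" for x y
    proof -
      have cont_linepath: "continuous_on A (\<lambda>p. linepath x y (snd p))" for A :: "(complex \<times> real) set"
        unfolding linepath_def by (intro continuous_intros)
      have "continuous_on (path_image (linepath 0 1) \<times> {0..1}) (\<lambda>(z, t). G (linepath x y t) z * (y - x))"
        unfolding case_prod_unfold
        by (intro continuous_intros continuous_on_compose2[OF contG[unfolded case_prod_unfold],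
              of _ "\<lambda>p. (linepath x y (snd p), fst p)", simplified])
           (use that in \<open>auto simp: linepath_in_path intro!: continuous_intros cont_linepath\<close>)
      then show ?thesis
        unfolding contour_integral_integral vector_derivative_linepath_within
        using integral_continuous_on_param[of _ 0 "1::real" "\<lambda>z t. G (linepath x y t) z * (y - x)"]
        by simp
    qed
    let ?h = "\<lambda>x y z. contour_integral (linepath x y) (\<lambda>s. G s z)"
    have int: "(\<lambda>z. ?h x y z) contour_integrable_on (linepath 0 1)" if "closed_segment x y \<subseteq> S" for x y
      using conti[OF that] by (intro contour_integrable_continuous_linepath) simp
    have zero: "?h a b z + ?h b c z + ?h c a z = 0" if "z \<in> path_image (linepath 0 1)" for z
    proof -
      have "Re z \<in> {0..1}" using that pi by auto
      then have H0: "(\<lambda>s. G s z) holomorphic_on S" using hol by (simp add: G_def)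
      then have H: "(\<lambda>s. G s z) holomorphic_on convex hull {a, b, c}"
        using abc holomorphic_on_subset by blast
      have "((\<lambda>s. G s z) has_contour_integral 0) (linepath a b +++ linepath b c +++ linepath c a)"
        by (rule Cauchy_theorem_triangle[OF H])
      moreover have C: "continuous_on (closed_segment x y) (\<lambda>s. G s z)" if "closed_segment x y \<subseteq> S" for x y
        using H0 that holomorphic_on_imp_continuous_on holomorphic_on_subset by blast
      ultimately show ?thesis
        using has_chain_integral_chain_integral3[of "\<lambda>s. G s z" 0 a b c a] by simp
    qed
    have "contour_integral (linepath a b) (\<lambda>s. integral {0..1} (g s)) + contour_integral (linepath b c) (\<lambda>s. integral {0..1} (g s)) +
       contour_integral (linepath c a) (\<lambda>s. integral {0..1} (g s))
       = contour_integral (linepath 0 1) (\<lambda>z. ?h a b z + ?h b c z + ?h c a z)"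
      unfolding swap[OF seg(1)] swap[OF seg(2)] swap[OF seg(3)]
      by (simp add: contour_integral_add int[OF seg(1)] int[OF seg(2)] int[OF seg(3)] contour_integrable_add)
    also have "\<dots> = contour_integral (linepath 0 1) (\<lambda>z. 0)"
      using zero by (intro contour_integral_eq) simp
    finally show "contour_integral (linepath a b) (\<lambda>s. integral {0..1} (g s)) + contour_integral (linepath b c) (\<lambda>s. integral {0..1} (g s)) +
       contour_integral (linepath c a) (\<lambda>s. integral {0..1} (g s)) = 0" by simp
  qed
qed

lemma hol_integral:
  assumes cont: "continuous_on (polydisc n R \<times> {0..1}) (\<lambda>(z, \<theta>). K \<theta> z)"
    and hol: "\<And>\<theta>. \<theta> \<in> {0..1} \<Longrightarrow> hol n R (K \<theta>)"
  shows "hol n R (\<lambda>z. integral {0..1::real} (\<lambda>\<theta>. K \<theta> z))"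
  unfolding hol_def
proof (intro conjI allI impI)
  show "continuous_on (polydisc n R) (\<lambda>z. integral {0..1} (\<lambda>\<theta>. K \<theta> z))"
    using integral_continuous_on_param[of _ "0::real" 1 "\<lambda>z \<theta>. K \<theta> z"] cont by simp
next
  fix z w :: "nat \<Rightarrow> complex"
  let ?S = "{s. (\<lambda>i. z i + s * w i) \<in> polydisc n R}"
  show "(\<lambda>s. integral {0..1} (\<lambda>\<theta>. K \<theta> (\<lambda>i. z i + s * w i))) holomorphic_on ?S"
  proof (rule holomorphic_on_integral_param[OF open_line_polydisc])
    show "continuous_on (?S \<times> {0..1}) (\<lambda>(s, \<theta>). K \<theta> (\<lambda>i. z i + s * w i))"
      unfolding case_prod_unfold
      by (rule continuous_on_compose2[OF cont[unfolded case_prod_unfold], of _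
            "\<lambda>x. (\<lambda>i. z i + fst x * w i, snd x)", simplified])
         (auto intro!: continuous_intros continuous_on_coordinatewise_then_product)
    show "(\<lambda>s. K \<theta> (\<lambda>i. z i + s * w i)) holomorphic_on ?S" if "\<theta> \<in> {0..1}" for \<theta>
      using hol[OF that] unfolding hol_def by auto
  qed
next
  fix z z' :: "nat \<Rightarrow> complex" assume "\<forall>i\<le>n. z i = z' i"
  then show "integral {0..1} (\<lambda>\<theta>. K \<theta> z) = integral {0..1} (\<lambda>\<theta>. K \<theta> z')"
    by (intro integral_cong hol_cong_point[OF hol]) auto
qed

section \<open>Cauchy integrals and division by the first coordinate\<close>

text \<open>
Contour integrals over circles are written as integrals over \<open>[0, 1]\<close>, so that \<open>hol_integral\<close> applies to them.
\<close>

definition circ :: "real \<Rightarrow> real \<Rightarrow> complex" where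
  "circ r \<theta> = of_real r * exp (2 * of_real pi * \<i> * of_real \<theta>)"

lemma norm_circ [simp]: "r \<ge> 0 \<Longrightarrow> norm (circ r \<theta>) = r"
  by (simp add: circ_def norm_mult)

lemma continuous_on_circ [continuous_intros]: "continuous_on S f \<Longrightarrow> continuous_on S (\<lambda>x. circ r (f x))"
  unfolding circ_def by (intro continuous_intros)

lemma contour_integral_circ:
  "contour_integral (circlepath 0 r) f = 2 * of_real pi * \<i> * integral {0..1} (\<lambda>\<theta>. circ r \<theta> * f (circ r \<theta>))"
proof -
  have "contour_integral (circlepath 0 r) f
      = integral {0..1} (\<lambda>\<theta>. (2 * of_real pi * \<i>) * (circ r \<theta> * f (circ r \<theta>)))"
    unfolding contour_integral_integral
    unfolding vector_derivative_circlepath by (rule integral_cong) (simp add: circlepath circ_def algebra_simps)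
  then show ?thesis by simp
qed

lemma Cauchy_integral_circ:
  assumes "f holomorphic_on cball 0 r" "norm w < r"
  shows "integral {0..1} (\<lambda>\<theta>. circ r \<theta> / (circ r \<theta> - w) * f (circ r \<theta>)) = f w"
proof -
  have "((\<lambda>u. f u / (u - w)) has_contour_integral (2 * of_real pi * \<i> * f w)) (circlepath 0 r)"
    using Cauchy_integral_circlepath_simple[of f 0 r w] assms by simp
  from contour_integral_unique[OF this]
  have "integral {0..1} (\<lambda>\<theta>. circ r \<theta> * (f (circ r \<theta>) / (circ r \<theta> - w))) = f w"
    unfolding contour_integral_circ by simp
  then show ?thesis by (simp add: field_simps)
qed

lemma Cauchy_deriv_circ:
  assumes "f holomorphic_on cball 0 r" "norm w < r"
  shows "integral {0..1} (\<lambda>\<theta>. circ r \<theta> / (circ r \<theta> - w)\<^sup>2 * f (circ r \<theta>)) = deriv f w"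
proof -
  have "(f has_field_derivative (1 / (2 * of_real pi * \<i>) * contour_integral(circlepath 0 r) (\<lambda>u. f u / (u-w)^2))) (at w)"
    using assms by (intro Cauchy_derivative_integral_circlepath holomorphic_on_imp_continuous_on)
      (auto intro: holomorphic_on_subset)
  from DERIV_imp_deriv[OF this]
  have "integral {0..1} (\<lambda>\<theta>. circ r \<theta> * (f (circ r \<theta>) / (circ r \<theta> - w)\<^sup>2)) = deriv f w"
    unfolding contour_integral_circ by simp
  then show ?thesis by (simp add: field_simps)
qed

lemma polydisc_upd: "z \<in> polydisc n R \<Longrightarrow> norm \<zeta> < R \<Longrightarrow> z(k := \<zeta>) \<in> polydisc n R"
  by (simp add: polydisc_def)

lemma polydisc_Suc_upd: "z(Suc n := \<zeta>) \<in> polydisc (Suc n) R \<longleftrightarrow> z \<in> polydisc n R \<and> norm \<zeta> < R"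
  by (auto simp: polydisc_def le_Suc_eq)

lemma fun_upd_affine:
  "(\<lambda>i. z i + s * w i)(k := \<zeta>) = (\<lambda>i. (z(k := \<zeta>)) i + s * (w(k := 0)) i)" for s :: complex
  by auto

lemma hol_fun_upd: "hol n R F \<Longrightarrow> norm \<zeta> < R \<Longrightarrow> hol n R (\<lambda>z. F (z(k := \<zeta>)))"
  by (rule hol_compose_affine[where T = "\<lambda>z. z(k := \<zeta>)" and T' = "\<lambda>w. w(k := 0)"])
     (auto intro!: polydisc_upd fun_upd_affine continuous_on_fun_upd continuous_on_id continuous_on_const)

lemma hol_drop_last: "hol (Suc n) R F \<Longrightarrow> norm \<zeta> < R \<Longrightarrow> hol n R (\<lambda>z. F (z(Suc n := \<zeta>)))"
  by (rule hol_compose_affine[where T = "\<lambda>z. z(Suc n := \<zeta>)" and T' = "\<lambda>w. w(Suc n := 0)"])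
     (auto simp: polydisc_Suc_upd intro!: fun_upd_affine continuous_on_fun_upd continuous_on_id continuous_on_const)

lemma hol_slice:
  assumes "hol n R F" "\<And>\<zeta>. norm \<zeta> < R \<Longrightarrow> z(k := \<zeta>) \<in> polydisc n R"
  shows "(\<lambda>\<zeta>. F (z(k := \<zeta>))) holomorphic_on ball 0 R"
proof -
  have eq: "(\<lambda>i. (z(k := 0)) i + \<zeta> * ((\<lambda>i. 0)(k := 1)) i) = z(k := \<zeta>)" for \<zeta>
    by auto
  have "(\<lambda>\<zeta>. F (z(k := \<zeta>))) holomorphic_on {s. z(k := s) \<in> polydisc n R}"
    using holD(2)[OF assms(1), of "z(k := 0)" "(\<lambda>i. 0)(k := 1)"] unfolding eq .
  then show ?thesis by (rule holomorphic_on_subset) (auto intro: assms(2))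
qed

text \<open>
If \<open>F\<close> is expanded in powers of the coordinate \<open>0\<close>, this is the series from order \<open>k\<close> on, divided by
\<open>z\<^sub>0\<^sup>k\<close>; at \<open>z\<^sub>0 = 0\<close> it is the \<open>k\<close>-th Taylor coefficient. The Cauchy kernel makes it visibly holomorphic in all coordinates.
\<close>

definition taylor_tail :: "real \<Rightarrow> nat \<Rightarrow> ((nat \<Rightarrow> complex) \<Rightarrow> complex) \<Rightarrow> (nat \<Rightarrow> complex) \<Rightarrow> complex" where
  "taylor_tail r k F z = integral {0..1} (\<lambda>\<theta>. circ r \<theta> / (circ r \<theta> - z 0) * F (z(0 := circ r \<theta>)) / circ r \<theta> ^ k)"

lemma circ_minus_nz: "z \<in> polydisc n r \<Longrightarrow> k \<le> n \<Longrightarrow> circ r \<theta> - z k \<noteq> 0"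
proof
  assume "z \<in> polydisc n r" "k \<le> n" "circ r \<theta> - z k = 0"
  then have "norm (z k) < r" "circ r \<theta> = z k" by (auto simp: polydisc_def)
  moreover then have "r \<ge> 0" using norm_ge_zero[of "z k"] by linarith
  ultimately show False using norm_circ[of r \<theta>] by simp
qed

lemma circ_neq: "z \<in> polydisc n r \<Longrightarrow> circ r \<theta> \<noteq> z 0"
  using circ_minus_nz[of z n r 0 \<theta>] by auto

lemma circ_nz: "r > 0 \<Longrightarrow> circ r \<theta> \<noteq> 0"
  by (simp add: circ_def)

lemma continuous_on_hol_upd:
  assumes "hol n R F" "0 < r" "r < R"
  shows "continuous_on (polydisc n r \<times> T) (\<lambda>p. F ((fst p)(k := circ r (snd p))))"
  by (rule hol_continuous_on[OF assms(1)])
     (use assms polydisc_mono[of n n r R] in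
      \<open>auto intro!: polydisc_upd continuous_on_fun_upd continuous_on_circ continuous_on_fst continuous_on_snd continuous_on_id\<close>)

lemma continuous_on_fst_coord: "continuous_on S (\<lambda>p::(nat \<Rightarrow> complex) \<times> real. fst p k)"
  by (rule continuous_on_product_then_coordinatewise, rule continuous_on_fst, rule continuous_on_id)

lemma hol_taylor_tail:
  assumes "hol n R F" "0 < r" "r < R"
  shows "hol n r (taylor_tail r k F)"
  unfolding taylor_tail_def
proof (rule hol_integral)
  show "continuous_on (polydisc n r \<times> {0..1})
     (\<lambda>(z, \<theta>). circ r \<theta> / (circ r \<theta> - z 0) * F (z(0 := circ r \<theta>)) / circ r \<theta> ^ k)"
    unfolding case_prod_unfold using assms
    by (intro continuous_intros continuous_on_hol_upd continuous_on_fst_coord)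
       (auto simp: circ_nz circ_neq)
  fix \<theta>
  show "hol n r (\<lambda>z. circ r \<theta> / (circ r \<theta> - z 0) * F (z(0 := circ r \<theta>)) / circ r \<theta> ^ k)"
    using assms by (intro hol_divide hol_mult hol_diff hol_const hol_coord hol_mono[OF hol_fun_upd[OF assms(1)]])
       (auto simp: circ_nz dest: circ_neq[of _ n r \<theta>])
qed

lemma taylor_tail_0:
  assumes "hol n R F" "r < R" "z \<in> polydisc n r"
  shows "taylor_tail r 0 F z = F z"
proof -
  have "(\<lambda>\<zeta>. F (z(0 := \<zeta>))) holomorphic_on ball 0 R"
    using assms polydisc_mono[of n n r R] by (intro hol_slice polydisc_upd) auto
  then have "(\<lambda>\<zeta>. F (z(0 := \<zeta>))) holomorphic_on cball 0 r"
    by (rule holomorphic_on_subset) (use assms in auto)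
  moreover have "norm (z 0) < r" using assms(3) by (simp add: polydisc_def)
  ultimately show ?thesis
    using Cauchy_integral_circ[of "\<lambda>\<zeta>. F (z(0 := \<zeta>))" r "z 0"] by (simp add: taylor_tail_def)
qed

lemma continuous_on_tail_integrand:
  assumes "hol n R F" "0 < r" "r < R" "z \<in> polydisc n r"
  shows "continuous_on {0..1} (\<lambda>\<theta>. circ r \<theta> / (circ r \<theta> - z 0) * F (z(0 := circ r \<theta>)) / circ r \<theta> ^ k)"
  using assms polydisc_mono[of n n r R]
  by (intro continuous_intros hol_continuous_on[OF assms(1)])
     (auto simp: circ_nz circ_neq intro!: continuous_on_fun_upd continuous_on_const continuous_on_circ continuous_on_id polydisc_upd)

lemma taylor_tail_Suc:
  assumes "hol n R F" "0 < r" "r < R" "z \<in> polydisc n r"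
  shows "taylor_tail r k F z = taylor_tail r k F (z(0 := 0)) + z 0 * taylor_tail r (Suc k) F z"
proof -
  let ?h = "\<lambda>k z \<theta>. circ r \<theta> / (circ r \<theta> - z 0) * F (z(0 := circ r \<theta>)) / circ r \<theta> ^ k"
  have z0: "z(0 := 0) \<in> polydisc n r" using assms by (intro polydisc_upd) auto
  have "?h k z \<theta> = ?h k (z(0 := 0)) \<theta> + z 0 * ?h (Suc k) z \<theta>" for \<theta>
    using circ_nz[OF assms(2), of \<theta>] circ_minus_nz[OF assms(4), of 0 \<theta>]
    by (simp add: field_simps)
  then have "taylor_tail r k F z = integral {0..1} (\<lambda>\<theta>. ?h k (z(0 := 0)) \<theta> + z 0 * ?h (Suc k) z \<theta>)"
    unfolding taylor_tail_def by simp
  also have "\<dots> = integral {0..1} (?h k (z(0 := 0))) + integral {0..1} (\<lambda>\<theta>. z 0 * ?h (Suc k) z \<theta>)"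
    by (intro integral_add integrable_continuous_real continuous_on_mult_left continuous_on_tail_integrand[OF assms(1-3)] z0 assms(4))
  finally show ?thesis unfolding taylor_tail_def by simp
qed

abbreviation cpt :: "(nat \<Rightarrow> real) \<Rightarrow> nat \<Rightarrow> complex" where
  "cpt a \<equiv> (\<lambda>i. complex_of_real (a i))"

lemma cpt_upd: "(cpt a)(k := complex_of_real x) = cpt (a(k := x))"
  by auto

text \<open>
Take the first Taylor coefficient in the coordinate \<open>0\<close> that is nonzero at some real point. It exists: otherwise
\<open>F(x) = x\<^sub>0\<^sup>k R\<^sub>k(x)\<close> for all \<open>k\<close>, where \<open>|R\<^sub>k(x)| \<le> M / r\<^sup>k\<close> and \<open>|x\<^sub>0| < r\<close>, which forces \<open>F(x) = 0\<close>.
\<close>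

lemma hol_divide_power:
  assumes F: "hol n R F" "0 < r" "r < R" and x: "cpt x \<in> polydisc n r" "F (cpt x) \<noteq> 0"
  obtains k G v where "hol n r G" "\<And>a. cpt a \<in> polydisc n r \<Longrightarrow> F (cpt a) = of_real (a 0) ^ k * G (cpt a)"
    "cpt v \<in> polydisc n r" "v 0 = 0" "G (cpt v) \<noteq> 0"
proof -
  define P where "P k \<longleftrightarrow> (\<exists>a. cpt a \<in> polydisc n r \<and> taylor_tail r k F (cpt (a(0 := 0))) \<noteq> 0)" for k
  have expand: "F (cpt a) = of_real (a 0) ^ k * taylor_tail r k F (cpt a)"
    if "\<forall>j<k. \<not> P j" "cpt a \<in> polydisc n r" for k a
    using that(1)
  proof (induction k)
    case 0
    show ?case using taylor_tail_0[OF F(1,3) that(2)] by simp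
  next
    case (Suc k)
    have "\<not> P k" using Suc.prems by simp
    then have "taylor_tail r k F (cpt (a(0 := 0))) = 0"
      using that(2) unfolding P_def by blast
    then have "taylor_tail r k F ((cpt a)(0 := 0)) = 0"
      using cpt_upd[of a 0 0] by simp
    then show ?case using Suc taylor_tail_Suc[OF F that(2), of k] by simp
  qed
  have "\<exists>k. P k"
  proof (rule ccontr)
    assume "\<not> (\<exists>k. P k)"
    then have e: "F (cpt x) = of_real (x 0) ^ k * taylor_tail r k F (cpt x)" for k
      using expand x(1) by blast
    let ?h = "\<lambda>\<theta>. circ r \<theta> / (circ r \<theta> - cpt x 0) * F ((cpt x)(0 := circ r \<theta>))"
    have c: "continuous_on {0..1} ?h"
      using continuous_on_tail_integrand[OF F x(1), of 0] by simp
    have "bounded (?h ` {0..1})"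
      by (intro compact_imp_bounded compact_continuous_image c) auto
    then obtain M where M: "\<And>\<theta>. \<theta> \<in> {0..1} \<Longrightarrow> norm (?h \<theta>) \<le> M"
      unfolding bounded_iff by blast
    have bound: "norm (taylor_tail r k F (cpt x)) \<le> M / r ^ k" for k
    proof -
      have "norm (integral {0..1} (\<lambda>\<theta>. ?h \<theta> / circ r \<theta> ^ k)) \<le> integral {0..1::real} (\<lambda>\<theta>. M / r ^ k)"
      proof (rule integral_norm_bound_integral)
        show "(\<lambda>\<theta>. ?h \<theta> / circ r \<theta> ^ k) integrable_on {0..1}"
          by (rule integrable_continuous_real[OF continuous_on_tail_integrand[OF F x(1)]])
        show "norm (?h \<theta> / circ r \<theta> ^ k) \<le> M / r ^ k" if "\<theta> \<in> {0..1}" for \<theta>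
        proof -
          have "norm (?h \<theta> / circ r \<theta> ^ k) = norm (?h \<theta>) / r ^ k"
            unfolding norm_divide[of "?h \<theta>"] norm_power using F(2) by simp
          then show ?thesis using divide_right_mono[OF M[OF that], of "r ^ k"] F(2) by simp
        qed
      qed auto
      then show ?thesis unfolding taylor_tail_def by simp
    qed
    define q where "q = \<bar>x 0\<bar> / r"
    have q: "0 \<le> q" "q < 1" using x(1) F(2) by (auto simp: q_def polydisc_def)
    have "norm (F (cpt x)) \<le> M * q ^ k" for k
    proof -
      have "norm (F (cpt x)) = \<bar>x 0\<bar> ^ k * norm (taylor_tail r k F (cpt x))"
        by (subst e[of k]) (simp add: norm_mult norm_power)
      also have "\<dots> \<le> \<bar>x 0\<bar> ^ k * (M / r ^ k)" by (intro mult_left_mono bound) auto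
      finally show ?thesis by (simp add: q_def power_divide field_simps)
    qed
    moreover have "(\<lambda>k. M * q ^ k) \<longlonglongrightarrow> M * 0"
      using q by (intro tendsto_intros LIMSEQ_power_zero) auto
    ultimately have "norm (F (cpt x)) \<le> 0"
      using LIMSEQ_le_const[of "\<lambda>k. M * q ^ k" "M * 0" "norm (F (cpt x))"] by auto
    with x(2) show False by simp
  qed
  then obtain k where k: "P k" "\<forall>j<k. \<not> P j" using exists_least_iff[of P] by auto
  then obtain a where a: "cpt a \<in> polydisc n r" "taylor_tail r k F (cpt (a(0 := 0))) \<noteq> 0"
    unfolding P_def by blast
  show ?thesis
  proof (rule that[of "taylor_tail r k F" k "a(0 := 0)"])
    show "cpt (a(0 := 0)) \<in> polydisc n r"
      using polydisc_upd[OF a(1), of 0 0] F(2) cpt_upd[of a 0 0] by simp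
  qed (use a k expand hol_taylor_tail[OF F] in auto)
qed

section \<open>Real zeros along a path\<close>

text \<open>
This is Hurwitz's theorem in the weak form that a zero cannot disappear: on the small circle the values stay away from
zero while the value at the centre becomes small, so the minimum principle gives a zero.
\<close>

lemma zero_persists:
  fixes f :: "real \<Rightarrow> complex \<Rightarrow> complex"
  assumes cont: "continuous_on (I \<times> ball 0 R) (\<lambda>(s, \<zeta>). f s \<zeta>)"
    and hol: "\<And>s. s \<in> I \<Longrightarrow> f s holomorphic_on ball 0 R"
    and s0: "s0 \<in> I" and e: "0 < e" "cball w e \<subseteq> ball 0 R"
    and zero: "f s0 w = 0" and nz: "\<And>\<zeta>. \<zeta> \<in> sphere w e \<Longrightarrow> f s0 \<zeta> \<noteq> 0"
  shows "\<forall>\<^sub>F s in at s0 within I. \<exists>\<zeta>\<in>ball w e. f s \<zeta> = 0"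
proof -
  have c0: "continuous_on (sphere w e) (f s0)"
    using hol[OF s0] e holomorphic_on_imp_continuous_on continuous_on_subset sphere_cball
    by (metis order_trans)
  have "compact ((\<lambda>\<zeta>. norm (f s0 \<zeta>)) ` sphere w e)"
    by (intro compact_continuous_image continuous_intros c0) auto
  moreover have "sphere w e \<noteq> {}" using e(1) by simp
  ultimately obtain m where m: "m \<in> (\<lambda>\<zeta>. norm (f s0 \<zeta>)) ` sphere w e"
      "\<And>t. t \<in> (\<lambda>\<zeta>. norm (f s0 \<zeta>)) ` sphere w e \<Longrightarrow> m \<le> t"
    using compact_attains_inf[of "(\<lambda>\<zeta>. norm (f s0 \<zeta>)) ` sphere w e"] by blast
  have mpos: "m > 0" using m(1) nz by auto
  have "continuous_on (I \<times> cball w e) (\<lambda>(s, \<zeta>). f s \<zeta>)"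
    using cont e(2) continuous_on_subset by (metis Sigma_mono subset_refl)
  then obtain X where X: "s0 \<in> X" "open X" and close: "\<forall>s\<in>X \<inter> I. \<forall>\<zeta>\<in>cball w e. dist (f s \<zeta>) (f s0 \<zeta>) \<le> m / 3"
    using continuous_on_prod_compactE[of I "cball w e" "\<lambda>(s, \<zeta>). f s \<zeta>" s0 "m / 3"] s0 mpos by auto
  have "\<exists>\<zeta>\<in>ball w e. f s \<zeta> = 0" if s: "s \<in> X" "s \<in> I" for s
  proof -
    have d: "norm (f s \<zeta> - f s0 \<zeta>) \<le> m / 3" if "\<zeta> \<in> cball w e" for \<zeta>
      using close s that by (auto simp: dist_norm)
    have h: "f s holomorphic_on cball w e" using hol[OF s(2)] e(2) holomorphic_on_subset by blast
    show ?thesis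
    proof (rule holomorphic_contract_to_zero[of w e "f s"])
      show "norm (f s w) < norm (f s \<zeta>)" if "norm (w - \<zeta>) = e" for \<zeta>
      proof -
        have "\<zeta> \<in> sphere w e" using that by (simp add: dist_norm)
        then have "m \<le> norm (f s0 \<zeta>)" "\<zeta> \<in> cball w e" using m(2) by auto
        moreover have "norm (f s0 \<zeta>) \<le> norm (f s \<zeta>) + norm (f s \<zeta> - f s0 \<zeta>)"
          by (metis norm_triangle_sub norm_minus_commute)
        moreover have "norm (f s w) \<le> m / 3" using d[of w] zero e(1) by simp
        ultimately show ?thesis using d[of \<zeta>] mpos by linarith
      qed
    qed (use h holomorphic_on_imp_continuous_on holomorphic_on_subset ball_subset_cball e(1) in blast)+
  qed
  moreover have "\<forall>\<^sub>F s in at s0 within I. s \<in> X \<and> s \<in> I"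
    using X unfolding eventually_at_topological by blast
  ultimately show ?thesis by (auto elim: eventually_mono)
qed

lemma nonzero_persists:
  fixes f :: "real \<Rightarrow> complex \<Rightarrow> complex"
  assumes cont: "continuous_on (I \<times> ball 0 R) (\<lambda>(s, \<zeta>). f s \<zeta>)"
    and s0: "s0 \<in> I" and K: "compact K" "K \<subseteq> ball 0 R"
    and nz: "\<And>\<zeta>. \<zeta> \<in> K \<Longrightarrow> f s0 \<zeta> \<noteq> 0"
  shows "\<forall>\<^sub>F s in at s0 within I. \<forall>\<zeta>\<in>K. f s \<zeta> \<noteq> 0"
proof (cases "K = {}")
  case False
  have contK: "continuous_on (I \<times> K) (\<lambda>(s, \<zeta>). f s \<zeta>)"
    using cont K(2) continuous_on_subset by (metis Sigma_mono subset_refl)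
  have "continuous_on K (f s0)"
  proof -
    have "continuous_on K (\<lambda>\<zeta>. (s0, \<zeta>))"
      by (rule continuous_on_Pair[OF continuous_on_const continuous_on_id])
    from continuous_on_compose2[OF contK this] s0 show ?thesis by auto
  qed
  then have "compact ((\<lambda>\<zeta>. norm (f s0 \<zeta>)) ` K)"
    by (intro compact_continuous_image continuous_intros K)
  then obtain m where m: "m \<in> (\<lambda>\<zeta>. norm (f s0 \<zeta>)) ` K"
      "\<And>t. t \<in> (\<lambda>\<zeta>. norm (f s0 \<zeta>)) ` K \<Longrightarrow> m \<le> t"
    using compact_attains_inf[of "(\<lambda>\<zeta>. norm (f s0 \<zeta>)) ` K"] False by blast
  have mpos: "m > 0" using m(1) nz by auto
  obtain X where X: "s0 \<in> X" "open X" and close: "\<forall>s\<in>X \<inter> I. \<forall>\<zeta>\<in>K. dist (f s \<zeta>) (f s0 \<zeta>) \<le> m / 3"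
    using continuous_on_prod_compactE[OF contK K(1) s0, of "m / 3"] mpos by auto
  have "f s \<zeta> \<noteq> 0" if "s \<in> X" "s \<in> I" "\<zeta> \<in> K" for s \<zeta>
    using close that m(2)[of "norm (f s0 \<zeta>)"] mpos by (force simp: dist_norm)
  moreover have "\<forall>\<^sub>F s in at s0 within I. s \<in> X \<and> s \<in> I"
    using X unfolding eventually_at_topological by blast
  ultimately show ?thesis by (auto elim!: eventually_mono)
qed simp

definition real_zeros :: "real \<Rightarrow> (complex \<Rightarrow> complex) \<Rightarrow> real set" where
  "real_zeros r q = {x. \<bar>x\<bar> < r \<and> q (of_real x) = 0}"

definition disc_zeros :: "real \<Rightarrow> (complex \<Rightarrow> complex) \<Rightarrow> complex set" where
  "disc_zeros r q = {\<zeta>. norm \<zeta> < r \<and> q \<zeta> = 0}"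

lemma real_zeros_disc_zeros: "x \<in> real_zeros r q \<longleftrightarrow> of_real x \<in> disc_zeros r q"
  by (simp add: real_zeros_def disc_zeros_def)

text \<open>
The factor \<open>2\<close> makes the closed discs of this radius around the points of \<open>Z\<close> disjoint.
\<close>

lemma separating_radius:
  fixes Z :: "complex set"
  assumes "finite Z" "0 < \<epsilon>" "\<And>w. w \<in> Z \<Longrightarrow> norm w < r"
  obtains e where "0 < e" "e \<le> \<epsilon>" "\<And>w w'. w \<in> Z \<Longrightarrow> w' \<in> Z \<Longrightarrow> w \<noteq> w' \<Longrightarrow> 2 * e < dist w w'"
    "\<And>w. w \<in> Z \<Longrightarrow> cball w e \<subseteq> ball 0 r"
proof -
  define D where "D = insert \<epsilon> ((\<lambda>(w, w'). dist w w') ` {p\<in>Z \<times> Z. fst p \<noteq> snd p} \<union> (\<lambda>w. r - norm w) ` Z)"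
  have fin: "finite D" using assms(1) unfolding D_def by simp
  have pos: "\<And>d. d \<in> D \<Longrightarrow> 0 < d" using assms unfolding D_def by (auto simp: algebra_simps)
  define e where "e = Min D / 3"
  have Mpos: "Min D > 0" by (rule pos, rule Min_in[OF fin]) (simp add: D_def)
  have le: "3 * e \<le> d" if "d \<in> D" for d using that fin by (simp add: e_def)
  show ?thesis
  proof (rule that[of e])
    show "0 < e" using Mpos by (simp add: e_def)
    then show "e \<le> \<epsilon>" using le[of \<epsilon>] by (simp add: D_def)
    show "2 * e < dist w w'" if "w \<in> Z" "w' \<in> Z" "w \<noteq> w'" for w w'
      using le[of "dist w w'"] that \<open>0 < e\<close> by (force simp: D_def)
    show "cball w e \<subseteq> ball 0 r" if "w \<in> Z" for w
    proof
      fix y assume "y \<in> cball w e"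
      then have "norm (y - w) \<le> e" by (simp add: dist_norm norm_minus_commute)
      moreover have "norm y \<le> norm w + norm (y - w)" by (rule norm_triangle_sub)
      moreover have "3 * e \<le> r - norm w" using le that by (simp add: D_def)
      ultimately show "y \<in> ball 0 r" using \<open>0 < e\<close> by simp
    qed
  qed
qed

text \<open>
Near \<open>s0\<close> every small disc around a zero of \<open>Q s0\<close> contains a zero of \<open>Q s\<close>, and there are none elsewhere. As the number
of distinct zeros does not change, each disc contains exactly one. A disc around a real zero is invariant under conjugation,
hence so is the zero in it, which is therefore real; a disc around a nonreal zero is disjoint from its conjugate and contains
no real point. A factor that vanishes at the old zero has a zero in the disc, and this must be the unique one.
\<close>

lemma real_zeros_local:
  fixes f :: "'i \<Rightarrow> real \<Rightarrow> complex \<Rightarrow> complex"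
  assumes fin: "finite \<Phi>"
    and cont: "\<And>i. i \<in> \<Phi> \<Longrightarrow> continuous_on (I \<times> ball 0 R) (\<lambda>(s, \<zeta>). f i s \<zeta>)"
    and hol: "\<And>i s. i \<in> \<Phi> \<Longrightarrow> s \<in> I \<Longrightarrow> f i s holomorphic_on ball 0 R"
    and r: "0 < r" "r < R"
  defines "Q \<equiv> \<lambda>s \<zeta>. \<Prod>i\<in>\<Phi>. f i s \<zeta>"
  assumes nz: "\<And>s \<zeta>. s \<in> I \<Longrightarrow> norm \<zeta> = r \<Longrightarrow> Q s \<zeta> \<noteq> 0"
    and card: "\<And>s. s \<in> I \<Longrightarrow> finite (disc_zeros r (Q s)) \<and> card (disc_zeros r (Q s)) = N"
    and sym: "\<And>s \<zeta>. s \<in> I \<Longrightarrow> \<zeta> \<in> disc_zeros r (Q s) \<Longrightarrow> cnj \<zeta> \<in> disc_zeros r (Q s)"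
    and s0: "s0 \<in> I" and \<epsilon>: "0 < \<epsilon>"
  shows "\<forall>\<^sub>F s in at s0 within I. \<exists>h. bij_betw h (real_zeros r (Q s0)) (real_zeros r (Q s)) \<and>
           (\<forall>x\<in>real_zeros r (Q s0). \<bar>h x - x\<bar> < \<epsilon> \<and>
             (\<forall>i\<in>\<Phi>. f i s (of_real (h x)) = 0 \<longleftrightarrow> f i s0 (of_real x) = 0))"
proof -
  let ?Z = "disc_zeros r (Q s0)"
  have Qz: "Q s \<zeta> = 0 \<longleftrightarrow> (\<exists>i\<in>\<Phi>. f i s \<zeta> = 0)" for s \<zeta>
    using fin by (auto simp: Q_def)
  have contQ: "continuous_on (I \<times> ball 0 R) (\<lambda>(s, \<zeta>). Q s \<zeta>)"
    using cont unfolding Q_def case_prod_unfold by (intro continuous_on_prod) auto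
  have holQ: "Q s holomorphic_on ball 0 R" if "s \<in> I" for s
    using hol that unfolding Q_def by (intro holomorphic_on_prod) auto
  have finZ: "finite ?Z" using card[OF s0] by blast
  obtain e where e: "0 < e" "e \<le> \<epsilon>"
      and sep: "\<And>w w'. w \<in> ?Z \<Longrightarrow> w' \<in> ?Z \<Longrightarrow> w \<noteq> w' \<Longrightarrow> 2 * e < dist w w'"
      and cb: "\<And>w. w \<in> ?Z \<Longrightarrow> cball w e \<subseteq> ball 0 r"
    using separating_radius[OF finZ \<epsilon>, of r] by (auto simp: disc_zeros_def)
  have cbR: "cball w e \<subseteq> ball 0 R" if "w \<in> ?Z" for w
    using cb[OF that] r(2) by (auto simp: subset_iff)
  have only: "\<zeta> = w" if "w \<in> ?Z" "\<zeta> \<in> cball w e" "Q s0 \<zeta> = 0" for w \<zeta>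
  proof (rule ccontr)
    assume "\<zeta> \<noteq> w"
    moreover have "\<zeta> \<in> ?Z" using that cb by (auto simp: disc_zeros_def subset_iff)
    ultimately show False using sep[OF that(1), of \<zeta>] that(2) e(1) by auto
  qed
  have ev1: "\<forall>\<^sub>F s in at s0 within I. \<forall>w\<in>?Z. \<exists>\<zeta>\<in>ball w e. Q s \<zeta> = 0"
  proof (rule eventually_ball_finite[OF finZ], rule ballI)
    fix w assume w: "w \<in> ?Z"
    have "Q s0 \<zeta> \<noteq> 0" if "\<zeta> \<in> sphere w e" for \<zeta>
      using only[OF w, of \<zeta>] that e(1) by auto
    then show "\<forall>\<^sub>F s in at s0 within I. \<exists>\<zeta>\<in>ball w e. Q s \<zeta> = 0"
      using w by (intro zero_persists[OF contQ holQ s0 e(1) cbR[OF w]]) (auto simp: disc_zeros_def)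
  qed
  have ev2: "\<forall>\<^sub>F s in at s0 within I. \<forall>\<zeta>\<in>cball 0 r - (\<Union>w\<in>?Z. ball w e). Q s \<zeta> \<noteq> 0"
  proof (rule nonzero_persists[OF contQ s0])
    show "compact (cball 0 r - (\<Union>w\<in>?Z. ball w e))" by (intro compact_diff) auto
    show "Q s0 \<zeta> \<noteq> 0" if "\<zeta> \<in> cball 0 r - (\<Union>w\<in>?Z. ball w e)" for \<zeta>
    proof
      assume "Q s0 \<zeta> = 0"
      with nz[OF s0, of \<zeta>] that have "\<zeta> \<in> ?Z"
        by (cases "norm \<zeta> = r") (auto simp: disc_zeros_def)
      with that e(1) show False by auto
    qed
  qed (use r in auto)
  have ev3: "\<forall>\<^sub>F s in at s0 within I. \<forall>w\<in>?Z. \<forall>i\<in>\<Phi>. f i s0 w = 0 \<longrightarrow> (\<exists>\<zeta>\<in>ball w e. f i s \<zeta> = 0)"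
  proof (rule eventually_ball_finite[OF finZ], rule ballI, rule eventually_ball_finite[OF fin], rule ballI)
    fix w i assume w: "w \<in> ?Z" and i: "i \<in> \<Phi>"
    show "\<forall>\<^sub>F s in at s0 within I. f i s0 w = 0 \<longrightarrow> (\<exists>\<zeta>\<in>ball w e. f i s \<zeta> = 0)"
    proof (cases "f i s0 w = 0")
      case True
      have "f i s0 \<zeta> \<noteq> 0" if "\<zeta> \<in> sphere w e" for \<zeta>
        using only[OF w, of \<zeta>] that e(1) i Qz[of s0 \<zeta>] by force
      then have "\<forall>\<^sub>F s in at s0 within I. \<exists>\<zeta>\<in>ball w e. f i s \<zeta> = 0"
        using True by (intro zero_persists[OF cont[OF i] hol[OF i] s0 e(1) cbR[OF w]]) auto
      then show ?thesis by (auto elim: eventually_mono)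
    qed simp
  qed
  have ev4: "\<forall>\<^sub>F s in at s0 within I. \<forall>w\<in>?Z. \<forall>i\<in>\<Phi>. f i s0 w \<noteq> 0 \<longrightarrow> (\<forall>\<zeta>\<in>cball w e. f i s \<zeta> \<noteq> 0)"
  proof (rule eventually_ball_finite[OF finZ], rule ballI, rule eventually_ball_finite[OF fin], rule ballI)
    fix w i assume w: "w \<in> ?Z" and i: "i \<in> \<Phi>"
    show "\<forall>\<^sub>F s in at s0 within I. f i s0 w \<noteq> 0 \<longrightarrow> (\<forall>\<zeta>\<in>cball w e. f i s \<zeta> \<noteq> 0)"
    proof (cases "f i s0 w = 0")
      case False
      have "f i s0 \<zeta> \<noteq> 0" if "\<zeta> \<in> cball w e" for \<zeta>
        using only[OF w, of \<zeta>] that False i Qz[of s0 \<zeta>] by force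
      then have "\<forall>\<^sub>F s in at s0 within I. \<forall>\<zeta>\<in>cball w e. f i s \<zeta> \<noteq> 0"
        by (intro nonzero_persists[OF cont[OF i] s0 _ cbR[OF w]]) auto
      then show ?thesis by (auto elim: eventually_mono)
    qed simp
  qed
  have evI: "\<forall>\<^sub>F s in at s0 within I. s \<in> I"
    by (simp add: eventually_at_filter)
  show ?thesis
    using ev1 ev2 ev3 ev4 evI
  proof eventually_elim
    case (elim s)
    obtain g where g: "\<And>w. w \<in> ?Z \<Longrightarrow> g w \<in> ball w e \<and> Q s (g w) = 0"
      using elim(1) by metis
    have gZ: "g w \<in> disc_zeros r (Q s)" if "w \<in> ?Z" for w
      using g[OF that] cb[OF that] by (auto simp: disc_zeros_def subset_iff)
    have sep': "w = w'" if "w \<in> ?Z" "w' \<in> ?Z" "\<zeta> \<in> cball w e" "\<zeta> \<in> cball w' e" for w w' \<zeta>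
    proof (rule ccontr)
      assume "w \<noteq> w'"
      then have "2 * e < dist w w'" using sep that by blast
      moreover have "dist w w' \<le> dist w \<zeta> + dist \<zeta> w'" by (rule dist_triangle)
      ultimately show False using that(3,4) by (simp add: dist_commute)
    qed
    have inj: "inj_on g ?Z"
      by (rule inj_onI) (metis g sep' ball_subset_cball subsetD)
    have img: "g ` ?Z = disc_zeros r (Q s)"
      using card[OF elim(5)] card[OF s0] card_image[OF inj] gZ
      by (intro card_subset_eq) auto
    have uniq: "\<zeta> = g w" if w: "w \<in> ?Z" and \<zeta>: "\<zeta> \<in> cball w e" "Q s \<zeta> = 0" for w \<zeta>
    proof -
      have "\<zeta> \<in> disc_zeros r (Q s)" using \<zeta> cb[OF w] by (auto simp: disc_zeros_def subset_iff)
      then obtain w' where w': "w' \<in> ?Z" "\<zeta> = g w'" using img by blast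
      then have "\<zeta> \<in> cball w' e" using g[OF w'(1)] by simp
      then have "w = w'" using sep' w w'(1) \<zeta>(1) by blast
      with w' show ?thesis by simp
    qed
    have real: "Im (g (of_real x)) = 0" if "x \<in> real_zeros r (Q s0)" for x
    proof -
      have w: "of_real x \<in> ?Z" using that by (simp add: real_zeros_disc_zeros)
      have "Q s (cnj (g (of_real x))) = 0"
        using sym[OF elim(5) gZ[OF w]] by (simp add: disc_zeros_def)
      moreover have "cnj (g (of_real x)) \<in> cball (of_real x) e"
      proof -
        have "norm (of_real x - cnj (g (of_real x))) = norm (cnj (of_real x - g (of_real x)))" by simp
        also have "\<dots> = norm (of_real x - g (of_real x))" by (rule complex_mod_cnj)
        finally show ?thesis using g[OF w] by (simp add: dist_norm)
      qed
      ultimately have "cnj (g (of_real x)) = g (of_real x)" using uniq[OF w] by blast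
      then show ?thesis by (simp add: complex_eq_iff)
    qed
    define h where "h x = Re (g (of_real x))" for x
    have gh: "g (of_real x) = of_real (h x)" if "x \<in> real_zeros r (Q s0)" for x
      using real[OF that] by (simp add: h_def complex_eq_iff)
    have "inj_on h (real_zeros r (Q s0))"
    proof (rule inj_onI)
      fix x y assume xy: "x \<in> real_zeros r (Q s0)" "y \<in> real_zeros r (Q s0)" "h x = h y"
      then have "g (of_real x) = g (of_real y)" using gh by simp
      from inj_onD[OF inj this] have "complex_of_real x = of_real y"
        using xy by (simp add: real_zeros_disc_zeros)
      then show "x = y" by simp
    qed
    moreover have "h ` real_zeros r (Q s0) = real_zeros r (Q s)"
    proof (rule equalityI; rule subsetI)
      fix y assume "y \<in> h ` real_zeros r (Q s0)"
      then obtain x where x: "x \<in> real_zeros r (Q s0)" "y = h x" by blast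
      then show "y \<in> real_zeros r (Q s)"
        using gZ[of "of_real x"] gh[OF x(1)] by (simp add: real_zeros_disc_zeros)
    next
      fix y assume "y \<in> real_zeros r (Q s)"
      then have "of_real y \<in> disc_zeros r (Q s)" by (simp add: real_zeros_disc_zeros)
      then obtain w where w: "w \<in> ?Z" "of_real y = g w" using img by blast
      have wb: "complex_of_real y \<in> cball w e" using g[OF w(1)] w(2) by auto
      have cw: "cnj w \<in> ?Z" by (rule sym[OF s0 w(1)])
      have "norm (cnj w - of_real y) = norm (cnj (w - of_real y))" by simp
      also have "\<dots> = norm (w - of_real y)" by (rule complex_mod_cnj)
      finally have "complex_of_real y \<in> cball (cnj w) e" using wb by (simp add: dist_norm)
      then have "w = cnj w" using sep'[OF w(1) cw wb] by simp
      then have wr: "w = of_real (Re w)" by (simp add: complex_eq_iff)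
      then have "Re w \<in> real_zeros r (Q s0)" using w(1) by (simp add: real_zeros_disc_zeros)
      moreover have "h (Re w) = y" unfolding h_def using wr w(2) by (metis Re_complex_of_real)
      ultimately show "y \<in> h ` real_zeros r (Q s0)" by blast
    qed
    moreover have "\<bar>h x - x\<bar> < \<epsilon> \<and> (\<forall>i\<in>\<Phi>. f i s (of_real (h x)) = 0 \<longleftrightarrow> f i s0 (of_real x) = 0)"
      if x: "x \<in> real_zeros r (Q s0)" for x
    proof (intro conjI ballI iffI)
      have w: "of_real x \<in> ?Z" using x by (simp add: real_zeros_disc_zeros)
      have b: "complex_of_real (h x) \<in> ball (of_real x) e" using g[OF w] gh[OF x] by simp
      have "dist (complex_of_real x) (of_real (h x)) = \<bar>x - h x\<bar>"
        by (metis dist_of_real dist_real_def)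
      then show "\<bar>h x - x\<bar> < \<epsilon>" using b e(2) by simp
      fix i assume i: "i \<in> \<Phi>"
      show "f i s0 (of_real x) = 0" if "f i s (of_real (h x)) = 0"
        using elim(4) w i b that by (meson ball_subset_cball subsetD)
      show "f i s (of_real (h x)) = 0" if zero: "f i s0 (of_real x) = 0"
      proof -
        obtain \<zeta> where \<zeta>: "\<zeta> \<in> ball (of_real x) e" "f i s \<zeta> = 0" using elim(3) w i zero by blast
        then have "\<zeta> = g (of_real x)" using uniq[OF w, of \<zeta>] Qz[of s \<zeta>] i by auto
        then show ?thesis using \<zeta>(2) gh[OF x] by simp
      qed
    qed
    ultimately show ?case unfolding bij_betw_def by blast
  qed
qed

text \<open>
The bijections provided locally are monotone as soon as they move points by less than half the smallest gap, so they match the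
zeros listed in increasing order. Everything that is locally constant is constant by connectedness of \<open>I\<close>.
\<close>

lemma real_zero_branches:
  fixes f :: "'i \<Rightarrow> real \<Rightarrow> complex \<Rightarrow> complex"
  assumes I: "connected I"
    and Q: "\<And>s. s \<in> I \<Longrightarrow> finite (real_zeros r (q s))"
    and loc: "\<And>s0 \<epsilon>. s0 \<in> I \<Longrightarrow> 0 < \<epsilon> \<Longrightarrow> \<forall>\<^sub>F s in at s0 within I.
           \<exists>h. bij_betw h (real_zeros r (q s0)) (real_zeros r (q s)) \<and>
           (\<forall>x\<in>real_zeros r (q s0). \<bar>h x - x\<bar> < \<epsilon> \<and>
             (\<forall>i\<in>\<Phi>. f i s (of_real (h x)) = 0 \<longleftrightarrow> f i s0 (of_real x) = 0))"
  obtains \<xi> :: "real \<Rightarrow> nat \<Rightarrow> real" and k :: nat where "\<And>s. s \<in> I \<Longrightarrow> \<xi> s ` {..<k} = real_zeros r (q s)"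
    "\<And>s i j. s \<in> I \<Longrightarrow> i < j \<Longrightarrow> j < k \<Longrightarrow> \<xi> s i < \<xi> s j"
    "\<And>j. j < k \<Longrightarrow> continuous_on I (\<lambda>s. \<xi> s j)"
    "\<And>j s s' i. j < k \<Longrightarrow> s \<in> I \<Longrightarrow> s' \<in> I \<Longrightarrow> i \<in> \<Phi> \<Longrightarrow>
       f i s (of_real (\<xi> s j)) = 0 \<longleftrightarrow> f i s' (of_real (\<xi> s' j)) = 0"
proof -
  define L where "L s = sorted_list_of_set (real_zeros r (q s))" for s
  define \<xi> where "\<xi> s j = L s ! j" for s j
  have L: "set (L s) = real_zeros r (q s)" "sorted (L s)" "distinct (L s)"
      "length (L s) = card (real_zeros r (q s))" if "s \<in> I" for s
    using Q[OF that] by (auto simp: L_def)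
  have local: "\<forall>\<^sub>F s in at s0 within I. length (L s) = length (L s0) \<and>
      (\<forall>j<length (L s0). \<bar>\<xi> s j - \<xi> s0 j\<bar> < \<epsilon> \<and>
         (\<forall>i\<in>\<Phi>. f i s (of_real (\<xi> s j)) = 0 \<longleftrightarrow> f i s0 (of_real (\<xi> s0 j)) = 0))"
    if s0: "s0 \<in> I" and \<epsilon>: "0 < \<epsilon>" for s0 \<epsilon>
  proof -
    define Z where "Z = real_zeros r (q s0)"
    have finZ: "finite Z" using Q[OF s0] by (simp add: Z_def)
    have fin': "finite (complex_of_real ` Z)" using finZ by simp
    have nb: "norm w < r" if "w \<in> complex_of_real ` Z" for w
      using that by (auto simp: Z_def real_zeros_def)
    obtain e where e: "0 < e" "e \<le> \<epsilon>"
        and sep: "\<And>w w'. w \<in> complex_of_real ` Z \<Longrightarrow> w' \<in> complex_of_real ` Z \<Longrightarrow> w \<noteq> w' \<Longrightarrow> 2 * e < dist w w'"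
        and "\<And>w. w \<in> complex_of_real ` Z \<Longrightarrow> cball w e \<subseteq> ball 0 r"
      by (rule separating_radius[OF fin' \<epsilon> nb]; (rule that)?; blast)
    have sep': "2 * e < y - x" if "x \<in> Z" "y \<in> Z" "x < y" for x y
    proof -
      have "2 * e < dist (complex_of_real x) (of_real y)" using that by (intro sep) auto
      also have "\<dots> = y - x" using that(3) dist_of_real[of x y, where 'a = complex] by (simp add: dist_real_def)
      finally show ?thesis .
    qed
    have evI: "\<forall>\<^sub>F s in at s0 within I. s \<in> I"
      by (simp add: eventually_at_filter)
    show ?thesis
      using loc[OF s0 e(1)] evI
    proof eventually_elim
      case (elim s)
      then obtain h where h: "bij_betw h Z (real_zeros r (q s))"
        and hx: "\<And>x. x \<in> Z \<Longrightarrow> \<bar>h x - x\<bar> < e"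
        and hf: "\<And>x i. x \<in> Z \<Longrightarrow> i \<in> \<Phi> \<Longrightarrow> f i s (of_real (h x)) = 0 \<longleftrightarrow> f i s0 (of_real x) = 0"
        unfolding Z_def by blast
      have setZ: "set (L s0) = Z" using L(1)[OF s0] by (simp add: Z_def)
      have mono: "h x < h y" if "x \<in> Z" "y \<in> Z" "x < y" for x y
        using hx[OF that(1)] hx[OF that(2)] sep'[OF that] by linarith
      have "sorted_wrt (<) (L s0)" using L(2,3)[OF s0] by (simp add: strict_sorted_iff)
      then have "sorted_wrt (\<lambda>x y. h x < h y) (L s0)"
        by (rule sorted_wrt_mono_rel[rotated]) (use mono setZ in auto)
      then have "sorted_wrt (<) (map h (L s0))" by (simp add: sorted_wrt_map)
      moreover have "set (map h (L s0)) = real_zeros r (q s)"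
        using h setZ by (simp add: bij_betw_def)
      ultimately have "map h (L s0) = L s"
        using L[OF elim(2)] by (intro sorted_distinct_set_unique) (auto simp: strict_sorted_iff)
      then have len: "length (L s) = length (L s0)" and eq: "\<And>j. j < length (L s0) \<Longrightarrow> \<xi> s j = h (\<xi> s0 j)"
        unfolding \<xi>_def by (metis length_map, metis nth_map)
      have "\<xi> s0 j \<in> Z" if "j < length (L s0)" for j
        using that setZ by (auto simp: \<xi>_def)
      then show ?case using len eq hx hf e(2) by (metis order_less_le_trans)
    qed
  qed
  show ?thesis
  proof (cases "I = {}")
    case True
    then show ?thesis using that[of "\<lambda>_ _. 0" 0] by simp
  next
    case False
    then obtain a where a: "a \<in> I" by blast
    define k where "k = length (L a)"
    have k: "length (L s) = k" if "s \<in> I" for s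
      unfolding k_def
    proof (rule connected_local_const[OF I that a], rule ballI)
      fix s0 assume "s0 \<in> I"
      from local[OF this, of 1] show "\<forall>\<^sub>F s in at s0 within I. length (L s0) = length (L s)"
        by (auto elim: eventually_mono)
    qed
    show ?thesis
    proof (rule that[of \<xi> k])
      show "\<xi> s ` {..<k} = real_zeros r (q s)" if "s \<in> I" for s
        using L(1)[OF that] k[OF that] by (auto simp: \<xi>_def set_conv_nth)
      show "\<xi> s i < \<xi> s j" if "s \<in> I" "i < j" "j < k" for s i j
        using L(2,3)[OF that(1)] k[OF that(1)] that(2,3) strict_sorted_iff[of "L s"]
        by (auto simp: \<xi>_def sorted_wrt_iff_nth_less)
      show "continuous_on I (\<lambda>s. \<xi> s j)" if "j < k" for j
        unfolding continuous_on_def tendsto_iff dist_real_def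
      proof (intro ballI allI impI)
        fix s0 and \<epsilon> :: real assume "s0 \<in> I" "0 < \<epsilon>"
        from local[OF this] k[OF \<open>s0 \<in> I\<close>] that
        show "\<forall>\<^sub>F s in at s0 within I. \<bar>\<xi> s j - \<xi> s0 j\<bar> < \<epsilon>"
          by (auto elim: eventually_mono)
      qed
      show "f i s (of_real (\<xi> s j)) = 0 \<longleftrightarrow> f i s' (of_real (\<xi> s' j)) = 0"
        if "j < k" "s \<in> I" "s' \<in> I" "i \<in> \<Phi>" for j s s' i
      proof (rule connected_local_const[OF I that(2,3)], rule ballI)
        fix s0 assume "s0 \<in> I"
        from local[OF this, of 1] k[OF \<open>s0 \<in> I\<close>] that
        show "\<forall>\<^sub>F s in at s0 within I.
            (f i s0 (of_real (\<xi> s0 j)) = 0) = (f i s (of_real (\<xi> s j)) = 0)"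
          by (auto elim: eventually_mono)
      qed
    qed
  qed
qed

text \<open>
If \<open>x\<close> is a zero at the parameter \<open>a\<close>, follow its branch. Otherwise \<open>x\<close> lies strictly between two neighbouring branches (or between a branch and an
end of the interval), and the point dividing this gap in the same ratio never meets a zero.
\<close>

lemma real_section:
  fixes f :: "'i \<Rightarrow> real \<Rightarrow> complex \<Rightarrow> complex"
  assumes fin: "finite \<Phi>" and I: "connected I"
    and cont: "\<And>i. i \<in> \<Phi> \<Longrightarrow> continuous_on (I \<times> ball 0 R) (\<lambda>(s, \<zeta>). f i s \<zeta>)"
    and hol: "\<And>i s. i \<in> \<Phi> \<Longrightarrow> s \<in> I \<Longrightarrow> f i s holomorphic_on ball 0 R"
    and r: "0 < r" "r < R"
  defines "Q \<equiv> \<lambda>s \<zeta>. \<Prod>i\<in>\<Phi>. f i s \<zeta>"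
  assumes nz: "\<And>s \<zeta>. s \<in> I \<Longrightarrow> norm \<zeta> = r \<Longrightarrow> Q s \<zeta> \<noteq> 0"
    and card: "\<And>s. s \<in> I \<Longrightarrow> finite (disc_zeros r (Q s)) \<and> card (disc_zeros r (Q s)) = N"
    and sym: "\<And>s \<zeta>. s \<in> I \<Longrightarrow> \<zeta> \<in> disc_zeros r (Q s) \<Longrightarrow> cnj \<zeta> \<in> disc_zeros r (Q s)"
    and a: "a \<in> I" and x: "\<bar>x\<bar> < r"
  obtains \<eta> where "continuous_on I \<eta>" "\<eta> a = x" "\<And>s. s \<in> I \<Longrightarrow> \<bar>\<eta> s\<bar> < r"
    "\<And>s i. s \<in> I \<Longrightarrow> i \<in> \<Phi> \<Longrightarrow> f i s (of_real (\<eta> s)) = 0 \<longleftrightarrow> f i a (of_real x) = 0"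
proof -
  have finr: "finite (real_zeros r (Q s))" if "s \<in> I" for s
  proof -
    have "complex_of_real ` real_zeros r (Q s) \<subseteq> disc_zeros r (Q s)"
      by (auto simp: real_zeros_disc_zeros)
    then have "finite (complex_of_real ` real_zeros r (Q s))" using card[OF that] finite_subset by blast
    then show ?thesis by (rule finite_imageD) (simp add: inj_on_def)
  qed
  have loc: "\<forall>\<^sub>F s in at s0 within I. \<exists>h. bij_betw h (real_zeros r (Q s0)) (real_zeros r (Q s)) \<and>
           (\<forall>x\<in>real_zeros r (Q s0). \<bar>h x - x\<bar> < \<epsilon> \<and>
             (\<forall>i\<in>\<Phi>. f i s (of_real (h x)) = 0 \<longleftrightarrow> f i s0 (of_real x) = 0))"
    if "s0 \<in> I" "0 < \<epsilon>" for s0 \<epsilon>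
    unfolding Q_def
    by (rule real_zeros_local[OF fin cont hol r nz[unfolded Q_def] card[unfolded Q_def]
          sym[unfolded Q_def] that])
  show ?thesis
  proof (rule real_zero_branches[OF I finr loc])
    fix \<xi> :: "real \<Rightarrow> nat \<Rightarrow> real" and k :: nat
    assume img: "\<And>s. s \<in> I \<Longrightarrow> \<xi> s ` {..<k} = real_zeros r (Q s)"
    and incr: "\<And>s i j. s \<in> I \<Longrightarrow> i < j \<Longrightarrow> j < k \<Longrightarrow> \<xi> s i < \<xi> s j"
    and contx: "\<And>j. j < k \<Longrightarrow> continuous_on I (\<lambda>s. \<xi> s j)"
    and stat: "\<And>j s s' i. j < k \<Longrightarrow> s \<in> I \<Longrightarrow> s' \<in> I \<Longrightarrow> i \<in> \<Phi> \<Longrightarrow>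
       f i s (of_real (\<xi> s j)) = 0 \<longleftrightarrow> f i s' (of_real (\<xi> s' j)) = 0"
    have bd: "\<bar>\<xi> s j\<bar> < r" if "s \<in> I" "j < k" for s j
      using img[OF that(1)] that(2) by (auto simp: real_zeros_def)
    show ?thesis
    proof (cases "x \<in> real_zeros r (Q a)")
      case True
      then obtain j where j: "j < k" "x = \<xi> a j" using img[OF a] by blast
      show ?thesis
      proof (rule that[of "\<lambda>s. \<xi> s j"])
        show "f i s (of_real (\<xi> s j)) = 0 \<longleftrightarrow> f i a (of_real x) = 0" if "s \<in> I" "i \<in> \<Phi>" for s i
          using stat[OF j(1) that(1) a that(2)] j(2) by simp
      qed (use j contx bd in auto)
    next
      case False
      define j where "j = (LEAST j. j = k \<or> x < \<xi> a j)"
      have jP: "j = k \<or> x < \<xi> a j" unfolding j_def by (rule LeastI[of _ k]) simp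
      have jle: "j \<le> k" unfolding j_def by (rule Least_le) simp
      have jmin: "\<not> x < \<xi> a i" if "i < j" for i
        using not_less_Least[of i "\<lambda>j. j = k \<or> x < \<xi> a j"] that unfolding j_def by blast
      define lo where "lo s = (if j = 0 then - r else \<xi> s (j - 1))" for s
      have jk: "j = 0 \<or> j - Suc 0 < k" using jle by linarith
      define up where "up s = (if j = k then r else \<xi> s j)" for s
      have lo_up: "lo s < up s" "- r \<le> lo s" "up s \<le> r" if "s \<in> I" for s
        using incr[OF that, of "j - 1" j] bd[OF that, of "j - 1"] bd[OF that, of j] jle jk r(1)
        by (auto simp: lo_def up_def split: if_splits)
      have gap: "y \<notin> real_zeros r (Q s)" if s: "s \<in> I" and y: "lo s < y" "y < up s" for s y
      proof
        assume "y \<in> real_zeros r (Q s)"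
        then obtain i where i: "i < k" "y = \<xi> s i" using img[OF s] by blast
        consider "i < j - 1" | "i = j - 1" "0 < j" | "i = j" | "j < i" by linarith
        then show False
        proof cases
          case 1
          then have "0 < j" "j - 1 < k" using jle by linarith+
          then show False using incr[OF s 1] y(1) i(2) by (simp add: lo_def)
        next
          case 2
          then show False using y(1) i(2) by (simp add: lo_def)
        next
          case 3
          then show False using y(2) i by (simp add: up_def)
        next
          case 4
          then show False using incr[OF s 4 i(1)] y(2) i by (simp add: up_def)
        qed
      qed
      have "x \<noteq> \<xi> a (j - 1)" if "0 < j"
        using False img[OF a] that jle by auto
      then have xlo: "lo a < x" using jmin[of "j - 1"] x by (auto simp: lo_def)
      have xup: "x < up a" using jP x by (auto simp: up_def)
      define l where "l = (x - lo a) / (up a - lo a)"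
      have l: "0 < l" "l < 1" using xlo xup by (auto simp: l_def)
      define \<eta> where "\<eta> s = lo s + l * (up s - lo s)" for s
      have between: "lo s < \<eta> s" "\<eta> s < up s" if "s \<in> I" for s
      proof -
        show "lo s < \<eta> s" using l lo_up(1)[OF that] by (simp add: \<eta>_def)
        have "l * (up s - lo s) < 1 * (up s - lo s)"
          using l lo_up(1)[OF that] by (intro mult_strict_right_mono) auto
        then show "\<eta> s < up s" by (simp add: \<eta>_def)
      qed
      have nonzero: "f i s (of_real y) \<noteq> 0" if "s \<in> I" "i \<in> \<Phi>" "lo s < y" "y < up s" for s i y
      proof
        assume "f i s (of_real y) = 0"
        then have "Q s (of_real y) = 0" unfolding Q_def using fin that(2) by (auto intro: prod_zero)
        moreover have "\<bar>y\<bar> < r" using lo_up[OF that(1)] that by auto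
        ultimately show False using gap[OF that(1,3,4)] by (simp add: real_zeros_def)
      qed
      have "continuous_on I lo"
        by (cases "j = 0") (use contx[of "j - Suc 0"] jk in \<open>auto simp: lo_def[abs_def]\<close>)
      moreover have "continuous_on I up"
        by (cases "j = k") (use contx[of j] jle in \<open>auto simp: up_def[abs_def]\<close>)
      ultimately have "continuous_on I \<eta>" unfolding \<eta>_def by (intro continuous_intros)
      moreover have "\<eta> a = x" using lo_up(1)[OF a] by (simp add: \<eta>_def l_def)
      moreover have "\<bar>\<eta> s\<bar> < r" if "s \<in> I" for s
        using between[OF that] lo_up[OF that] by auto
      moreover have "f i s (of_real (\<eta> s)) = 0 \<longleftrightarrow> f i a (of_real x) = 0" if "s \<in> I" "i \<in> \<Phi>" for s i
        using nonzero[OF that between[OF that(1)]] nonzero[OF a that(2) xlo xup] by simp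
      ultimately show ?thesis by (rule that)
    qed
  qed
qed

section \<open>Counting distinct zeros\<close>

text \<open>
For the power sums of a finite set of points with nonzero weights, the rank of the Hankel matrix is the number of points. This detects
the number of distinct zeros through functions of the power sums, which are holomorphic in the parameters although the zeros are not.
\<close>

definition hankel :: "nat \<Rightarrow> (nat \<Rightarrow> complex) \<Rightarrow> complex" where
  "hankel k p = det (mat k k (\<lambda>(i, j). p (i + j)))"

lemma hankel_eq_0_iff:
  "hankel k p = 0 \<longleftrightarrow> (\<exists>v. (\<exists>j<k. v j \<noteq> 0) \<and> (\<forall>i<k. (\<Sum>j<k. p (i + j) * v j) = 0))"
proof -
  let ?A = "mat k k (\<lambda>(i, j). p (i + j))"
  have mv: "?A *\<^sub>v Matrix.vec k v = 0\<^sub>v k \<longleftrightarrow> (\<forall>i<k. (\<Sum>j<k. p (i + j) * v j) = 0)" for v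
    by (auto simp: vec_eq_iff scalar_prod_def atLeast0LessThan)
  have nz: "Matrix.vec k v \<noteq> 0\<^sub>v k \<longleftrightarrow> (\<exists>j<k. v j \<noteq> 0)" for v :: "nat \<Rightarrow> complex"
    by (auto simp: vec_eq_iff)
  have "hankel k p = 0 \<longleftrightarrow> (\<exists>x. x \<in> carrier_vec k \<and> x \<noteq> 0\<^sub>v k \<and> ?A *\<^sub>v x = 0\<^sub>v k)"
    unfolding hankel_def by (rule det_0_iff_vec_prod_zero) simp
  also have "\<dots> \<longleftrightarrow> (\<exists>v. Matrix.vec k v \<noteq> 0\<^sub>v k \<and> ?A *\<^sub>v Matrix.vec k v = 0\<^sub>v k)"
  proof
    assume "\<exists>x. x \<in> carrier_vec k \<and> x \<noteq> 0\<^sub>v k \<and> ?A *\<^sub>v x = 0\<^sub>v k"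
    then obtain x where x: "x \<in> carrier_vec k" "x \<noteq> 0\<^sub>v k" "?A *\<^sub>v x = 0\<^sub>v k" by blast
    have "Matrix.vec k (vec_index x) = x" using x(1) by (auto simp: vec_eq_iff)
    with x show "\<exists>v. Matrix.vec k v \<noteq> 0\<^sub>v k \<and> ?A *\<^sub>v Matrix.vec k v = 0\<^sub>v k" by metis
  next
    assume "\<exists>v. Matrix.vec k v \<noteq> 0\<^sub>v k \<and> ?A *\<^sub>v Matrix.vec k v = 0\<^sub>v k"
    then show "\<exists>x. x \<in> carrier_vec k \<and> x \<noteq> 0\<^sub>v k \<and> ?A *\<^sub>v x = 0\<^sub>v k" by (metis vec_carrier)
  qed
  finally show ?thesis unfolding mv nz .
qed

lemma poly_sum_lessThan:
  fixes P :: "complex poly"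
  assumes "degree P < k"
  shows "(\<Sum>j<k. coeff P j * w ^ j) = poly P w"
  unfolding poly_altdef
  by (rule sum.mono_neutral_right) (use assms in \<open>auto simp: coeff_eq_0\<close>)

text \<open>
A combination of the columns, with the coefficients of \<open>P\<close>, evaluates \<open>P\<close> at the points. So the kernel of the matrix consists of polynomials.
\<close>

lemma hankel_moments:
  fixes S :: "complex set"
  assumes "\<And>j. p j = (\<Sum>w\<in>S. m w * w ^ j)" "degree P < k"
  shows "(\<Sum>j<k. p (i + j) * coeff P j) = (\<Sum>w\<in>S. m w * w ^ i * poly P w)"
proof -
  have "p (i + j) * coeff P j = (\<Sum>w\<in>S. m w * w ^ i * (coeff P j * w ^ j))" for j
    unfolding assms(1) sum_distrib_right by (rule sum.cong) (simp_all add: power_add)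
  then have "(\<Sum>j<k. p (i + j) * coeff P j) = (\<Sum>j<k. \<Sum>w\<in>S. m w * w ^ i * (coeff P j * w ^ j))"
    by simp
  also have "\<dots> = (\<Sum>w\<in>S. \<Sum>j<k. m w * w ^ i * (coeff P j * w ^ j))"
    by (rule sum.swap)
  also have "\<dots> = (\<Sum>w\<in>S. m w * w ^ i * poly P w)"
    by (simp add: sum_distrib_left[symmetric] poly_sum_lessThan[OF assms(2)])
  finally show ?thesis .
qed

lemma degree_root_product: "finite S \<Longrightarrow> degree (\<Prod>w\<in>S. [:- w, 1:]) = card S" for S :: "complex set"
  by (subst degree_prod_eq_sum_degree) auto

lemma poly_root_product: "finite S \<Longrightarrow> poly (\<Prod>w\<in>S. [:- w, 1:]) x = 0 \<longleftrightarrow> x \<in> S" for S :: "complex set"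
  by (auto simp: poly_prod)

text \<open>
The polynomial with root set \<open>S\<close> lies in the kernel.
\<close>

lemma hankel_power_sums_zero:
  fixes S :: "complex set"
  assumes S: "finite S" and p: "\<And>j. p j = (\<Sum>w\<in>S. m w * w ^ j)" and k: "card S < k"
  shows "hankel k p = 0"
proof -
  define P where "P = (\<Prod>w\<in>S. [:- w, 1:])"
  have deg: "degree P = card S" using degree_root_product[OF S] by (simp add: P_def)
  have "P \<noteq> 0" using S by (auto simp: P_def)
  then have "coeff P (card S) \<noteq> 0" using deg leading_coeff_0_iff[of P] by simp
  moreover have "(\<Sum>j<k. p (i + j) * coeff P j) = 0" for i
  proof -
    have "poly P w = 0" if "w \<in> S" for w using poly_root_product[OF S] that by (simp add: P_def)
    then show ?thesis using hankel_moments[OF p, of P k i] deg k by simp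
  qed
  ultimately show ?thesis unfolding hankel_eq_0_iff using k by blast
qed

text \<open>
A polynomial \<open>E\<close> in the kernel has degree below \<open>card S\<close>. Pairing it with the polynomial that vanishes on all of \<open>S\<close> except
\<open>w0\<close> gives \<open>E(w0) = 0\<close>, so that \<open>E\<close> has too many roots.
\<close>

lemma hankel_power_sums_nonzero:
  fixes S :: "complex set"
  assumes S: "finite S" and p: "\<And>j. p j = (\<Sum>w\<in>S. m w * w ^ j)" and m: "\<And>w. w \<in> S \<Longrightarrow> m w \<noteq> 0"
  shows "hankel (card S) p \<noteq> 0"
proof
  let ?n = "card S"
  assume "hankel (card S) p = 0"
  then obtain v where v: "\<exists>j<?n. v j \<noteq> 0" "\<And>i. i < ?n \<Longrightarrow> (\<Sum>j<?n. p (i + j) * v j) = 0"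
    unfolding hankel_eq_0_iff by blast
  define E where "E = Abs_poly (\<lambda>j. if j < ?n then v j else 0)"
  have "\<forall>\<^sub>\<infinity>j. (if j < ?n then v j else 0) = 0"
    unfolding MOST_nat by (rule exI[of _ ?n]) auto
  then have cE: "coeff E j = (if j < ?n then v j else 0)" for j
    unfolding E_def by (subst Abs_poly_inverse) auto
  have npos: "0 < ?n" using v(1) by auto
  have "degree E \<le> ?n - 1" by (rule degree_le) (use npos cE in auto)
  then have degE: "degree E < ?n" using npos by linarith
  have mom: "(\<Sum>w\<in>S. m w * w ^ i * poly E w) = 0" if "i < ?n" for i
    using hankel_moments[OF p degE, of i] v(2)[OF that] by (simp add: cE)
  have mom_poly: "(\<Sum>w\<in>S. m w * poly B w * poly E w) = 0" if "degree B < ?n" for B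
  proof -
    have "(\<Sum>w\<in>S. m w * poly B w * poly E w) = (\<Sum>w\<in>S. \<Sum>i<?n. coeff B i * (m w * w ^ i * poly E w))"
      by (simp add: poly_sum_lessThan[OF that, symmetric] sum_distrib_left sum_distrib_right mult_ac)
    also have "\<dots> = (\<Sum>i<?n. coeff B i * (\<Sum>w\<in>S. m w * w ^ i * poly E w))"
      by (subst sum.swap) (simp add: sum_distrib_left)
    also have "\<dots> = 0" by (simp add: mom)
    finally show ?thesis .
  qed
  have rootE: "poly E w0 = 0" if w0: "w0 \<in> S" for w0
  proof -
    define B where "B = (\<Prod>w\<in>S - {w0}. [:- w, 1:])"
    have "degree B < ?n"
      using degree_root_product[of "S - {w0}"] S w0 npos by (simp add: B_def)
    from mom_poly[OF this] have "(\<Sum>w\<in>S. m w * poly B w * poly E w) = 0" .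
    moreover have "poly B w = 0" if "w \<in> S - {w0}" for w
      using poly_root_product[of "S - {w0}" w] S that by (simp add: B_def)
    ultimately have "m w0 * poly B w0 * poly E w0 = 0"
      using S w0 by (simp add: sum.remove)
    moreover have "poly B w0 \<noteq> 0"
      using poly_root_product[of "S - {w0}" w0] S by (simp add: B_def)
    ultimately show ?thesis using m[OF w0] by simp
  qed
  have "E \<noteq> 0" using v(1) cE by (metis coeff_0)
  then have "card {x. poly E x = 0} \<le> degree E" by (rule card_poly_roots_bound)
  moreover have "card S \<le> card {x. poly E x = 0}"
    using \<open>E \<noteq> 0\<close> rootE by (intro card_mono poly_roots_finite) auto
  ultimately show False using degE by linarith
qed

lemma hol_hankel:
  assumes "\<And>j. hol n R (P j)"
  shows "hol n R (\<lambda>z. hankel k (\<lambda>j. P j z))"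
proof -
  have "hankel k p = (\<Sum>\<pi> | \<pi> permutes {0..<k}. signof \<pi> * (\<Prod>i = 0..<k. p (i + \<pi> i)))" for p
    unfolding hankel_def by (subst det_def'[of _ k]) (auto intro!: sum.cong prod.cong)
  then show ?thesis by (simp only:) (intro hol_sum hol_mult hol_prod hol_const assms)
qed

lemma power_sums_of_zeros:
  assumes f: "f holomorphic_on ball 0 R" and r: "0 < r" "r < R"
    and nz: "\<And>\<zeta>. norm \<zeta> = r \<Longrightarrow> f \<zeta> \<noteq> 0"
  shows "finite (disc_zeros r f)" "\<And>w. w \<in> disc_zeros r f \<Longrightarrow> 0 < zorder f w"
    "integral {0..1} (\<lambda>\<theta>. circ r \<theta> ^ Suc j * deriv f (circ r \<theta>) / f (circ r \<theta>))
       = (\<Sum>w\<in>disc_zeros r f. of_int (zorder f w) * w ^ j)"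
proof -
  define r2 where "r2 = (r + R) / 2"
  have r2: "r < r2" "r2 < R" using r by (auto simp: r2_def)
  let ?S = "ball (0::complex) r2"
  have fS: "f holomorphic_on ?S" using f r2 by (auto intro: holomorphic_on_subset)
  define pz where "pz = {w\<in>?S. f w = 0 \<or> w \<in> {}}"
  have nzr: "f (of_real r) \<noteq> 0" using nz r by simp
  have fin: "finite pz"
  proof (cases "f constant_on ball 0 R")
    case True
    then obtain c where c: "\<And>w. w \<in> ball 0 R \<Longrightarrow> f w = c" unfolding constant_on_def by blast
    have "c \<noteq> 0" using c[of "of_real r"] nzr r by auto
    then have "pz = {}" using c r2 by (auto simp: pz_def)
    then show ?thesis by simp
  next
    case False
    have "finite {z \<in> cball 0 r2. f z = 0}"
      using f False r2 by (intro holomorphic_compact_finite_zeros[of f "ball 0 R"]) auto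
    then show ?thesis by (rule finite_subset[rotated]) (auto simp: pz_def)
  qed
  have dz: "disc_zeros r f \<subseteq> pz" using r2 by (auto simp: disc_zeros_def pz_def)
  then show findz: "finite (disc_zeros r f)" using fin finite_subset by blast
  show "0 < zorder f w" if w: "w \<in> disc_zeros r f" for w
  proof -
    have wS: "w \<in> ?S" "f w = 0" using w r2 by (auto simp: disc_zeros_def)
    have "open (?S - (pz - {w}))"
      using fin by (intro open_Diff open_ball finite_imp_closed finite_Diff)
    moreover have "w \<in> ?S - (pz - {w})" using wS by simp
    ultimately have "\<forall>\<^sub>F z in at w. z \<in> ?S - (pz - {w}) - {w}" by (rule eventually_at_in_open)
    then have "\<forall>\<^sub>F z in at w. f z \<noteq> 0"
      by (rule eventually_mono) (auto simp: pz_def)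
    then have "\<exists>\<^sub>F z in at w. f z \<noteq> 0" by (rule eventually_frequently[rotated]) simp
    then show ?thesis using zorder_pos_iff[OF fS _ wS(1)] wS(2) by simp
  qed
  let ?g = "circlepath 0 r"
  have out: "winding_number ?g z = 0" if "r < norm z" for z
    by (rule winding_number_zero_outside[of _ "cball 0 r"]) (use that r in auto)
  have "contour_integral ?g (\<lambda>x. deriv f x * x ^ j / f x)
      = 2 * pi * \<i> * (\<Sum>p\<in>pz. winding_number ?g p * p ^ j * zorder f p)"
    unfolding pz_def
  proof (rule argument_principle)
    show "path_image ?g \<subseteq> ?S - {w \<in> ?S. f w = 0 \<or> w \<in> {}}"
      using nz r r2 by auto
    show "\<forall>z. z \<notin> ?S \<longrightarrow> winding_number ?g z = 0"
      using out r2 by auto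
    show "finite {w \<in> ?S. f w = 0 \<or> w \<in> {}}" using fin by (simp add: pz_def)
  qed (use fS in \<open>auto intro!: holomorphic_intros\<close>)
  moreover have "(\<Sum>p\<in>pz. winding_number ?g p * p ^ j * zorder f p)
      = (\<Sum>w\<in>disc_zeros r f. of_int (zorder f w) * w ^ j)"
  proof (rule sum.mono_neutral_cong_right[OF fin dz])
    show "\<forall>p\<in>pz - disc_zeros r f. winding_number ?g p * p ^ j * zorder f p = 0"
    proof
      fix p assume "p \<in> pz - disc_zeros r f"
      then have "\<not> norm p < r" "f p = 0" by (auto simp: pz_def disc_zeros_def)
      then have "r < norm p" using nz[of p] by linarith
      then show "winding_number ?g p * p ^ j * zorder f p = 0" using out by simp
    qed
    show "winding_number ?g p * p ^ j * zorder f p = of_int (zorder f p) * p ^ j"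
      if "p \<in> disc_zeros r f" for p
      using that winding_number_circlepath[of p 0 r] by (simp add: disc_zeros_def)
  qed
  ultimately have "integral {0..1} (\<lambda>\<theta>. circ r \<theta> * (deriv f (circ r \<theta>) * circ r \<theta> ^ j / f (circ r \<theta>)))
      = (\<Sum>w\<in>disc_zeros r f. of_int (zorder f w) * w ^ j)"
    unfolding contour_integral_circ by simp
  then show "integral {0..1} (\<lambda>\<theta>. circ r \<theta> ^ Suc j * deriv f (circ r \<theta>) / f (circ r \<theta>))
       = (\<Sum>w\<in>disc_zeros r f. of_int (zorder f w) * w ^ j)"
    by (simp add: mult_ac)
qed

definition deriv_coord :: "real \<Rightarrow> nat \<Rightarrow> ((nat \<Rightarrow> complex) \<Rightarrow> complex) \<Rightarrow> (nat \<Rightarrow> complex) \<Rightarrow> complex" where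
  "deriv_coord r k F z = integral {0..1} (\<lambda>\<theta>. circ r \<theta> / (circ r \<theta> - z k)\<^sup>2 * F (z(k := circ r \<theta>)))"

lemma hol_deriv_coord:
  assumes "hol n R F" "0 < r" "r < R" "k \<le> n"
  shows "hol n r (deriv_coord r k F)"
  unfolding deriv_coord_def
proof (rule hol_integral)
  have nz: "circ r \<theta> \<noteq> z k" if "z \<in> polydisc n r" for z \<theta>
    using circ_minus_nz[OF that assms(4), of \<theta>] by auto
  show "continuous_on (polydisc n r \<times> {0..1})
     (\<lambda>(z, \<theta>). circ r \<theta> / (circ r \<theta> - z k)\<^sup>2 * F (z(k := circ r \<theta>)))"
    unfolding case_prod_unfold using assms
    by (intro continuous_intros continuous_on_hol_upd continuous_on_fst_coord) (auto dest: nz)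
  fix \<theta>
  show "hol n r (\<lambda>z. circ r \<theta> / (circ r \<theta> - z k)\<^sup>2 * F (z(k := circ r \<theta>)))"
    using assms by (intro hol_divide hol_mult hol_diff hol_power hol_const hol_coord hol_mono[OF hol_fun_upd[OF assms(1)]])
       (auto dest: nz[of _ \<theta>])
qed

lemma deriv_coord_eq:
  assumes "hol n R F" "r < R" "z \<in> polydisc n r" "k \<le> n"
  shows "deriv_coord r k F z = deriv (\<lambda>\<zeta>. F (z(k := \<zeta>))) (z k)"
proof -
  have "(\<lambda>\<zeta>. F (z(k := \<zeta>))) holomorphic_on ball 0 R"
    using assms polydisc_mono[of n n r R] by (intro hol_slice polydisc_upd) auto
  then have "(\<lambda>\<zeta>. F (z(k := \<zeta>))) holomorphic_on cball 0 r"
    by (rule holomorphic_on_subset) (use assms in auto)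
  moreover have "norm (z k) < r" using assms by (simp add: polydisc_def)
  ultimately show ?thesis
    using Cauchy_deriv_circ[of "\<lambda>\<zeta>. F (z(k := \<zeta>))" r "z k"] by (simp add: deriv_coord_def)
qed

text \<open>
The sum of the \<open>j\<close>-th powers of the zeros, with multiplicity, that the function \<open>\<zeta> \<mapsto> F(c(k := \<zeta>))\<close> has in the disc of
radius \<open>r\<close>, as given by the argument principle.
\<close>

definition power_sum :: "nat \<Rightarrow> real \<Rightarrow> real \<Rightarrow> ((nat \<Rightarrow> complex) \<Rightarrow> complex) \<Rightarrow> nat \<Rightarrow> (nat \<Rightarrow> complex) \<Rightarrow> complex" where
  "power_sum k r r' F j c =
     integral {0..1} (\<lambda>\<theta>. circ r \<theta> ^ Suc j * deriv_coord r' k F (c(k := circ r \<theta>)) / F (c(k := circ r \<theta>)))"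

lemma hol_power_sum:
  assumes F: "hol (Suc n) R F" and r: "0 < r" "r < r'" "r' < R" and d: "\<delta> \<le> r'"
    and nz: "\<And>c \<zeta>. c \<in> polydisc n \<delta> \<Longrightarrow> norm \<zeta> = r \<Longrightarrow> F (c(Suc n := \<zeta>)) \<noteq> 0"
  shows "hol n \<delta> (power_sum (Suc n) r r' F j)"
  unfolding power_sum_def
proof (rule hol_integral)
  have D: "hol (Suc n) r' (deriv_coord r' (Suc n) F)" using F r by (intro hol_deriv_coord) auto
  have sub: "z(Suc n := circ r \<theta>) \<in> polydisc (Suc n) r'" "z(Suc n := circ r \<theta>) \<in> polydisc (Suc n) R"
    if "z \<in> polydisc n \<delta>" for z \<theta>
    using that polydisc_mono[of n n \<delta> r'] polydisc_mono[of n n \<delta> R] d r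
    by (auto simp: polydisc_Suc_upd)
  have nz': "F (z(Suc n := circ r \<theta>)) \<noteq> 0" if "z \<in> polydisc n \<delta>" for z \<theta>
    using nz[OF that, of "circ r \<theta>"] r by simp
  have cu: "continuous_on (polydisc n \<delta> \<times> {0..1::real}) (\<lambda>p. (fst p)(Suc n := circ r (snd p)))"
    by (intro continuous_on_fun_upd continuous_on_circ continuous_on_fst continuous_on_snd continuous_on_id)
  show "continuous_on (polydisc n \<delta> \<times> {0..1}) (\<lambda>(c, \<theta>). circ r \<theta> ^ Suc j *
      deriv_coord r' (Suc n) F (c(Suc n := circ r \<theta>)) / F (c(Suc n := circ r \<theta>)))"
    unfolding case_prod_unfold
    by (intro continuous_on_divide continuous_on_mult continuous_on_power continuous_on_circ continuous_on_snd
        continuous_on_id hol_continuous_on[OF D cu] hol_continuous_on[OF F cu])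
       (use sub nz' in auto)
  fix \<theta>
  show "hol n \<delta> (\<lambda>c. circ r \<theta> ^ Suc j *
      deriv_coord r' (Suc n) F (c(Suc n := circ r \<theta>)) / F (c(Suc n := circ r \<theta>)))"
  proof (intro hol_divide hol_mult hol_const)
    show "hol n \<delta> (\<lambda>c. deriv_coord r' (Suc n) F (c(Suc n := circ r \<theta>)))"
      by (rule hol_mono[OF hol_drop_last[OF D]]) (use r d in auto)
    show "hol n \<delta> (\<lambda>c. F (c(Suc n := circ r \<theta>)))"
      by (rule hol_mono[OF hol_drop_last[OF F]]) (use r d in auto)
  qed (use nz' in auto)
qed

lemma power_sum_eq:
  assumes F: "hol (Suc n) R F" and r: "0 < r" "r < r'" "r' < R"
    and c: "c \<in> polydisc n r'" and nz: "\<And>\<zeta>. norm \<zeta> = r \<Longrightarrow> F (c(Suc n := \<zeta>)) \<noteq> 0"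
  defines "f \<equiv> \<lambda>\<zeta>. F (c(Suc n := \<zeta>))"
  shows "finite (disc_zeros r f)" "\<And>w. w \<in> disc_zeros r f \<Longrightarrow> 0 < zorder f w"
    "power_sum (Suc n) r r' F j c = (\<Sum>w\<in>disc_zeros r f. of_int (zorder f w) * w ^ j)"
proof -
  have "polydisc n r' \<subseteq> polydisc n R" using r by (intro polydisc_mono) auto
  then have f: "f holomorphic_on ball 0 R"
    unfolding f_def by (intro hol_slice[OF F]) (use c in \<open>auto simp: polydisc_Suc_upd\<close>)
  have rR: "r < R" using r by linarith
  have nzf: "f \<zeta> \<noteq> 0" if "norm \<zeta> = r" for \<zeta> using nz[OF that] by (simp add: f_def)
  note * = power_sums_of_zeros[OF f r(1) rR nzf]
  show "finite (disc_zeros r f)" "\<And>w. w \<in> disc_zeros r f \<Longrightarrow> 0 < zorder f w"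
    using * by blast+
  have "deriv_coord r' (Suc n) F (c(Suc n := circ r \<theta>)) = deriv f (circ r \<theta>)" for \<theta>
    using deriv_coord_eq[OF F r(3), of "c(Suc n := circ r \<theta>)" "Suc n"] c r
    by (simp add: polydisc_Suc_upd f_def)
  then show "power_sum (Suc n) r r' F j c = (\<Sum>w\<in>disc_zeros r f. of_int (zorder f w) * w ^ j)"
    using *(3)[of j] unfolding power_sum_def f_def by simp
qed

lemma open_contains_polydisc:
  assumes V: "open V" "(\<lambda>_. 0) \<in> V"
  obtains \<delta> where "0 < \<delta>" "\<And>c. c \<in> polydisc n \<delta> \<Longrightarrow> (\<lambda>i. if i \<le> n then c i else 0) \<in> V"
proof -
  have "openin (product_topology (\<lambda>_. euclidean) UNIV) V"
    using V(1) by (simp add: euclidean_product_topology)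
  from product_topology_open_contains_basis[OF this V(2)]
  obtain X where X: "(\<lambda>_. 0) \<in> (\<Pi>\<^sub>E i\<in>UNIV. X i)" "\<And>i. openin euclidean (X i)" "(\<Pi>\<^sub>E i\<in>UNIV. X i) \<subseteq> V"
    by blast
  have "\<exists>d>0. ball 0 d \<subseteq> X i" for i
    using X(1) X(2)[of i] open_contains_ball[of "X i"] by (auto simp: PiE_UNIV_domain)
  then obtain d where d: "\<And>i. 0 < d i" "\<And>i. ball 0 (d i) \<subseteq> X i" by metis
  have M: "0 < Min (d ` {..n})" using d(1) by simp
  show ?thesis
  proof (rule that[OF M])
    fix c assume c: "c \<in> polydisc n (Min (d ` {..n}))"
    have "(if i \<le> n then c i else 0) \<in> X i" for i
    proof (cases "i \<le> n")
      case True
      then have "norm (c i) < Min (d ` {..n})" using c by (simp add: polydisc_def)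
      also have "\<dots> \<le> d i" using True by (intro Min_le) auto
      finally show ?thesis using d(2)[of i] True by auto
    next
      case False
      then show ?thesis using d(1)[of i] d(2)[of i] by auto
    qed
    then show "(\<lambda>i. if i \<le> n then c i else 0) \<in> V" using X(3) by auto
  qed
qed

lemma nonvanishing_circle:
  assumes F: "hol (Suc n) R F" and r: "0 < r" "r < R"
    and nz: "\<And>\<zeta>. norm \<zeta> = r \<Longrightarrow> F ((\<lambda>_. 0)(Suc n := \<zeta>)) \<noteq> 0"
  obtains \<delta> where "0 < \<delta>" "\<And>c \<zeta>. c \<in> polydisc n \<delta> \<Longrightarrow> norm \<zeta> = r \<Longrightarrow> F (c(Suc n := \<zeta>)) \<noteq> 0"
proof -
  let ?D = "polydisc n R \<times> ball (0::complex) R"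
  let ?h = "\<lambda>p. F ((fst p)(Suc n := snd p))"
  have cont: "continuous_on ?D ?h"
    by (rule hol_continuous_on[OF F])
       (auto simp: polydisc_Suc_upd intro!: continuous_on_fun_upd continuous_on_fst continuous_on_snd continuous_on_id)
  have op: "open (?D \<inter> ?h -` (- {0}))"
    by (rule continuous_open_preimage[OF cont]) (auto intro!: open_Times open_polydisc)
  have sub: "{\<lambda>_. 0} \<times> sphere 0 r \<subseteq> ?D \<inter> ?h -` (- {0})"
    using nz r by (auto simp: polydisc_def)
  from Elementary_Topology.tube_lemma[OF compact_sphere op sub]
  obtain V where V: "(\<lambda>_. 0) \<in> V" "open V" "V \<times> sphere 0 r \<subseteq> ?D \<inter> ?h -` (- {0})"
    by (elim exE conjE) (rule that)
  obtain \<delta> where \<delta>: "0 < \<delta>" "\<And>c. c \<in> polydisc n \<delta> \<Longrightarrow> (\<lambda>i. if i \<le> n then c i else 0) \<in> V"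
    using open_contains_polydisc[OF V(2,1)] by blast
  show ?thesis
  proof (rule that[OF \<delta>(1)])
    fix c \<zeta> assume c: "c \<in> polydisc n \<delta>" and z: "norm (\<zeta>::complex) = r"
    let ?c = "\<lambda>i. if i \<le> n then c i else 0"
    have "(?c, \<zeta>) \<in> V \<times> sphere 0 r" using \<delta>(2)[OF c] z by simp
    then have "(?c, \<zeta>) \<in> ?h -` (- {0})" using V(3) by blast
    then have "F (?c(Suc n := \<zeta>)) \<noteq> 0" by simp
    moreover have "F (?c(Suc n := \<zeta>)) = F (c(Suc n := \<zeta>))"
      by (rule hol_cong_point[OF F]) auto
    ultimately show "F (c(Suc n := \<zeta>)) \<noteq> 0" by simp
  qed
qed

lemma hol_continuous_at_0:
  assumes F: "hol n R F" and R: "0 < R" and e: "0 < e"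
  obtains \<delta> where "0 < \<delta>" "\<delta> \<le> R" "\<And>c. c \<in> polydisc n \<delta> \<Longrightarrow> norm (F c - F (\<lambda>_. 0)) < e"
proof -
  have "open (polydisc n R \<inter> F -` ball (F (\<lambda>_. 0)) e)"
    by (rule continuous_open_preimage[OF holD(1)[OF F] open_polydisc]) auto
  moreover have "(\<lambda>_. 0) \<in> polydisc n R \<inter> F -` ball (F (\<lambda>_. 0)) e"
    using R e by (auto simp: polydisc_def)
  ultimately obtain \<delta> where \<delta>: "0 < \<delta>"
      "\<And>c. c \<in> polydisc n \<delta> \<Longrightarrow> (\<lambda>i. if i \<le> n then c i else 0) \<in> polydisc n R \<inter> F -` ball (F (\<lambda>_. 0)) e"
    using open_contains_polydisc by blast
  show ?thesis
  proof (rule that[of "min \<delta> R"])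
    fix c assume "c \<in> polydisc n (min \<delta> R)"
    then have "c \<in> polydisc n \<delta>" using polydisc_mono[of n n "min \<delta> R" \<delta>] by auto
    from \<delta>(2)[OF this] have "dist (F (\<lambda>_. 0)) (F (\<lambda>i. if i \<le> n then c i else 0)) < e" by simp
    moreover have "F (\<lambda>i. if i \<le> n then c i else 0) = F c" by (rule hol_cong_point[OF F]) auto
    ultimately show "norm (F c - F (\<lambda>_. 0)) < e" by (simp add: dist_norm norm_minus_commute)
  qed (use \<delta> R in auto)
qed

text \<open>
The number of distinct zeros is the largest \<open>k\<close> with nonzero Hankel determinant of order \<open>k\<close>. Finitely many \<open>k\<close> suffice: the number
of zeros is at most the power sum of order \<open>0\<close>, which is bounded near the origin by continuity.
\<close>

lemma zero_count_functions:
  assumes Q: "hol (Suc n) R Q" and r: "0 < r" "r < R"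
    and nz0: "\<And>\<zeta>. norm \<zeta> = r \<Longrightarrow> Q ((\<lambda>_. 0)(Suc n := \<zeta>)) \<noteq> 0"
  obtains \<delta> \<Psi> where "0 < \<delta>" "\<delta> \<le> R" "finite \<Psi>" "\<And>D. D \<in> \<Psi> \<Longrightarrow> hol n \<delta> D"
    "\<And>c \<zeta>. c \<in> polydisc n \<delta> \<Longrightarrow> norm \<zeta> = r \<Longrightarrow> Q (c(Suc n := \<zeta>)) \<noteq> 0"
    "\<And>c. c \<in> polydisc n \<delta> \<Longrightarrow> finite (disc_zeros r (\<lambda>\<zeta>. Q (c(Suc n := \<zeta>))))"
    "\<And>c c'. c \<in> polydisc n \<delta> \<Longrightarrow> c' \<in> polydisc n \<delta> \<Longrightarrow> (\<And>D. D \<in> \<Psi> \<Longrightarrow> D c = 0 \<longleftrightarrow> D c' = 0) \<Longrightarrow>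
       card (disc_zeros r (\<lambda>\<zeta>. Q (c(Suc n := \<zeta>)))) = card (disc_zeros r (\<lambda>\<zeta>. Q (c'(Suc n := \<zeta>))))"
proof -
  define r' where "r' = (r + R) / 2"
  have r': "r < r'" "r' < R" "0 < r'" using r by (auto simp: r'_def)
  obtain d where d: "0 < d" "\<And>c \<zeta>. c \<in> polydisc n d \<Longrightarrow> norm \<zeta> = r \<Longrightarrow> Q (c(Suc n := \<zeta>)) \<noteq> 0"
    using nonvanishing_circle[OF Q r nz0] by blast
  define d1 where "d1 = min d r'"
  have d1: "0 < d1" "d1 \<le> r'" using d r' by (auto simp: d1_def)
  have nz: "Q (c(Suc n := \<zeta>)) \<noteq> 0" if "c \<in> polydisc n d1" "norm \<zeta> = r" for c \<zeta>
    using d(2) that polydisc_mono[of n n d1 d] by (auto simp: d1_def)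
  let ?p = "power_sum (Suc n) r r' Q"
  let ?Z = "\<lambda>c. disc_zeros r (\<lambda>\<zeta>. Q (c(Suc n := \<zeta>)))"
  let ?m = "\<lambda>c w. zorder (\<lambda>\<zeta>. Q (c(Suc n := \<zeta>))) w"
  have hol_p: "hol n d1 (?p j)" for j
    using hol_power_sum[OF Q r(1) r'(1,2) d1(2) nz] by blast
  have in_r': "c \<in> polydisc n r'" if "c \<in> polydisc n d1" for c
    using that polydisc_mono[of n n d1 r'] d1 by auto
  have fin: "finite (?Z c)" if "c \<in> polydisc n d1" for c
    by (rule power_sum_eq(1)[OF Q r(1) r'(1,2) in_r'[OF that] nz[OF that]])
  have pos: "0 < ?m c w" if "c \<in> polydisc n d1" "w \<in> ?Z c" for c w
    by (rule power_sum_eq(2)[OF Q r(1) r'(1,2) in_r'[OF that(1)] nz[OF that(1)] that(2)])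
  have p_eq: "?p j c = (\<Sum>w\<in>?Z c. of_int (?m c w) * w ^ j)" if "c \<in> polydisc n d1" for c j
    by (rule power_sum_eq(3)[OF Q r(1) r'(1,2) in_r'[OF that] nz[OF that]])
  have one: "(0::real) < 1" by simp
  obtain \<delta> where \<delta>: "0 < \<delta>" "\<delta> \<le> d1" "\<And>c. c \<in> polydisc n \<delta> \<Longrightarrow> norm (?p 0 c - ?p 0 (\<lambda>_. 0)) < 1"
    using hol_continuous_at_0[OF hol_p[of 0] d1(1) one] by blast
  have sub: "c \<in> polydisc n d1" if "c \<in> polydisc n \<delta>" for c
    using that polydisc_mono[of n n \<delta> d1] \<delta> by auto
  define B where "B = nat \<lceil>norm (?p 0 (\<lambda>_. 0)) + 1\<rceil>"
  have bound: "card (?Z c) \<le> B" if c: "c \<in> polydisc n \<delta>" for c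
  proof -
    note c1 = sub[OF c]
    have "real (card (?Z c)) = (\<Sum>w\<in>?Z c. 1)" by simp
    also have "\<dots> \<le> (\<Sum>w\<in>?Z c. real_of_int (?m c w))"
      using pos[OF c1] by (intro sum_mono) force
    also have "\<dots> \<le> norm (complex_of_real (\<Sum>w\<in>?Z c. real_of_int (?m c w)))"
      by (simp only: norm_of_real abs_ge_self)
    also have "complex_of_real (\<Sum>w\<in>?Z c. real_of_int (?m c w)) = ?p 0 c"
      using p_eq[OF c1, of 0] by simp
    also have "norm (?p 0 c) \<le> norm (?p 0 (\<lambda>_. 0)) + 1"
      using \<delta>(3)[OF c] norm_triangle_sub[of "?p 0 c" "?p 0 (\<lambda>_. 0)"] by linarith
    finally show ?thesis unfolding B_def by linarith
  qed
  define \<Psi> where "\<Psi> = (\<lambda>k c. hankel k (\<lambda>j. ?p j c)) ` {..B}"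
  have nonzero: "hankel (card (?Z c)) (\<lambda>j. ?p j c) \<noteq> 0" if "c \<in> polydisc n \<delta>" for c
    using fin[OF sub[OF that]] pos[OF sub[OF that]]
    by (intro hankel_power_sums_nonzero[where m = "\<lambda>w. of_int (?m c w)"] p_eq[OF sub[OF that]]) force+
  have zero: "hankel k (\<lambda>j. ?p j c) = 0" if "c \<in> polydisc n \<delta>" "card (?Z c) < k" for c k
    by (rule hankel_power_sums_zero[where m = "\<lambda>w. of_int (?m c w)", OF fin[OF sub[OF that(1)]] _ that(2)])
       (rule p_eq[OF sub[OF that(1)]])
  have le: "card (?Z c) \<le> card (?Z c')"
    if c: "c \<in> polydisc n \<delta>" "c' \<in> polydisc n \<delta>" and same: "\<And>D. D \<in> \<Psi> \<Longrightarrow> D c = 0 \<longleftrightarrow> D c' = 0" for c c'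
  proof (rule ccontr)
    assume "\<not> card (?Z c) \<le> card (?Z c')"
    then have "hankel (card (?Z c)) (\<lambda>j. ?p j c') = 0" using zero[OF c(2)] by simp
    moreover have "(\<lambda>c'. hankel (card (?Z c)) (\<lambda>j. ?p j c')) \<in> \<Psi>"
      unfolding \<Psi>_def using bound[OF c(1)] by blast
    ultimately show False using same nonzero[OF c(1)] by blast
  qed
  show ?thesis
  proof (rule that[of \<delta> \<Psi>])
    show "hol n \<delta> D" if D: "D \<in> \<Psi>" for D
    proof -
      obtain k where "D = (\<lambda>c. hankel k (\<lambda>j. ?p j c))" using D unfolding \<Psi>_def by blast
      then show ?thesis using hol_hankel[OF hol_mono[OF hol_p le_refl \<delta>(2)]] by simp
    qed
    show "card (?Z c) = card (?Z c')"
      if "c \<in> polydisc n \<delta>" "c' \<in> polydisc n \<delta>" "\<And>D. D \<in> \<Psi> \<Longrightarrow> D c = 0 \<longleftrightarrow> D c' = 0" for c c'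
      using le[OF that] le[OF that(2,1)] that(3) by (intro antisym) auto
  qed (use \<delta> d1 r' nz sub fin in \<open>auto simp: \<Psi>_def\<close>)
qed

section \<open>Curve selection\<close>

lemma punctured_nonzero:
  assumes q: "q holomorphic_on S" and S: "open S" "connected S" "\<xi> \<in> S" "\<beta> \<in> S" and nz: "q \<beta> \<noteq> 0"
  shows "\<exists>e>0. ball \<xi> e \<subseteq> S \<and> (\<forall>z\<in>ball \<xi> e - {\<xi>}. q z \<noteq> 0)"
proof (cases "q \<xi> = 0")
  case True
  show ?thesis
    by (rule isolated_zeros[OF q S(1,2,3) True S(4) nz]) blast
next
  case False
  have "open (S \<inter> q -` (- {0}))"
    by (rule continuous_open_preimage[OF holomorphic_on_imp_continuous_on[OF q] S(1)]) auto
  moreover have "\<xi> \<in> S \<inter> q -` (- {0})" using S(3) False by simp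
  ultimately obtain e where "0 < e" "ball \<xi> e \<subseteq> S \<inter> q -` (- {0})"
    using open_contains_ball by blast
  then show ?thesis by (intro exI[of _ e]) auto
qed

lemma convex_line_polydisc: "convex {s::complex. (\<lambda>i. z i + s * w i) \<in> polydisc n R}"
proof (rule convexI)
  fix x y :: complex and u v :: real
  assume x: "x \<in> {s. (\<lambda>i. z i + s * w i) \<in> polydisc n R}" and y: "y \<in> {s. (\<lambda>i. z i + s * w i) \<in> polydisc n R}"
    and uv: "0 \<le> u" "0 \<le> v" "u + v = 1"
  have "norm (z i + (u *\<^sub>R x + v *\<^sub>R y) * w i) < R" if "i \<le> n" for i
  proof -
    have "z i + x * w i \<in> ball 0 R" "z i + y * w i \<in> ball 0 R"
      using x y that by (auto simp: polydisc_def)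
    then have "u *\<^sub>R (z i + x * w i) + v *\<^sub>R (z i + y * w i) \<in> ball 0 R"
      by (intro convexD[OF convex_ball] uv)
    moreover have "u *\<^sub>R (z i + x * w i) + v *\<^sub>R (z i + y * w i)
        = (u + v) *\<^sub>R z i + (u *\<^sub>R x + v *\<^sub>R y) * w i"
      by (simp add: algebra_simps)
    ultimately show ?thesis using uv(3) by simp
  qed
  then show "u *\<^sub>R x + v *\<^sub>R y \<in> {s. (\<lambda>i. z i + s * w i) \<in> polydisc n R}"
    by (simp add: polydisc_def)
qed

text \<open>
The identity theorem on the segment between two points: a product of nonzero functions is nonzero.
Points with coordinate \<open>0\<close> equal to zero form the slice \<open>t = 0\<close>.
\<close>

lemma common_nonzero:
  assumes "finite \<Gamma>" "0 < R"
    and "\<And>G. G \<in> \<Gamma> \<Longrightarrow> hol n R G"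
    and "\<And>G. G \<in> \<Gamma> \<Longrightarrow> \<exists>v. cpt v \<in> polydisc n R \<and> v 0 = 0 \<and> G (cpt v) \<noteq> 0"
  shows "\<exists>v. cpt v \<in> polydisc n R \<and> v 0 = 0 \<and> (\<forall>G\<in>\<Gamma>. G (cpt v) \<noteq> 0)"
  using assms(1,3,4)
proof (induction \<Gamma>)
  case empty
  have "cpt (\<lambda>_. 0) \<in> polydisc n R" using assms(2) by (simp add: polydisc_def)
  then show ?case by (intro exI[of _ "\<lambda>_. 0"]) auto
next
  case (insert G \<Gamma>)
  obtain a where a: "cpt a \<in> polydisc n R" "a 0 = 0" "\<forall>F\<in>\<Gamma>. F (cpt a) \<noteq> 0"
    using insert.IH insert.prems by blast
  obtain b where b: "cpt b \<in> polydisc n R" "b 0 = 0" "G (cpt b) \<noteq> 0"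
    using insert.prems(2)[of G] by blast
  let ?l = "\<lambda>s i. complex_of_real (a i) + s * of_real (b i - a i)"
  let ?S = "{s. ?l s \<in> polydisc n R}"
  have S: "open ?S" "connected ?S"
    by (rule open_line_polydisc, rule convex_connected[OF convex_line_polydisc])
  have l0: "?l 0 = cpt a" and l1: "?l 1 = cpt b" by (auto simp: fun_eq_iff)
  have S01: "0 \<in> ?S" "1 \<in> ?S" using a(1) b(1) l0 l1 by simp_all
  have holS: "(\<lambda>s. F (?l s)) holomorphic_on ?S" if "F \<in> insert G \<Gamma>" for F
    by (rule holD(2)[OF insert.prems(1)[OF that]])
  have "G (?l 1) \<noteq> 0" using b(3) l1 by simp
  from punctured_nonzero[of "\<lambda>s. G (?l s)" ?S 0 1, OF holS[OF insertI1] S S01 this]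
  obtain e where e: "0 < e" "\<forall>s\<in>ball 0 e - {0}. G (?l s) \<noteq> 0" by blast
  have "(\<lambda>s. \<Prod>F\<in>\<Gamma>. F (?l s)) holomorphic_on ?S"
    using holS by (intro holomorphic_on_prod) auto
  moreover have "(\<Prod>F\<in>\<Gamma>. F (?l 0)) \<noteq> 0" using a(3) l0 insert.hyps(1) by simp
  ultimately obtain e' where e': "0 < e'" "ball 0 e' \<subseteq> ?S" "\<forall>s\<in>ball 0 e' - {0}. (\<Prod>F\<in>\<Gamma>. F (?l s)) \<noteq> 0"
    using punctured_nonzero[of "\<lambda>s. \<Prod>F\<in>\<Gamma>. F (?l s)" ?S 0 0, OF _ S S01(1) S01(1)] by blast
  define t where "t = min e e' / 2"
  have t: "0 < t" "t < e" "t < e'" using e(1) e'(1) by (auto simp: t_def)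
  let ?v = "\<lambda>i. a i + t * (b i - a i)"
  have lt: "?l (of_real t) = cpt ?v" by (auto simp: fun_eq_iff)
  have "of_real t \<in> ball (0::complex) e - {0}" "of_real t \<in> ball (0::complex) e' - {0}"
    using t by auto
  then have "G (?l (of_real t)) \<noteq> 0" "(\<Prod>F\<in>\<Gamma>. F (?l (of_real t))) \<noteq> 0" "of_real t \<in> ?S"
    using e(2) e'(2,3) by blast+
  then have "G (cpt ?v) \<noteq> 0" "(\<Prod>F\<in>\<Gamma>. F (cpt ?v)) \<noteq> 0" "cpt ?v \<in> polydisc n R"
    unfolding mem_Collect_eq lt by blast+
  then show ?case using a(2) b(2) insert.hyps(1) by (intro exI[of _ ?v]) auto
qed

text \<open>
The coordinate \<open>0\<close> serves as the parameter of the curve. Continuity is demanded of every coordinate, which is continuity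
for the product topology and allows composition with continuous functions of sequences.
\<close>

definition curve_down :: "nat \<Rightarrow> real \<Rightarrow> ((nat \<Rightarrow> complex) \<Rightarrow> complex) set \<Rightarrow> (nat \<Rightarrow> real) \<Rightarrow> (real \<Rightarrow> nat \<Rightarrow> real) \<Rightarrow> bool" where
  "curve_down n \<rho> \<Phi> a \<gamma> \<longleftrightarrow>
     (\<forall>i. continuous_on {0<..a 0} (\<lambda>s. \<gamma> s i)) \<and> (\<forall>i\<le>n. \<gamma> (a 0) i = a i) \<and>
     (\<forall>s\<in>{0<..a 0}. \<gamma> s 0 = s \<and> (\<forall>i\<le>n. \<bar>\<gamma> s i\<bar> < \<rho>) \<and>
        (\<forall>F\<in>\<Phi>. F (cpt (\<gamma> s)) = 0 \<longleftrightarrow> F (cpt a) = 0))"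

lemma finite_common_bound:
  assumes "finite A" "\<And>x. x \<in> A \<Longrightarrow> \<exists>d>0. \<forall>s. 0 < s \<and> s < d \<longrightarrow> P x (s::real)"
  shows "\<exists>d>0. \<forall>x\<in>A. \<forall>s. 0 < s \<and> s < d \<longrightarrow> P x s"
proof -
  obtain f where f: "\<And>x. x \<in> A \<Longrightarrow> 0 < f x" "\<And>x s. x \<in> A \<Longrightarrow> 0 < s \<Longrightarrow> s < f x \<Longrightarrow> P x s"
    using assms(2) by metis
  show ?thesis
    by (rule exI[of _ "Min (insert 1 (f ` A))"]) (use assms(1) f in auto)
qed

text \<open>
In one variable zeros are isolated, so each function is near \<open>0\<close> either identically zero or without zeros for \<open>t > 0\<close>.
\<close>

lemma curve_selection_0:
  assumes \<Phi>: "finite \<Phi>" "\<And>F. F \<in> \<Phi> \<Longrightarrow> hol 0 R F" and R: "0 < R" "0 < \<rho>"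
  shows "\<exists>\<delta>>0. \<forall>a. 0 < a 0 \<and> (\<forall>i\<le>0. \<bar>a i\<bar> < \<delta>) \<longrightarrow> (\<exists>\<gamma>. curve_down 0 \<rho> \<Phi> a \<gamma>)"
proof -
  have "\<exists>d>0. \<forall>s. 0 < s \<and> s < d \<longrightarrow>
      (F (\<lambda>_. complex_of_real s) = 0 \<longleftrightarrow> (\<forall>s'. 0 < s' \<and> s' < R \<longrightarrow> F (\<lambda>_. complex_of_real s') = 0))"
    if F: "F \<in> \<Phi>" for F
  proof (cases "\<forall>s'. 0 < s' \<and> s' < R \<longrightarrow> F (\<lambda>_. complex_of_real s') = 0")
    case True
    then show ?thesis using R(1) by (intro exI[of _ R]) auto
  next
    case False
    then obtain s' where s': "0 < s'" "s' < R" "F (\<lambda>_. complex_of_real s') \<noteq> 0" by blast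
    have c: "F ((\<lambda>_. 0)(0 := \<zeta>)) = F (\<lambda>_. \<zeta>)" for \<zeta>
      by (rule hol_cong_point[OF \<Phi>(2)[OF F]]) auto
    have "(\<lambda>\<zeta>. F ((\<lambda>_. 0)(0 := \<zeta>))) holomorphic_on ball 0 R"
      by (rule hol_slice[OF \<Phi>(2)[OF F]]) (auto simp: polydisc_def)
    then have h: "(\<lambda>\<zeta>. F (\<lambda>_. \<zeta>)) holomorphic_on ball 0 R" by (simp only: c)
    have in_ball: "0 \<in> ball (0::complex) R" "of_real s' \<in> ball (0::complex) R" using R s' by auto
    obtain e where e: "0 < e" "\<forall>z\<in>ball 0 e - {0}. F (\<lambda>_. z) \<noteq> 0"
      using punctured_nonzero[of "\<lambda>\<zeta>. F (\<lambda>_. \<zeta>)" "ball 0 R" 0 "of_real s'", OF h open_ball connected_ball in_ball s'(3)] by blast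
    have "F (\<lambda>_. complex_of_real s) \<noteq> 0" if "0 < s \<and> s < e" for s
      by (rule e(2)[rule_format]) (use that in auto)
    then show ?thesis using e(1) s' by (intro exI[of _ e]) blast
  qed
  then have "\<exists>d>0. \<forall>F\<in>\<Phi>. \<forall>s. 0 < s \<and> s < d \<longrightarrow>
      (F (\<lambda>_. complex_of_real s) = 0 \<longleftrightarrow> (\<forall>s'. 0 < s' \<and> s' < R \<longrightarrow> F (\<lambda>_. complex_of_real s') = 0))"
    by (intro finite_common_bound[OF \<Phi>(1)]) blast
  then
  obtain d where d: "0 < d" "\<And>F s. F \<in> \<Phi> \<Longrightarrow> 0 < s \<Longrightarrow> s < d \<Longrightarrow>
      (F (\<lambda>_. complex_of_real s) = 0 \<longleftrightarrow> (\<forall>s'. 0 < s' \<and> s' < R \<longrightarrow> F (\<lambda>_. complex_of_real s') = 0))"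
    by blast
  have "curve_down 0 \<rho> \<Phi> a (\<lambda>s i. s)" if a: "0 < a 0" "\<bar>a 0\<bar> < min d \<rho>" for a
  proof -
    have cp: "F (cpt a) = F (\<lambda>_. complex_of_real (a 0))" if "F \<in> \<Phi>" for F
      by (rule hol_cong_point[OF \<Phi>(2)[OF that]]) auto
    have "F (cpt (\<lambda>_. s)) = 0 \<longleftrightarrow> F (cpt a) = 0" if "F \<in> \<Phi>" "s \<in> {0<..a 0}" for F s
      unfolding cp[OF that(1)]
      using d(2)[OF that(1), of s] d(2)[OF that(1), of "a 0"] that(2) a by simp
    then show ?thesis using a unfolding curve_down_def by (auto intro!: continuous_intros)
  qed
  then show ?thesis
    using d(1) R by (intro exI[of _ "min d \<rho>"] conjI allI impI exI[of _ "\<lambda>s i. s"]) auto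
qed

text \<open>
The names follow the outline at the beginning: \<open>G F\<close> is \<open>F\<close> with a power of the coordinate \<open>0\<close> divided out, \<open>\<Gamma>\<close> consists of these functions
and their reflections, \<open>L\<close> is the shear, \<open>H g\<close> is \<open>g\<close> in the sheared coordinates, \<open>Q\<close> is the product of all \<open>H g\<close>, and \<open>\<Psi>\<close> are
the functions of the first \<open>n\<close> coordinates whose zero status determines the number of distinct zeros of \<open>Q\<close> in the last coordinate.
\<close>

lemma curve_selection_Suc:
  assumes IH: "\<And>\<Psi> \<rho> R. finite \<Psi> \<Longrightarrow> (\<And>F. F \<in> \<Psi> \<Longrightarrow> hol n R F) \<Longrightarrow> 0 < R \<Longrightarrow> 0 < \<rho> \<Longrightarrow>
      \<exists>\<delta>>0. \<forall>a. 0 < a 0 \<and> (\<forall>i\<le>n. \<bar>a i\<bar> < \<delta>) \<longrightarrow> (\<exists>\<gamma>. curve_down n \<rho> \<Psi> a \<gamma>)"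
    and \<Phi>: "finite \<Phi>" "\<And>F. F \<in> \<Phi> \<Longrightarrow> hol (Suc n) R F" and R: "0 < R" "0 < \<rho>"
  shows "\<exists>\<delta>>0. \<forall>a. 0 < a 0 \<and> (\<forall>i\<le>Suc n. \<bar>a i\<bar> < \<delta>) \<longrightarrow> (\<exists>\<gamma>. curve_down (Suc n) \<rho> \<Phi> a \<gamma>)"
proof -
  let ?N = "Suc n"
  define r0 where "r0 = R / 2"
  have r0: "0 < r0" "r0 < R" using R by (auto simp: r0_def)
  \<comment> \<open>The functions outside \<open>\<Phi>1\<close> vanish at all real points near \<open>0\<close> and impose no condition.\<close>
  define \<Phi>1 where "\<Phi>1 = {F\<in>\<Phi>. \<exists>x. cpt x \<in> polydisc ?N r0 \<and> F (cpt x) \<noteq> 0}"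
  have "\<exists>G. hol ?N r0 G \<and> (\<exists>k. \<forall>a. cpt a \<in> polydisc ?N r0 \<longrightarrow> F (cpt a) = of_real (a 0) ^ k * G (cpt a)) \<and>
      (\<exists>v. cpt v \<in> polydisc ?N r0 \<and> v 0 = 0 \<and> G (cpt v) \<noteq> 0)" if "F \<in> \<Phi>1" for F
  proof -
    from that obtain x where F: "hol ?N R F" and x: "cpt x \<in> polydisc ?N r0" "F (cpt x) \<noteq> 0"
      using \<Phi>(2) by (auto simp: \<Phi>1_def)
    show ?thesis by (rule hol_divide_power[OF F r0 x]) blast
  qed
  then obtain G where G: "\<And>F. F \<in> \<Phi>1 \<Longrightarrow> hol ?N r0 (G F)"
    and G_pow: "\<And>F. F \<in> \<Phi>1 \<Longrightarrow> \<exists>k. \<forall>a. cpt a \<in> polydisc ?N r0 \<longrightarrow> F (cpt a) = of_real (a 0) ^ k * G F (cpt a)"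
    and G_nz: "\<And>F. F \<in> \<Phi>1 \<Longrightarrow> \<exists>v. cpt v \<in> polydisc ?N r0 \<and> v 0 = 0 \<and> G F (cpt v) \<noteq> 0"
    by metis
  have FG: "F (cpt a) = 0 \<longleftrightarrow> G F (cpt a) = 0" if "F \<in> \<Phi>1" "cpt a \<in> polydisc ?N r0" "0 < a 0" for F a
    using G_pow[OF that(1)] that(2,3) by auto
  define star where "star g z = cnj (g (\<lambda>i. cnj (z i)))" for g :: "(nat \<Rightarrow> complex) \<Rightarrow> complex" and z
  have star_cpt: "star g (cpt v) = cnj (g (cpt v))" for g v by (simp add: star_def)
  have star_star: "star (star g) = g" for g by (simp add: star_def fun_eq_iff)
  define \<Gamma> where "\<Gamma> = G ` \<Phi>1 \<union> star ` G ` \<Phi>1"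
  have fin\<Gamma>: "finite \<Gamma>" using \<Phi>(1) by (simp add: \<Gamma>_def \<Phi>1_def)
  have hol\<Gamma>: "hol ?N r0 g" if "g \<in> \<Gamma>" for g
  proof -
    have "hol ?N r0 (star g)" if "hol ?N r0 g" for g
      using hol_cnj[OF that] by (simp add: star_def[abs_def])
    then show ?thesis using that G by (auto simp: \<Gamma>_def)
  qed
  have star\<Gamma>: "star g \<in> \<Gamma>" if "g \<in> \<Gamma>" for g
    using that star_star by (auto simp: \<Gamma>_def)
  have nz\<Gamma>: "\<exists>v. cpt v \<in> polydisc ?N r0 \<and> v 0 = 0 \<and> g (cpt v) \<noteq> 0" if "g \<in> \<Gamma>" for g
  proof -
    from that obtain F where F: "F \<in> \<Phi>1" "g = G F \<or> g = star (G F)" by (auto simp: \<Gamma>_def)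
    obtain v where "cpt v \<in> polydisc ?N r0" "v 0 = 0" "G F (cpt v) \<noteq> 0" using G_nz[OF F(1)] by blast
    then show ?thesis using F(2) star_cpt[of "G F" v] by (intro exI[of _ v]) auto
  qed
  \<comment> \<open>Adding the last coordinate to \<open>\<Gamma>\<close> yields a direction \<open>v\<close> with nonzero last coordinate.\<close>
  let ?last = "\<lambda>z::nat \<Rightarrow> complex. z ?N"
  have lastnz: "\<exists>v. cpt v \<in> polydisc ?N r0 \<and> v 0 = 0 \<and> ?last (cpt v) \<noteq> 0"
    using r0(1) by (intro exI[of _ "(\<lambda>_. 0)(?N := r0 / 2)"]) (auto simp: polydisc_def)
  have "\<exists>v. cpt v \<in> polydisc ?N r0 \<and> v 0 = 0 \<and> (\<forall>g\<in>insert ?last \<Gamma>. g (cpt v) \<noteq> 0)"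
  proof (rule common_nonzero[OF _ r0(1)])
    show "hol ?N r0 g" if "g \<in> insert ?last \<Gamma>" for g
      using that hol\<Gamma> hol_coord[of ?N ?N r0] by blast
    show "\<exists>v. cpt v \<in> polydisc ?N r0 \<and> v 0 = 0 \<and> g (cpt v) \<noteq> 0" if "g \<in> insert ?last \<Gamma>" for g
      using that lastnz nz\<Gamma> by blast
  qed (use fin\<Gamma> in simp)
  then obtain v where v: "cpt v \<in> polydisc ?N r0" "v 0 = 0" "\<And>g. g \<in> \<Gamma> \<Longrightarrow> g (cpt v) \<noteq> 0" "v ?N \<noteq> 0"
    by auto
  define m where "m i = (if i = ?N then 0 else v i / v ?N)" for i
  have m0: "m 0 = 0" "m ?N = 0" by (auto simp: m_def v(2))
  define M where "M = (\<Sum>i\<le>?N. \<bar>m i\<bar>)"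
  have mM: "\<bar>m i\<bar> \<le> M" if "i \<le> ?N" for i
    unfolding M_def using that by (intro member_le_sum) auto
  have M0: "0 \<le> M" unfolding M_def by (intro sum_nonneg) auto
  define L where "L z = (\<lambda>i. z i + z ?N * complex_of_real (m i))" for z
  define Lr where "Lr x = (\<lambda>i. x i + x ?N * m i)" for x
  have L_cpt: "L (cpt x) = cpt (Lr x)" for x by (simp add: L_def Lr_def fun_eq_iff)
  define R1 where "R1 = r0 / (1 + M)"
  have R1: "0 < R1" "(1 + M) * R1 = r0" using r0(1) M0 by (auto simp: R1_def field_simps)
  have R1r0: "R1 \<le> r0" using R1 M0 mult_right_mono[of 1 "1 + M" R1] by simp
  have L_disc: "L z \<in> polydisc ?N r0" if z: "z \<in> polydisc ?N R1" for z
  proof -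
    have "norm (L z i) < r0" if "i \<le> ?N" for i
    proof -
      have "norm (L z i) \<le> norm (z i) + norm (z ?N) * \<bar>m i\<bar>"
        unfolding L_def using norm_triangle_ineq[of "z i" "z ?N * of_real (m i)"] by (simp add: norm_mult)
      also have "norm (z ?N) * \<bar>m i\<bar> \<le> R1 * M"
        using z mM[OF that] R1(1) by (intro mult_mono) (auto simp: polydisc_def less_imp_le)
      also have "norm (z i) < R1" using z that by (simp add: polydisc_def)
      finally show ?thesis using R1(2) by (simp add: algebra_simps)
    qed
    then show ?thesis by (simp add: polydisc_def)
  qed
  define H where "H g z = g (L z)" for g :: "(nat \<Rightarrow> complex) \<Rightarrow> complex" and z
  have holH: "hol ?N R1 (H g)" if "g \<in> \<Gamma>" for g
  proof -
    have "hol ?N R1 (\<lambda>z. g (L z))"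
    proof (rule hol_compose_affine[OF hol\<Gamma>[OF that] L_disc, where T' = L])
      show "continuous_on UNIV L"
        unfolding L_def
        by (intro continuous_on_coordinatewise_then_product continuous_on_add continuous_on_mult
            continuous_on_const continuous_on_coord)
    qed (auto simp: L_def algebra_simps)
    then show ?thesis by (simp add: H_def[abs_def])
  qed
  \<comment> \<open>The shear sends the last coordinate axis to the line through \<open>v\<close>, on which no function in \<open>\<Gamma>\<close> is identically zero.\<close>
  define w where "w i = complex_of_real (v i / v ?N)" for i
  have L_axis: "L ((\<lambda>_. 0)(?N := \<zeta>)) = (\<lambda>i. 0 + \<zeta> * w i)" for \<zeta>
    using v(4) by (auto simp: L_def w_def m_def fun_eq_iff)
  let ?S = "{\<zeta>. (\<lambda>i. 0 + \<zeta> * w i) \<in> polydisc ?N r0}"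
  have w_v: "(\<lambda>i. 0 + complex_of_real (v ?N) * w i) = cpt v"
    using v(4) by (auto simp: w_def fun_eq_iff)
  have S: "open ?S" "connected ?S"
    using open_line_polydisc[of "\<lambda>_. 0" w ?N r0] convex_connected[OF convex_line_polydisc[of "\<lambda>_. 0" w ?N r0]]
    by auto
  have S0: "0 \<in> ?S" using r0(1) by (simp add: polydisc_def)
  have Sv: "complex_of_real (v ?N) \<in> ?S" unfolding mem_Collect_eq w_v by (rule v(1))
  have "(\<lambda>\<zeta>. \<Prod>g\<in>\<Gamma>. g (\<lambda>i. 0 + \<zeta> * w i)) holomorphic_on ?S"
    by (intro holomorphic_on_prod) (rule holD(2)[OF hol\<Gamma>])
  moreover have "(\<Prod>g\<in>\<Gamma>. g (\<lambda>i. 0 + complex_of_real (v ?N) * w i)) \<noteq> 0"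
    unfolding w_v using v(3) fin\<Gamma> by simp
  ultimately obtain e where e: "0 < e" "\<forall>\<zeta>\<in>ball 0 e - {0}. (\<Prod>g\<in>\<Gamma>. g (\<lambda>i. 0 + \<zeta> * w i)) \<noteq> 0"
    using punctured_nonzero[of "\<lambda>\<zeta>. \<Prod>g\<in>\<Gamma>. g (\<lambda>i. 0 + \<zeta> * w i)" ?S 0 "of_real (v ?N)", OF _ S S0 Sv] by blast
  \<comment> \<open>Half of \<open>\<rho>\<close> is left for the other coordinates: undoing the shear moves them by at most \<open>M r\<close>.\<close>
  define r where "r = min (min e R1) (\<rho> / (1 + M)) / 2"
  have r: "0 < r" "r < e" "r < R1" "(1 + M) * r \<le> \<rho> / 2"
  proof -
    have p: "0 < \<rho> / (1 + M)" using R(2) M0 by simp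
    show "0 < r" "r < e" "r < R1" using e(1) R1(1) p by (auto simp: r_def)
    have "r \<le> \<rho> / (1 + M) / 2" unfolding r_def by (intro divide_right_mono) auto
    then have "(1 + M) * r \<le> (1 + M) * (\<rho> / (1 + M) / 2)" using M0 by (intro mult_left_mono) auto
    also have "\<dots> = \<rho> / 2"
    proof -
      have "1 + M \<noteq> 0" using M0 by linarith
      from nonzero_mult_div_cancel_left[OF this, of "\<rho> / 2"]
      show ?thesis by (simp only: times_divide_eq_right divide_divide_eq_left mult.commute)
    qed
    finally show "(1 + M) * r \<le> \<rho> / 2" .
  qed
  define Q where "Q z = (\<Prod>g\<in>\<Gamma>. H g z)" for z
  have holQ: "hol ?N R1 Q" unfolding Q_def[abs_def] using holH by (intro hol_prod) auto
  have Q0: "Q ((\<lambda>_. 0)(?N := \<zeta>)) \<noteq> 0" if "norm \<zeta> = r" for \<zeta>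
  proof -
    have "\<zeta> \<in> ball 0 e - {0}" using that r by auto
    then show ?thesis using e(2) unfolding Q_def H_def L_axis by blast
  qed
  obtain \<delta>1 \<Psi> where \<delta>1: "0 < \<delta>1" "\<delta>1 \<le> R1" and \<Psi>: "finite \<Psi>" "\<And>D. D \<in> \<Psi> \<Longrightarrow> hol n \<delta>1 D"
    and Qnz: "\<And>c \<zeta>. c \<in> polydisc n \<delta>1 \<Longrightarrow> norm \<zeta> = r \<Longrightarrow> Q (c(?N := \<zeta>)) \<noteq> 0"
    and Qfin: "\<And>c. c \<in> polydisc n \<delta>1 \<Longrightarrow> finite (disc_zeros r (\<lambda>\<zeta>. Q (c(?N := \<zeta>))))"
    and Qcard: "\<And>c c'. c \<in> polydisc n \<delta>1 \<Longrightarrow> c' \<in> polydisc n \<delta>1 \<Longrightarrow> (\<And>D. D \<in> \<Psi> \<Longrightarrow> D c = 0 \<longleftrightarrow> D c' = 0) \<Longrightarrow>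
       card (disc_zeros r (\<lambda>\<zeta>. Q (c(?N := \<zeta>)))) = card (disc_zeros r (\<lambda>\<zeta>. Q (c'(?N := \<zeta>))))"
    by (rule zero_count_functions[OF holQ r(1,3) Q0]) blast+
  define \<rho>' where "\<rho>' = min \<delta>1 (\<rho> / 2)"
  have \<rho>': "0 < \<rho>'" "\<rho>' \<le> \<delta>1" "\<rho>' \<le> \<rho> / 2" using \<delta>1 R(2) by (auto simp: \<rho>'_def)
  obtain \<delta>2 where \<delta>2: "0 < \<delta>2" "\<And>a. 0 < a 0 \<Longrightarrow> (\<forall>i\<le>n. \<bar>a i\<bar> < \<delta>2) \<Longrightarrow> \<exists>\<gamma>. curve_down n \<rho>' \<Psi> a \<gamma>"
    using IH[OF \<Psi> \<delta>1(1) \<rho>'(1)] by blast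
  define \<delta> where "\<delta> = min (min \<delta>1 \<delta>2) r / (1 + M)"
  have \<delta>: "0 < \<delta>" using \<delta>1(1) \<delta>2(1) r(1) M0 by (simp add: \<delta>_def)
  have "(1 + M) * \<delta> = min (min \<delta>1 \<delta>2) r" using M0 by (simp add: \<delta>_def)
  then have \<delta>M: "(1 + M) * \<delta> \<le> \<delta>1" "(1 + M) * \<delta> \<le> \<delta>2" "(1 + M) * \<delta> \<le> r" by auto
  show ?thesis
  proof (intro exI[of _ \<delta>] conjI allI impI)
    fix a :: "nat \<Rightarrow> real" assume "0 < a 0 \<and> (\<forall>i\<le>?N. \<bar>a i\<bar> < \<delta>)"
    then have a: "0 < a 0" "\<And>i. i \<le> ?N \<Longrightarrow> \<bar>a i\<bar> < \<delta>" by auto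
    define b where "b i = a i - a ?N * m i" for i
    have Lb: "Lr b = a" by (simp add: Lr_def b_def fun_eq_iff m0)
    have b0: "b 0 = a 0" by (simp add: b_def m0)
    have bb: "\<bar>b i\<bar> < (1 + M) * \<delta>" if "i \<le> ?N" for i
    proof -
      have "\<bar>b i\<bar> \<le> \<bar>a i\<bar> + \<bar>a ?N\<bar> * \<bar>m i\<bar>" unfolding b_def by (metis abs_mult abs_triangle_ineq4)
      also have "\<bar>a ?N\<bar> * \<bar>m i\<bar> \<le> \<delta> * M"
        using a(2)[of ?N] mM[OF that] \<delta> by (intro mult_mono) auto
      also have "\<bar>a i\<bar> < \<delta>" by (rule a(2)[OF that])
      finally show ?thesis by (simp add: algebra_simps)
    qed
    have bpos: "0 < b 0" using a(1) b0 by simp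
    have bsmall: "\<forall>i\<le>n. \<bar>b i\<bar> < \<delta>2" using bb \<delta>M(2) by (meson le_SucI less_le_trans)
    obtain \<gamma> where \<gamma>: "curve_down n \<rho>' \<Psi> b \<gamma>" using \<delta>2(2)[OF bpos bsmall] by blast
    define I where "I = {0<..a 0}"
    have I: "connected I" "a 0 \<in> I" using a(1) by (auto simp: I_def)
    have g_cont: "continuous_on I (\<lambda>s. \<gamma> s i)" for i
      using \<gamma> b0 by (auto simp: curve_down_def I_def)
    have g_end: "\<gamma> (a 0) i = b i" if "i \<le> n" for i
      using \<gamma> b0 that by (auto simp: curve_down_def)
    have g_0: "\<gamma> s 0 = s" and g_small: "\<And>i. i \<le> n \<Longrightarrow> \<bar>\<gamma> s i\<bar> < \<rho>'"
      and g_stat: "\<And>D. D \<in> \<Psi> \<Longrightarrow> D (cpt (\<gamma> s)) = 0 \<longleftrightarrow> D (cpt b) = 0" if "s \<in> I" for s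
      using \<gamma> b0 that by (auto simp: curve_down_def I_def)
    have g_disc: "cpt (\<gamma> s) \<in> polydisc n \<delta>1" if "s \<in> I" for s
      using g_small[OF that] \<rho>'(2) by (force simp: polydisc_def)
    have bb1: "\<bar>b i\<bar> < \<delta>1" if "i \<le> ?N" for i using bb[OF that] \<delta>M(1) by linarith
    have b_disc: "cpt b \<in> polydisc n \<delta>1" using bb1 by (simp add: polydisc_def)
    have g_upd: "(cpt (\<gamma> s))(?N := \<zeta>) \<in> polydisc ?N R1" if "s \<in> I" "norm \<zeta> < R1" for s \<zeta>
      using g_disc[OF that(1)] that(2) polydisc_mono[of n n \<delta>1 R1] \<delta>1(2) by (auto simp: polydisc_Suc_upd)
    define f where "f g s \<zeta> = H g ((cpt (\<gamma> s))(?N := \<zeta>))" for g s \<zeta>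
    have Qf: "(\<Prod>g\<in>\<Gamma>. f g s \<zeta>) = Q ((cpt (\<gamma> s))(?N := \<zeta>))" for s \<zeta>
      by (simp add: f_def Q_def)
    have f_cont: "continuous_on (I \<times> ball 0 R1) (\<lambda>(s, \<zeta>). f g s \<zeta>)" if "g \<in> \<Gamma>" for g
      unfolding f_def case_prod_unfold
    proof (rule hol_continuous_on[OF holH[OF that]])
      have "continuous_on (I \<times> ball (0::complex) R1) (\<lambda>p. \<gamma> (fst p) i)" for i
        by (rule continuous_on_compose2[OF g_cont continuous_on_fst[OF continuous_on_id]]) auto
      then show "continuous_on (I \<times> ball 0 R1) (\<lambda>p. (cpt (\<gamma> (fst p)))(?N := snd p))"
        by (intro continuous_on_fun_upd continuous_on_coordinatewise_then_product continuous_on_of_real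
            continuous_on_snd continuous_on_id)
      show "(cpt (\<gamma> (fst p)))(?N := snd p) \<in> polydisc ?N R1" if "p \<in> I \<times> ball 0 R1" for p
        using that by (intro g_upd) auto
    qed
    have f_hol: "f g s holomorphic_on ball 0 R1" if "g \<in> \<Gamma>" "s \<in> I" for g s
      unfolding f_def using hol_slice[OF holH[OF that(1)] g_upd[OF that(2)]] by blast
    have f_sym: "f (star g) s (cnj \<zeta>) = cnj (f g s \<zeta>)" for g s \<zeta>
    proof -
      have "(\<lambda>i. cnj (L ((cpt (\<gamma> s))(?N := cnj \<zeta>)) i)) = L ((cpt (\<gamma> s))(?N := \<zeta>))"
        by (auto simp: L_def fun_eq_iff)
      then show ?thesis by (simp add: f_def H_def star_def)
    qed
    have bN: "\<bar>b ?N\<bar> < r" using bb[of ?N] \<delta>M(3) by simp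
    have dz: "disc_zeros r (\<lambda>\<zeta>. \<Prod>g\<in>\<Gamma>. f g s \<zeta>) = disc_zeros r (\<lambda>\<zeta>. Q ((cpt (\<gamma> s))(?N := \<zeta>)))" for s
      by (simp only: Qf)
    have "\<exists>\<eta>. continuous_on I \<eta> \<and> \<eta> (a 0) = b ?N \<and> (\<forall>s\<in>I. \<bar>\<eta> s\<bar> < r) \<and>
        (\<forall>s\<in>I. \<forall>g\<in>\<Gamma>. f g s (of_real (\<eta> s)) = 0 \<longleftrightarrow> f g (a 0) (of_real (b ?N)) = 0)"
    proof (rule real_section[where N = "card (disc_zeros r (\<lambda>\<zeta>. Q ((cpt b)(?N := \<zeta>))))",
          OF fin\<Gamma> I(1) f_cont f_hol r(1,3) _ _ _ I(2) bN])
      show "(\<Prod>g\<in>\<Gamma>. f g s \<zeta>) \<noteq> 0" if "s \<in> I" "norm \<zeta> = r" for s \<zeta>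
        unfolding Qf by (rule Qnz[OF g_disc[OF that(1)] that(2)])
      show "finite (disc_zeros r (\<lambda>\<zeta>. \<Prod>g\<in>\<Gamma>. f g s \<zeta>)) \<and>
          card (disc_zeros r (\<lambda>\<zeta>. \<Prod>g\<in>\<Gamma>. f g s \<zeta>)) = card (disc_zeros r (\<lambda>\<zeta>. Q ((cpt b)(?N := \<zeta>))))"
        if "s \<in> I" for s
        unfolding dz using Qfin[OF g_disc[OF that]] Qcard[OF g_disc[OF that] b_disc g_stat[OF that]] by blast
      show "cnj \<zeta> \<in> disc_zeros r (\<lambda>\<zeta>. \<Prod>g\<in>\<Gamma>. f g s \<zeta>)"
        if "s \<in> I" and z: "\<zeta> \<in> disc_zeros r (\<lambda>\<zeta>. \<Prod>g\<in>\<Gamma>. f g s \<zeta>)" for s \<zeta>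
      proof -
        obtain g where g: "g \<in> \<Gamma>" "f g s \<zeta> = 0" using z fin\<Gamma> by (auto simp: disc_zeros_def)
        then have "f (star g) s (cnj \<zeta>) = 0" by (simp add: f_sym)
        then have "(\<Prod>g\<in>\<Gamma>. f g s (cnj \<zeta>)) = 0" using star\<Gamma>[OF g(1)] fin\<Gamma> by (auto intro: prod_zero)
        then show ?thesis using z by (simp add: disc_zeros_def)
      qed
      fix \<eta> assume "continuous_on I \<eta>" "\<eta> (a 0) = b ?N" "\<And>s. s \<in> I \<Longrightarrow> \<bar>\<eta> s\<bar> < r"
        "\<And>s g. s \<in> I \<Longrightarrow> g \<in> \<Gamma> \<Longrightarrow> f g s (of_real (\<eta> s)) = 0 \<longleftrightarrow> f g (a 0) (of_real (b ?N)) = 0"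
      then show "\<exists>\<eta>. continuous_on I \<eta> \<and> \<eta> (a 0) = b ?N \<and> (\<forall>s\<in>I. \<bar>\<eta> s\<bar> < r) \<and>
          (\<forall>s\<in>I. \<forall>g\<in>\<Gamma>. f g s (of_real (\<eta> s)) = 0 \<longleftrightarrow> f g (a 0) (of_real (b ?N)) = 0)"
        by (intro exI[of _ \<eta>]) blast
    qed
    then obtain \<eta> where \<eta>: "continuous_on I \<eta>" "\<eta> (a 0) = b ?N" "\<And>s. s \<in> I \<Longrightarrow> \<bar>\<eta> s\<bar> < r"
      and \<eta>stat: "\<And>s g. s \<in> I \<Longrightarrow> g \<in> \<Gamma> \<Longrightarrow> f g s (of_real (\<eta> s)) = 0 \<longleftrightarrow> f g (a 0) (of_real (b ?N)) = 0"
      by blast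
    define \<beta> where "\<beta> s = (\<gamma> s)(?N := \<eta> s)" for s
    have f_\<beta>: "f g s (of_real (\<eta> s)) = g (cpt (Lr (\<beta> s)))" for g s
      unfolding f_def H_def cpt_upd L_cpt \<beta>_def ..
    have \<beta>_end: "Lr (\<beta> (a 0)) i = a i" if "i \<le> ?N" for i
    proof -
      have "\<beta> (a 0) i = b i" if "i \<le> ?N" for i
        using that g_end[of i] \<eta>(2) by (auto simp: \<beta>_def le_Suc_eq)
      then show ?thesis using that Lb by (simp add: Lr_def fun_eq_iff)
    qed
    have f_end: "f g (a 0) (of_real (b ?N)) = g (cpt a)" if "g \<in> \<Gamma>" for g
    proof -
      have "f g (a 0) (of_real (b ?N)) = g (cpt (Lr (\<beta> (a 0))))" using f_\<beta>[of g "a 0"] \<eta>(2) by simp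
      also have "\<dots> = g (cpt a)" by (rule hol_cong_point[OF hol\<Gamma>[OF that]]) (simp add: \<beta>_end)
      finally show ?thesis .
    qed
    have \<beta>disc: "cpt (Lr (\<beta> s)) \<in> polydisc ?N r0" if "s \<in> I" for s
    proof -
      have "cpt (\<beta> s) \<in> polydisc ?N R1"
        using g_upd[OF that, of "of_real (\<eta> s)"] \<eta>(3)[OF that] r(3) unfolding \<beta>_def cpt_upd by simp
      from L_disc[OF this] show ?thesis by (simp only: L_cpt)
    qed
    have adisc: "cpt a \<in> polydisc ?N r0"
    proof -
      have "\<bar>b i\<bar> < R1" if "i \<le> ?N" for i using bb1[OF that] \<delta>1(2) by linarith
      then have "cpt b \<in> polydisc ?N R1" by (simp add: polydisc_def)
      from L_disc[OF this] show ?thesis by (simp only: L_cpt Lb)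
    qed
    have \<beta>0: "Lr (\<beta> s) 0 = s" if "s \<in> I" for s
      using g_0[OF that] by (simp add: Lr_def \<beta>_def m0)
    have "curve_down ?N \<rho> \<Phi> a (\<lambda>s. Lr (\<beta> s))"
      unfolding curve_down_def I_def[symmetric]
    proof (intro conjI allI impI ballI)
      show "continuous_on I (\<lambda>s. Lr (\<beta> s) i)" for i
        unfolding Lr_def \<beta>_def using g_cont[of i] \<eta>(1)
        by (cases "i = ?N") (auto intro!: continuous_intros)
      show "Lr (\<beta> (a 0)) i = a i" if "i \<le> ?N" for i by (rule \<beta>_end[OF that])
      show "Lr (\<beta> s) 0 = s" if "s \<in> I" for s by (rule \<beta>0[OF that])
      show "\<bar>Lr (\<beta> s) i\<bar> < \<rho>" if s: "s \<in> I" and i: "i \<le> ?N" for s i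
      proof -
        have Mr: "r + r * M \<le> \<rho> / 2" using r(4) by (simp add: algebra_simps)
        have "\<bar>\<eta> s * m i\<bar> \<le> r * M"
          unfolding abs_mult using \<eta>(3)[OF s] mM[OF i] r(1) by (intro mult_mono) auto
        moreover have "\<bar>\<beta> s i\<bar> < max \<rho>' r"
          using g_small[OF s, of i] \<eta>(3)[OF s] i by (auto simp: \<beta>_def le_Suc_eq)
        moreover have "Lr (\<beta> s) i = \<beta> s i + \<eta> s * m i" by (simp add: Lr_def \<beta>_def)
        moreover have "0 \<le> r * M" using r(1) M0 by simp
        ultimately show ?thesis
          using Mr \<rho>'(3) r(1) R(2) m0(2) i \<eta>(3)[OF s] g_small[OF s, of i]
          by (cases "i = ?N") (auto simp: \<beta>_def le_Suc_eq)
      qed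
      show "F (cpt (Lr (\<beta> s))) = 0 \<longleftrightarrow> F (cpt a) = 0" if s: "s \<in> I" and F: "F \<in> \<Phi>" for s F
      proof (cases "F \<in> \<Phi>1")
        case True
        then have GF: "G F \<in> \<Gamma>" by (simp add: \<Gamma>_def)
        have "0 < Lr (\<beta> s) 0" using \<beta>0[OF s] s by (simp add: I_def)
        from FG[OF True \<beta>disc[OF s] this] FG[OF True adisc a(1)] \<eta>stat[OF s GF]
        show ?thesis unfolding f_\<beta> f_end[OF GF] by simp
      next
        case False
        then show ?thesis using F \<beta>disc[OF s] adisc by (auto simp: \<Phi>1_def)
      qed
    qed
    then show "\<exists>\<gamma>. curve_down ?N \<rho> \<Phi> a \<gamma>" by blast
  qed (rule \<delta>)
qed

theorem curve_selection:
  assumes "finite \<Phi>" "\<And>F. F \<in> \<Phi> \<Longrightarrow> hol n R F" "0 < R" "0 < \<rho>"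
  shows "\<exists>\<delta>>0. \<forall>a. 0 < a 0 \<and> (\<forall>i\<le>n. \<bar>a i\<bar> < \<delta>) \<longrightarrow> (\<exists>\<gamma>. curve_down n \<rho> \<Phi> a \<gamma>)"
  using assms
proof (induction n arbitrary: \<Phi> R \<rho>)
  case 0
  then show ?case by (rule curve_selection_0)
next
  case (Suc n)
  show ?case by (rule curve_selection_Suc[OF Suc.IH Suc.prems]) assumption+
qed

section \<open>Lipschitz normal embedding and the blowing-up\<close>

text \<open>
The path ends in \<open>z\<close> and tends to \<open>(u0, 0)\<close> as the parameter tends to \<open>0\<close>. The squared distance is used as the parameter because
it is a polynomial in the coordinates.
\<close>

definition descends :: "(real ^ 'm) set \<Rightarrow> real ^ 'm \<Rightarrow> (real ^ 'm) \<times> real \<Rightarrow> bool" where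
  "descends X u0 z \<longleftrightarrow> (\<exists>\<gamma>. continuous_on {0<..(dist z (u0, 0))\<^sup>2} \<gamma> \<and> \<gamma> ((dist z (u0, 0))\<^sup>2) = z \<and>
     (\<forall>s\<in>{0<..(dist z (u0, 0))\<^sup>2}. \<gamma> s \<in> blowup_preimage X \<and> (dist (\<gamma> s) (u0, 0))\<^sup>2 = s))"

text \<open>
The polygon with the two vertices \<open>g 0\<close>, \<open>g t\<close> is inscribed.
\<close>

lemma dist_le_path_length:
  assumes "t \<in> {0..1}"
  shows "ennreal (dist (g 0) (g t)) \<le> path_length g"
proof -
  have ts: "[0, t] \<in> {ts. sorted ts \<and> set ts \<subseteq> {0..1}}" using assms by auto
  have "(\<Sum>i<length [0, t] - 1. ennreal (dist (g ([0, t] ! i)) (g ([0, t] ! Suc i)))) \<le> path_length g"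
    unfolding path_length_def by (rule SUP_upper[OF ts])
  then show ?thesis by simp
qed

text \<open>
One \<open>\<kappa>\<close> in the change of direction comes from the displacement, the other from renormalising.
\<close>

lemma polar_perturbation:
  fixes p q :: "'a::real_normed_vector"
  assumes p: "p \<noteq> 0" and q: "norm (q - p) \<le> \<kappa> * norm p" and \<kappa>: "\<kappa> < 1"
  shows "q \<noteq> 0" "norm q \<le> (1 + \<kappa>) * norm p" "norm (q /\<^sub>R norm q - p /\<^sub>R norm p) \<le> 2 * \<kappa>"
proof -
  have np: "0 < norm p" using p by simp
  then have "\<kappa> * norm p < 1 * norm p" using \<kappa> by (intro mult_strict_right_mono)
  then have "norm (q - p) < norm p" using q by simp
  then show q0: "q \<noteq> 0" by auto
  show "norm q \<le> (1 + \<kappa>) * norm p"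
    using norm_triangle_sub[of q p] q by (simp add: algebra_simps)
  have nq: "0 < norm q" using q0 by simp
  have "norm p * norm (q /\<^sub>R norm q - p /\<^sub>R norm p) = norm (norm p *\<^sub>R (q /\<^sub>R norm q - p /\<^sub>R norm p))"
    by simp
  also have "norm p *\<^sub>R (q /\<^sub>R norm q - p /\<^sub>R norm p) = (q - p) + (norm p - norm q) *\<^sub>R (q /\<^sub>R norm q)"
    using np nq by (simp add: algebra_simps)
  also have "norm \<dots> \<le> norm (q - p) + norm ((norm p - norm q) *\<^sub>R (q /\<^sub>R norm q))"
    by (rule norm_triangle_ineq)
  also have "norm ((norm p - norm q) *\<^sub>R (q /\<^sub>R norm q)) = \<bar>norm p - norm q\<bar>"
  proof -
    have unit: "norm (q /\<^sub>R norm q) = 1" using nq by simp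
    show ?thesis by (simp only: norm_scaleR[of "norm p - norm q"] unit mult_1_right)
  qed
  also have "\<dots> \<le> norm (q - p)"
    using norm_triangle_ineq3[of p q] by (simp add: norm_minus_commute)
  finally have "norm p * norm (q /\<^sub>R norm q - p /\<^sub>R norm p) \<le> norm p * (2 * \<kappa>)"
    using q by (simp add: algebra_simps)
  then show "norm (q /\<^sub>R norm q - p /\<^sub>R norm p) \<le> 2 * \<kappa>" using np by simp
qed

lemma blowup_preimage_iff:
  "(u, r) \<in> blowup_preimage X \<longleftrightarrow> norm u = 1 \<and> 0 < r \<and> r *\<^sub>R u \<in> X"
  by (auto simp: blowup_preimage_def blowup_map_def less_le)

lemma connected_component_image:
  assumes "continuous_on I \<gamma>" "connected I" "\<gamma> ` I \<subseteq> S" "s \<in> I" "t \<in> I"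
  shows "connected_component S (\<gamma> s) (\<gamma> t)"
  unfolding connected_component_def
  using assms by (intro exI[of _ "\<gamma> ` I"]) (auto intro: connected_continuous_image)

text \<open>
The height (the second component) is positive and continuous along the path and at most the distance to \<open>(u0, 0)\<close>, so it takes
every small positive value while the path is close to \<open>(u0, 0)\<close>.
\<close>

lemma descends_level:
  assumes z: "z \<in> blowup_preimage X" "descends X u0 z" and \<delta>: "0 < \<delta>" "\<delta> \<le> dist z (u0, 0)"
  obtains l where "0 < l" "l \<le> \<delta>" "\<And>h. 0 < h \<Longrightarrow> h \<le> l \<Longrightarrow>
     \<exists>u. (u, h) \<in> blowup_preimage X \<and> dist u u0 \<le> \<delta> \<and>
       (\<forall>\<epsilon>. dist z (u0, 0) < \<epsilon> \<longrightarrow> connected_component (blowup_preimage X \<inter> ball (u0, 0) \<epsilon>) z (u, h))"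
proof -
  define T where "T = (dist z (u0, 0))\<^sup>2"
  obtain \<gamma> where \<gamma>: "continuous_on {0<..T} \<gamma>" "\<gamma> T = z"
      "\<And>s. s \<in> {0<..T} \<Longrightarrow> \<gamma> s \<in> blowup_preimage X \<and> (dist (\<gamma> s) (u0, 0))\<^sup>2 = s"
    using z(2) unfolding descends_def T_def by blast
  have \<delta>T: "\<delta>\<^sup>2 \<le> T" using \<delta> by (simp add: T_def power_mono)
  have "0 < dist z (u0, 0)" using \<delta> by linarith
  then have Tpos: "0 < T" unfolding T_def by (rule zero_less_power)
  have d: "dist (\<gamma> s) (u0, 0) \<le> c" if "s \<in> {0<..T}" "s \<le> c\<^sup>2" "0 \<le> c" for s c
    using \<gamma>(3)[OF that(1)] that(2,3) by (metis power2_le_imp_le)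
  have snd_le: "\<bar>snd (\<gamma> s)\<bar> \<le> dist (\<gamma> s) (u0, 0)" for s
    using dist_snd_le[of "\<gamma> s" "(u0, 0)"] by (simp add: dist_real_def)
  have pos: "0 < snd (\<gamma> s)" if "s \<in> {0<..T}" for s
    using \<gamma>(3)[OF that] blowup_preimage_iff[of "fst (\<gamma> s)" "snd (\<gamma> s)" X] by simp
  define l where "l = snd (\<gamma> (\<delta>\<^sup>2))"
  have \<delta>I: "\<delta>\<^sup>2 \<in> {0<..T}" using \<delta>T \<delta>(1) by simp
  have l: "0 < l" "l \<le> \<delta>"
    using pos[OF \<delta>I] snd_le[of "\<delta>\<^sup>2"] d[OF \<delta>I, of \<delta>] \<delta>(1) by (auto simp: l_def)
  \<comment> \<open>At the parameter \<open>h\<^sup>2\<close> the distance, and hence the height, is at most \<open>h\<close>; at \<open>\<delta>\<^sup>2\<close> the height is \<open>l \<ge> h\<close>.\<close>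
  show ?thesis
  proof (rule that[OF l])
    fix h assume h: "0 < h" "h \<le> l"
    have h\<delta>: "h\<^sup>2 \<le> \<delta>\<^sup>2" using h l by (intro power_mono) auto
    have hI: "h\<^sup>2 \<in> {0<..T}" using h\<delta> \<delta>T h by simp
    have "snd (\<gamma> (h\<^sup>2)) \<le> h" using snd_le[of "h\<^sup>2"] d[OF hI, of h] h by simp
    moreover have "h \<le> snd (\<gamma> (\<delta>\<^sup>2))" using h(2) by (simp add: l_def)
    moreover have "continuous_on {h\<^sup>2..\<delta>\<^sup>2} (\<lambda>s. snd (\<gamma> s))"
    proof (intro continuous_on_snd continuous_on_subset[OF \<gamma>(1)] subsetI)
      fix t assume "t \<in> {h\<^sup>2..\<delta>\<^sup>2}"
      then have "h\<^sup>2 \<le> t" "t \<le> \<delta>\<^sup>2" by auto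
      moreover have "0 < h\<^sup>2" using h(1) by simp
      ultimately show "t \<in> {0<..T}" unfolding greaterThanAtMost_iff using \<delta>T by linarith
    qed
    ultimately obtain s where s: "h\<^sup>2 \<le> s" "s \<le> \<delta>\<^sup>2" "snd (\<gamma> s) = h"
      using IVT'[of "\<lambda>s. snd (\<gamma> s)" "h\<^sup>2" h "\<delta>\<^sup>2"] h\<delta> by auto
    have "0 < h\<^sup>2" using h(1) by simp
    then have sI: "s \<in> {0<..T}" unfolding greaterThanAtMost_iff using s(1,2) \<delta>T by linarith
    let ?u = "fst (\<gamma> s)"
    have g: "\<gamma> s = (?u, h)" using s(3) by (simp add: prod_eq_iff)
    have "dist ?u u0 \<le> dist (\<gamma> s) (u0, 0)" using dist_fst_le[of "\<gamma> s" "(u0, 0)"] by simp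
    then have "dist ?u u0 \<le> \<delta>" using d[OF sI s(2)] \<delta>(1) by simp
    moreover have "(?u, h) \<in> blowup_preimage X" using \<gamma>(3)[OF sI] g by simp
    moreover have "connected_component (blowup_preimage X \<inter> ball (u0, 0) \<epsilon>) z (?u, h)"
      if \<epsilon>: "dist z (u0, 0) < \<epsilon>" for \<epsilon>
    proof -
      have "\<gamma> ` {0<..T} \<subseteq> blowup_preimage X \<inter> ball (u0, 0) \<epsilon>"
      proof
        fix y assume "y \<in> \<gamma> ` {0<..T}"
        then obtain t where t: "t \<in> {0<..T}" "y = \<gamma> t" by blast
        have "dist y (u0, 0) \<le> dist z (u0, 0)"
          using d[OF t(1), of "dist z (u0, 0)"] t by (simp add: T_def)
        then show "y \<in> blowup_preimage X \<inter> ball (u0, 0) \<epsilon>"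
          using \<gamma>(3)[OF t(1)] t(2) \<epsilon> by (simp add: dist_commute)
      qed
      moreover have "T \<in> {0<..T}" using Tpos by simp
      ultimately have "connected_component (blowup_preimage X \<inter> ball (u0, 0) \<epsilon>) (\<gamma> T) (\<gamma> s)"
        using connected_component_image[OF \<gamma>(1) _ _ _ sI] by simp
      then show ?thesis using \<gamma>(2) g by simp
    qed
    ultimately show "\<exists>u. (u, h) \<in> blowup_preimage X \<and> dist u u0 \<le> \<delta> \<and>
       (\<forall>\<epsilon>. dist z (u0, 0) < \<epsilon> \<longrightarrow> connected_component (blowup_preimage X \<inter> ball (u0, 0) \<epsilon>) z (u, h))"
      by blast
  qed
qed

lemma lipschitz_link:
  assumes U: "open U" "0 \<in> U" and L: "1 \<le> L"
    and lip: "\<And>x1 x2. x1 \<in> X \<inter> U \<Longrightarrow> x2 \<in> X \<inter> U \<Longrightarrow> inner_dist (X \<inter> U) x1 x2 \<le> ennreal (L * norm (x1 - x2))"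
    and \<epsilon>: "0 < \<epsilon>"
  obtains \<delta> where "0 < \<delta>" "\<And>u1 u2 h. (u1, h) \<in> blowup_preimage X \<Longrightarrow> (u2, h) \<in> blowup_preimage X \<Longrightarrow>
     dist u1 u0 \<le> \<delta> \<Longrightarrow> dist u2 u0 \<le> \<delta> \<Longrightarrow> h \<le> \<delta> \<Longrightarrow>
     connected_component (blowup_preimage X \<inter> ball (u0, 0) \<epsilon>) (u1, h) (u2, h)"
proof -
  obtain d0 where d0: "0 < d0" "ball 0 d0 \<subseteq> U" using U open_contains_ball by blast
  \<comment> \<open>Points of height \<open>h\<close> within \<open>\<delta>\<close> of \<open>u0\<close> are joined by a path of length below \<open>K \<delta> h\<close>: \<open>2 L \<delta> h\<close> from the Lipschitz bound,
    and \<open>\<delta> h\<close> because the infimum need not be attained.\<close>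
  define K where "K = 2 * L + 1"
  have K: "3 \<le> K" using L by (simp add: K_def)
  define \<delta> where "\<delta> = min (min d0 (1 / K)) (\<epsilon> / (2 * K + 3)) / 2"
  have pos: "0 < d0" "0 < 1 / K" "0 < \<epsilon> / (2 * K + 3)" using d0(1) K \<epsilon> by auto
  then have "0 < min (min d0 (1 / K)) (\<epsilon> / (2 * K + 3))" by simp
  moreover have "2 * \<delta> = min (min d0 (1 / K)) (\<epsilon> / (2 * K + 3))" by (simp add: \<delta>_def)
  ultimately have \<delta>: "0 < \<delta>" "\<delta> < d0" "\<delta> < 1 / K" "\<delta> < \<epsilon> / (2 * K + 3)" by linarith+
  have \<kappa>1: "K * \<delta> < 1" using \<delta>(3) K by (simp add: field_simps)
  have \<kappa>2: "(2 * K + 3) * \<delta> < \<epsilon>" using \<delta>(4) K by (simp add: field_simps)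
  show ?thesis
  proof (rule that[OF \<delta>(1)])
    fix u1 u2 h assume u1: "(u1, h) \<in> blowup_preimage X" and u2: "(u2, h) \<in> blowup_preimage X"
      and near: "dist u1 u0 \<le> \<delta>" "dist u2 u0 \<le> \<delta>" "h \<le> \<delta>"
    have n: "norm u1 = 1" "norm u2 = 1" "0 < h" "h *\<^sub>R u1 \<in> X" "h *\<^sub>R u2 \<in> X"
      using u1 u2 by (auto simp: blowup_preimage_iff)
    have inU: "h *\<^sub>R u1 \<in> X \<inter> U" "h *\<^sub>R u2 \<in> X \<inter> U"
      using n near(3) \<delta>(2) d0(2) by (auto simp: subset_iff)
    have "norm (h *\<^sub>R u1 - h *\<^sub>R u2) = h * norm (u1 - u2)"
      using n(3) by (simp add: scaleR_right_diff_distrib[symmetric])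
    also have "norm (u1 - u2) \<le> 2 * \<delta>"
      using near(1,2) dist_triangle2[of u1 u2 u0] by (simp add: dist_norm)
    finally have "norm (h *\<^sub>R u1 - h *\<^sub>R u2) \<le> h * (2 * \<delta>)" using n(3) by simp
    then have "L * norm (h *\<^sub>R u1 - h *\<^sub>R u2) \<le> L * (h * (2 * \<delta>))" using L by (intro mult_left_mono) auto
    also have "\<dots> < K * \<delta> * h" using n(3) \<delta>(1) by (simp add: K_def algebra_simps)
    finally have "ennreal (L * norm (h *\<^sub>R u1 - h *\<^sub>R u2)) < ennreal (K * \<delta> * h)"
      using L by (intro ennreal_lessI) (auto intro: le_less_trans[rotated])
    then have "inner_dist (X \<inter> U) (h *\<^sub>R u1) (h *\<^sub>R u2) < ennreal (K * \<delta> * h)"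
      using lip[OF inU] by (rule le_less_trans[rotated])
    then obtain g where g: "path g" "path_image g \<subseteq> X \<inter> U" "pathstart g = h *\<^sub>R u1" "pathfinish g = h *\<^sub>R u2"
        "path_length g < ennreal (K * \<delta> * h)"
      unfolding inner_dist_def INF_less_iff by blast
    have g01: "g 0 = h *\<^sub>R u1" "g 1 = h *\<^sub>R u2" using g(3,4) by (simp_all add: pathstart_def pathfinish_def)
    have close: "norm (g t - h *\<^sub>R u1) \<le> K * \<delta> * norm (h *\<^sub>R u1)" if "t \<in> {0..1}" for t
    proof -
      have "ennreal (dist (g 0) (g t)) < ennreal (K * \<delta> * h)"
        using dist_le_path_length[OF that] g(5) by (rule le_less_trans)
      then have "dist (g 0) (g t) < K * \<delta> * h" using K \<delta>(1) n(3) by (subst (asm) ennreal_less_iff) auto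
      then show ?thesis using n g01 by (simp add: dist_norm norm_minus_commute)
    qed
    have p0: "h *\<^sub>R u1 \<noteq> 0" using n by auto
    note polar = polar_perturbation[OF p0 close \<kappa>1]
    define G where "G t = (g t /\<^sub>R norm (g t), norm (g t))" for t
    have contg: "continuous_on {0..1} g" using g(1) by (simp add: path_def)
    have contG: "continuous_on {0..1} G"
      unfolding G_def using polar(1) by (intro continuous_intros contg) auto
    have "G t \<in> blowup_preimage X \<inter> ball (u0, 0) \<epsilon>" if t: "t \<in> {0..1}" for t
    proof
      have "g t \<in> X" using g(2) t by (auto simp: path_image_def)
      then show "G t \<in> blowup_preimage X"
        using polar(1)[OF t] by (simp add: G_def blowup_preimage_iff)
      have pu: "(h *\<^sub>R u1) /\<^sub>R norm (h *\<^sub>R u1) = u1" using n by simp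
      have "dist (G t) (u0, 0) \<le> norm (g t /\<^sub>R norm (g t) - u0) + norm (g t)"
        using norm_Pair_le[of "g t /\<^sub>R norm (g t) - u0" "norm (g t)"] by (simp add: G_def dist_norm)
      also have "norm (g t /\<^sub>R norm (g t) - u0) \<le> norm (g t /\<^sub>R norm (g t) - u1) + norm (u1 - u0)"
        using norm_triangle_ineq[of "g t /\<^sub>R norm (g t) - u1" "u1 - u0"] by simp
      also have "norm (g t /\<^sub>R norm (g t) - u1) \<le> 2 * (K * \<delta>)" using polar(3)[OF t] unfolding pu .
      also have "norm (u1 - u0) \<le> \<delta>" using near(1) by (simp add: dist_norm)
      also have "norm (g t) \<le> 2 * \<delta>"
      proof -
        have "norm (g t) \<le> (1 + K * \<delta>) * h" using polar(2)[OF t] n by simp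
        also have "\<dots> \<le> 2 * \<delta>" using \<kappa>1 near(3) n(3) \<delta>(1) K by (intro mult_mono) auto
        finally show ?thesis .
      qed
      finally have "dist (G t) (u0, 0) < \<epsilon>" using \<kappa>2 by (simp add: algebra_simps)
      then show "G t \<in> ball (u0, 0) \<epsilon>" by (simp add: dist_commute)
    qed
    then have "G ` {0..1} \<subseteq> blowup_preimage X \<inter> ball (u0, 0) \<epsilon>" by blast
    then have "connected_component (blowup_preimage X \<inter> ball (u0, 0) \<epsilon>) (G 0) (G 1)"
      by (rule connected_component_image[OF contG connected_Icc]) auto
    moreover have "G 0 = (u1, h)" "G 1 = (u2, h)" using n by (auto simp: G_def g01)
    ultimately show "connected_component (blowup_preimage X \<inter> ball (u0, 0) \<epsilon>) (u1, h) (u2, h)" by simp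
  qed
qed

text \<open>
Two points descend to a common height and are linked there.
\<close>

lemma connected_blowup_ball:
  assumes lne: "lipschitz_normally_embedded_at X 0"
    and desc: "\<And>z. z \<in> blowup_preimage X \<inter> ball (u0, 0) \<epsilon> \<Longrightarrow> descends X u0 z" and \<epsilon>: "0 < \<epsilon>"
  shows "connected (blowup_preimage X \<inter> ball (u0, 0) \<epsilon>)"
  unfolding connected_iff_connected_component
proof (intro ballI)
  let ?S = "blowup_preimage X \<inter> ball (u0, 0) \<epsilon>"
  fix z1 z2 assume z1: "z1 \<in> ?S" and z2: "z2 \<in> ?S"
  obtain U L where U: "open U" "0 \<in> U" and L: "1 \<le> L"
    and lip: "\<And>x1 x2. x1 \<in> X \<inter> U \<Longrightarrow> x2 \<in> X \<inter> U \<Longrightarrow> inner_dist (X \<inter> U) x1 x2 \<le> ennreal (L * norm (x1 - x2))"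
    using lne unfolding lipschitz_normally_embedded_at_def lipschitz_normally_embedded_def by blast
  obtain \<delta>0 where \<delta>0: "0 < \<delta>0" and link: "\<And>u1 u2 h. (u1, h) \<in> blowup_preimage X \<Longrightarrow> (u2, h) \<in> blowup_preimage X \<Longrightarrow>
     dist u1 u0 \<le> \<delta>0 \<Longrightarrow> dist u2 u0 \<le> \<delta>0 \<Longrightarrow> h \<le> \<delta>0 \<Longrightarrow> connected_component ?S (u1, h) (u2, h)"
    by (rule lipschitz_link[OF U L lip \<epsilon>, of u0]) blast+
  have pos: "0 < dist z (u0, 0)" if "z \<in> ?S" for z
  proof -
    have "0 < snd z" using that blowup_preimage_iff[of "fst z" "snd z" X] by simp
    then show ?thesis by auto
  qed
  define \<delta> where "\<delta> = min \<delta>0 (min (dist z1 (u0, 0)) (dist z2 (u0, 0)))"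
  have \<delta>: "0 < \<delta>" "\<delta> \<le> \<delta>0" "\<delta> \<le> dist z1 (u0, 0)" "\<delta> \<le> dist z2 (u0, 0)"
    using \<delta>0 pos[OF z1] pos[OF z2] by (auto simp: \<delta>_def)
  have near: "dist z1 (u0, 0) < \<epsilon>" "dist z2 (u0, 0) < \<epsilon>" using z1 z2 by (auto simp: dist_commute)
  obtain l1 where l1: "0 < l1" "l1 \<le> \<delta>" "\<And>h. 0 < h \<Longrightarrow> h \<le> l1 \<Longrightarrow>
     \<exists>u. (u, h) \<in> blowup_preimage X \<and> dist u u0 \<le> \<delta> \<and>
       (\<forall>\<epsilon>. dist z1 (u0, 0) < \<epsilon> \<longrightarrow> connected_component (blowup_preimage X \<inter> ball (u0, 0) \<epsilon>) z1 (u, h))"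
    by (rule descends_level[OF IntD1[OF z1] desc[OF z1] \<delta>(1,3)]) blast+
  obtain l2 where l2: "0 < l2" "l2 \<le> \<delta>" "\<And>h. 0 < h \<Longrightarrow> h \<le> l2 \<Longrightarrow>
     \<exists>u. (u, h) \<in> blowup_preimage X \<and> dist u u0 \<le> \<delta> \<and>
       (\<forall>\<epsilon>. dist z2 (u0, 0) < \<epsilon> \<longrightarrow> connected_component (blowup_preimage X \<inter> ball (u0, 0) \<epsilon>) z2 (u, h))"
    by (rule descends_level[OF IntD1[OF z2] desc[OF z2] \<delta>(1,4)]) blast+
  define h where "h = min l1 l2"
  have h: "0 < h" "h \<le> l1" "h \<le> l2" using l1(1) l2(1) by (auto simp: h_def)
  obtain u1 where u1: "(u1, h) \<in> blowup_preimage X" "dist u1 u0 \<le> \<delta>" "connected_component ?S z1 (u1, h)"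
    using l1(3)[OF h(1,2)] near(1) by blast
  obtain u2 where u2: "(u2, h) \<in> blowup_preimage X" "dist u2 u0 \<le> \<delta>" "connected_component ?S z2 (u2, h)"
    using l2(3)[OF h(1,3)] near(2) by blast
  have "connected_component ?S (u1, h) (u2, h)"
    using u1(2) u2(2) \<delta>(2) h(2) l1(2) by (intro link[OF u1(1) u2(1)]) linarith+
  from connected_component_trans[OF connected_component_trans[OF u1(3) this] connected_component_sym[OF u2(3)]]
  show "connected_component ?S z1 z2" .
qed

lemma tangent_multiplicity_eq_1:
  assumes x: "x \<in> closure (blowup_preimage X)" and \<epsilon>0: "0 < \<epsilon>0"
    and conn: "\<And>\<epsilon>. 0 < \<epsilon> \<Longrightarrow> \<epsilon> < \<epsilon>0 \<Longrightarrow> connected (blowup_preimage X \<inter> ball x \<epsilon>)"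
  shows "tangent_multiplicity X x = 1"
proof -
  let ?P = "\<lambda>k. \<forall>\<^sub>F \<epsilon> in at_right 0. finite (components (blowup_preimage X \<inter> ball x \<epsilon>)) \<and>
        card (components (blowup_preimage X \<inter> ball x \<epsilon>)) = k"
  have comp: "components (blowup_preimage X \<inter> ball x \<epsilon>) = {blowup_preimage X \<inter> ball x \<epsilon>}"
    if \<epsilon>: "0 < \<epsilon>" "\<epsilon> < \<epsilon>0" for \<epsilon>
  proof -
    obtain y where "y \<in> blowup_preimage X" "dist y x < \<epsilon>"
      using x \<epsilon>(1) unfolding closure_approachable by blast
    then have "y \<in> blowup_preimage X \<inter> ball x \<epsilon>" by (simp add: dist_commute)
    then have "blowup_preimage X \<inter> ball x \<epsilon> \<noteq> {}" by blast
    with conn[OF \<epsilon>] show ?thesis unfolding components_eq_sing_iff by (rule conjI)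
  qed
  have "\<forall>\<^sub>F \<epsilon> in at_right 0. \<epsilon> \<in> {0<..<\<epsilon>0}" using \<epsilon>0 by (rule eventually_at_right_real)
  then have P1: "?P 1" by (rule eventually_mono) (use comp in auto)
  have "k = 1" if "?P k" for k
  proof -
    have "\<forall>\<^sub>F \<epsilon> in at_right (0::real). k = 1" using that P1 by eventually_elim auto
    then show ?thesis by simp
  qed
  with P1 show ?thesis unfolding tangent_multiplicity_def by (rule the_equality)
qed

section \<open>Subanalytic sets\<close>

text \<open>
By the Weierstrass test the partial sums converge uniformly. Substituting holomorphic functions for the variables at this stage
avoids composing holomorphic functions of several variables; the blowing-up is quadratic, so that lines do not go to lines.
\<close>

lemma hol_power_series:
  fixes c :: "('i \<Rightarrow> nat) \<Rightarrow> real"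
  assumes sum: "(\<lambda>\<alpha>. \<bar>c \<alpha>\<bar> * (\<Prod>i\<in>I. \<epsilon> ^ \<alpha> i)) summable_on A"
    and d: "\<And>i. i \<in> I \<Longrightarrow> hol n R (d i)"
    and small: "\<And>i z. i \<in> I \<Longrightarrow> z \<in> polydisc n R \<Longrightarrow> norm (d i z) \<le> \<epsilon>"
  shows "hol n R (\<lambda>z. \<Sum>\<^sub>\<infinity>\<alpha>\<in>A. of_real (c \<alpha>) * (\<Prod>i\<in>I. d i z ^ \<alpha> i))"
proof -
  let ?t = "\<lambda>\<alpha> z. complex_of_real (c \<alpha>) * (\<Prod>i\<in>I. d i z ^ \<alpha> i)"
  let ?f = "\<lambda>z. \<Sum>\<^sub>\<infinity>\<alpha>\<in>A. ?t \<alpha> z"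
  have hol_t: "hol n R (\<lambda>z. \<Sum>\<alpha>\<in>B. ?t \<alpha> z)" for B
    by (intro hol_sum hol_mult hol_const hol_prod hol_power d)
  have bound: "norm (?t \<alpha> z) \<le> \<bar>c \<alpha>\<bar> * (\<Prod>i\<in>I. \<epsilon> ^ \<alpha> i)" if z: "z \<in> polydisc n R" for \<alpha> z
  proof -
    have "(\<Prod>i\<in>I. norm (d i z) ^ \<alpha> i) \<le> (\<Prod>i\<in>I. \<epsilon> ^ \<alpha> i)"
      using small z by (intro prod_mono conjI power_mono) auto
    then show ?thesis
      unfolding norm_mult norm_of_real prod_norm[symmetric] norm_power
      by (rule mult_left_mono) simp
  qed
  have ul: "uniform_limit (polydisc n R) (\<lambda>B z. \<Sum>\<alpha>\<in>B. ?t \<alpha> z) ?f (finite_subsets_at_top A)"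
    by (rule Weierstrass_m_test_general[where f = ?t and M = "\<lambda>\<alpha>. \<bar>c \<alpha>\<bar> * (\<Prod>i\<in>I. \<epsilon> ^ \<alpha> i)"])
       (use bound sum in blast)+
  show ?thesis
  proof (rule holI)
    show "continuous_on (polydisc n R) ?f"
      by (rule uniform_limit_theorem[OF _ ul]) (auto intro: holD(1)[OF hol_t])
  next
    fix z w :: "nat \<Rightarrow> complex"
    let ?l = "\<lambda>s i. z i + s * w i"
    let ?S = "{s. ?l s \<in> polydisc n R}"
    have "(\<lambda>s. ?f (?l s)) field_differentiable (at s)" if sS: "s \<in> ?S" for s
    proof -
      have "\<exists>e>0. cball s e \<subseteq> ?S"
        using open_line_polydisc[of z w n R] sS unfolding open_contains_cball by (rule bspec)
      then obtain e where e: "0 < e" "cball s e \<subseteq> ?S" by (elim exE conjE)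
      have h: "(\<lambda>s. \<Sum>\<alpha>\<in>B. ?t \<alpha> (?l s)) holomorphic_on ?S" for B
        by (rule holD(2)[OF hol_t])
      have "uniform_limit (cball s e) (\<lambda>B s. \<Sum>\<alpha>\<in>B. ?t \<alpha> (?l s)) (\<lambda>s. ?f (?l s)) (finite_subsets_at_top A)"
        by (rule uniform_limit_compose'[OF ul]) (use e in auto)
      moreover have "\<forall>\<^sub>F B in finite_subsets_at_top A. continuous_on (cball s e) (\<lambda>s. \<Sum>\<alpha>\<in>B. ?t \<alpha> (?l s)) \<and>
          (\<lambda>s. \<Sum>\<alpha>\<in>B. ?t \<alpha> (?l s)) holomorphic_on ball s e"
      proof (intro always_eventually allI conjI)
        fix B
        show "continuous_on (cball s e) (\<lambda>s. \<Sum>\<alpha>\<in>B. ?t \<alpha> (?l s))"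
          using holomorphic_on_imp_continuous_on[OF h] e(2) continuous_on_subset by blast
        show "(\<lambda>s. \<Sum>\<alpha>\<in>B. ?t \<alpha> (?l s)) holomorphic_on ball s e"
          by (rule holomorphic_on_subset[OF h]) (use e(2) ball_subset_cball in blast)
      qed
      ultimately have "(\<lambda>s. ?f (?l s)) holomorphic_on ball s e"
        using holomorphic_uniform_limit[of s e _ "finite_subsets_at_top A" "\<lambda>s. ?f (?l s)"] by auto
      then show ?thesis using e(1) holomorphic_on_imp_differentiable_at[of _ "ball s e" s] by auto
    qed
    then show "(\<lambda>s. ?f (?l s)) holomorphic_on ?S"
      unfolding holomorphic_on_def using field_differentiable_at_within by blast
  next
    fix z z' :: "nat \<Rightarrow> complex" assume eq: "\<And>i. i \<le> n \<Longrightarrow> z i = z' i"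
    have "d i z = d i z'" if "i \<in> I" for i by (rule hol_cong_point[OF d[OF that] eq])
    then show "?f z = ?f z'" by (intro infsum_cong) (simp cong: prod.cong)
  qed
qed

text \<open>
\<open>dr\<close> are the displacements from \<open>q\<close> as functions of real coordinates, \<open>dc\<close> their complexifications. Absolute convergence
comes from the value of the real series at the point with all displacements equal to \<open>\<epsilon>'\<close>.
\<close>

lemma analytic_pullback:
  fixes f :: "('i \<Rightarrow> real) \<Rightarrow> real"
  assumes I: "finite I"
    and ser: "\<And>x. x \<in> PiE I (\<lambda>_. UNIV) \<Longrightarrow> (\<forall>i\<in>I. \<bar>x i - q i\<bar> < \<epsilon>) \<Longrightarrow>
        ((\<lambda>\<alpha>. c \<alpha> * (\<Prod>i\<in>I. (x i - q i) ^ \<alpha> i)) has_sum f x) (PiE I (\<lambda>_. UNIV :: nat set))"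
    and \<epsilon>: "0 < \<epsilon>'" "\<epsilon>' < \<epsilon>"
    and dc: "\<And>i. i \<in> I \<Longrightarrow> hol n R (dc i)"
    and small: "\<And>i z. i \<in> I \<Longrightarrow> z \<in> polydisc n R \<Longrightarrow> norm (dc i z) \<le> \<epsilon>'"
    and dr: "\<And>i b. i \<in> I \<Longrightarrow> dc i (cpt b) = of_real (dr i b)"
  shows "\<exists>F. hol n R F \<and> (\<forall>b. cpt b \<in> polydisc n R \<longrightarrow> F (cpt b) = of_real (f (\<lambda>i\<in>I. q i + dr i b)))"
proof -
  let ?P = "PiE I (\<lambda>_. UNIV :: nat set)"
  define F where "F z = (\<Sum>\<^sub>\<infinity>\<alpha>\<in>?P. of_real (c \<alpha>) * (\<Prod>i\<in>I. dc i z ^ \<alpha> i))" for z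
  have "((\<lambda>\<alpha>. c \<alpha> * (\<Prod>i\<in>I. ((\<lambda>i\<in>I. q i + \<epsilon>') i - q i) ^ \<alpha> i)) has_sum f (\<lambda>i\<in>I. q i + \<epsilon>')) ?P"
    by (rule ser) (use \<epsilon> in auto)
  then have "((\<lambda>\<alpha>. c \<alpha> * (\<Prod>i\<in>I. \<epsilon>' ^ \<alpha> i)) has_sum f (\<lambda>i\<in>I. q i + \<epsilon>')) ?P"
    by (simp cong: prod.cong)
  then have "(\<lambda>\<alpha>. c \<alpha> * (\<Prod>i\<in>I. \<epsilon>' ^ \<alpha> i)) summable_on ?P"
    by (rule has_sum_imp_summable)
  then have "(\<lambda>\<alpha>. norm (c \<alpha> * (\<Prod>i\<in>I. \<epsilon>' ^ \<alpha> i))) summable_on ?P"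
    by (subst (asm) summable_on_iff_abs_summable_on_real)
  moreover have "norm (c \<alpha> * (\<Prod>i\<in>I. \<epsilon>' ^ \<alpha> i)) = \<bar>c \<alpha>\<bar> * (\<Prod>i\<in>I. \<epsilon>' ^ \<alpha> i)" for \<alpha>
    using \<epsilon>(1) by (simp add: abs_mult abs_prod power_abs)
  ultimately have "(\<lambda>\<alpha>. \<bar>c \<alpha>\<bar> * (\<Prod>i\<in>I. \<epsilon>' ^ \<alpha> i)) summable_on ?P" by simp
  from hol_power_series[OF this dc small] have "hol n R F" by (simp add: F_def[abs_def])
  moreover have "F (cpt b) = of_real (f (\<lambda>i\<in>I. q i + dr i b))" if b: "cpt b \<in> polydisc n R" for b
  proof -
    let ?x = "\<lambda>i\<in>I. q i + dr i b"
    have "\<bar>dr i b\<bar> \<le> \<epsilon>'" if "i \<in> I" for i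
      using small[OF that b] dr[OF that, of b] by simp
    then have "((\<lambda>\<alpha>. c \<alpha> * (\<Prod>i\<in>I. (?x i - q i) ^ \<alpha> i)) has_sum f ?x) ?P"
      using \<epsilon>(2) by (intro ser) force+
    then have "((\<lambda>\<alpha>. c \<alpha> * (\<Prod>i\<in>I. dr i b ^ \<alpha> i)) has_sum f ?x) ?P"
      by (simp cong: prod.cong)
    from has_sum_of_real[OF this, where 'a = complex]
    have "((\<lambda>\<alpha>. of_real (c \<alpha>) * (\<Prod>i\<in>I. dc i (cpt b) ^ \<alpha> i)) has_sum complex_of_real (f ?x)) ?P"
      by (simp add: dr cong: prod.cong)
    then show ?thesis unfolding F_def by (rule infsumI)
  qed
  ultimately show ?thesis by blast
qed

lemma open_box_product:
  assumes V: "openin (coord_space I) V" "q \<in> V" and I: "finite I"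
  shows "\<exists>\<epsilon>>0. \<forall>x\<in>PiE I (\<lambda>_. UNIV). (\<forall>i\<in>I. \<bar>x i - q i\<bar> < \<epsilon>) \<longrightarrow> x \<in> V"
proof -
  from bspec[OF V(1)[unfolded openin_product_topology_alt] V(2)]
  obtain W where W: "\<forall>i\<in>I. openin euclideanreal (W i)" "q \<in> PiE I W" "PiE I W \<subseteq> V"
    by (elim exE conjE)
  have "\<exists>d>0. \<forall>s. 0 < s \<and> s < d \<longrightarrow> ball (q i) s \<subseteq> W i" if "i \<in> I" for i
  proof -
    have "q i \<in> W i" using PiE_mem[OF W(2) that] .
    moreover have "open (W i)" using bspec[OF W(1) that] by (simp only: open_openin)
    ultimately obtain d where "0 < d" "ball (q i) d \<subseteq> W i" using open_contains_ball by blast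
    then show ?thesis by (intro exI[of _ d]) (auto simp: subset_iff)
  qed
  then have "\<exists>d>0. \<forall>i\<in>I. \<forall>s. 0 < s \<and> s < d \<longrightarrow> ball (q i) s \<subseteq> W i"
    by (intro finite_common_bound[OF I]) blast
  then obtain d where
    d: "0 < d" "\<And>i s. i \<in> I \<Longrightarrow> 0 < s \<Longrightarrow> s < d \<Longrightarrow> ball (q i) s \<subseteq> W i"
    by blast
  show ?thesis
  proof (intro exI[of _ "d / 2"] conjI ballI impI)
    fix x assume x: "x \<in> PiE I (\<lambda>_. UNIV)" "\<forall>i\<in>I. \<bar>x i - q i\<bar> < d / 2"
    have "x i \<in> W i" if i: "i \<in> I" for i
    proof -
      have "x i \<in> ball (q i) (d / 2)" using x(2) i by (simp add: dist_real_def abs_minus_commute)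
      then show ?thesis using d(2)[OF i, of "d / 2"] d(1) by auto
    qed
    then have "x \<in> PiE I W" using x(1) by (auto simp: PiE_def)
    then show "x \<in> V" using W(3) by blast
  qed (use d in simp)
qed

lemma finite_UN_families:
  "finite F \<Longrightarrow> \<forall>(Z, P)\<in>F. finite Z \<and> finite P \<Longrightarrow> finite (\<Union>(Z, P)\<in>F. Z \<union> P)"
  by auto

lemma common_series_radius:
  assumes I: "finite I" and Fs: "finite Fs" "\<And>f. f \<in> Fs \<Longrightarrow> real_analytic_on I V f"
    and V: "openin (coord_space I) V" "q \<in> V"
  obtains \<epsilon> c where "0 < \<epsilon>" "\<And>x. x \<in> PiE I (\<lambda>_. UNIV) \<Longrightarrow> (\<forall>i\<in>I. \<bar>x i - q i\<bar> < \<epsilon>) \<Longrightarrow> x \<in> V"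
    "\<And>f x. f \<in> Fs \<Longrightarrow> x \<in> PiE I (\<lambda>_. UNIV) \<Longrightarrow> (\<forall>i\<in>I. \<bar>x i - q i\<bar> < \<epsilon>) \<Longrightarrow>
        ((\<lambda>\<alpha>. c f \<alpha> * (\<Prod>i\<in>I. (x i - q i) ^ \<alpha> i)) has_sum f x) (PiE I (\<lambda>_. UNIV :: nat set))"
proof -
  obtain \<epsilon>1 where \<epsilon>1: "0 < \<epsilon>1" "\<forall>x\<in>PiE I (\<lambda>_. UNIV). (\<forall>i\<in>I. \<bar>x i - q i\<bar> < \<epsilon>1) \<longrightarrow> x \<in> V"
    using open_box_product[OF V I] by blast
  let ?S = "\<lambda>f c s. \<forall>x\<in>V. (\<forall>i\<in>I. \<bar>x i - q i\<bar> < s) \<longrightarrow>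
        ((\<lambda>\<alpha>. c \<alpha> * (\<Prod>i\<in>I. (x i - q i) ^ \<alpha> i)) has_sum f x) (PiE I (\<lambda>_. UNIV :: nat set))"
  have "\<exists>d>0. \<forall>s. 0 < s \<and> s < d \<longrightarrow> (\<exists>c. ?S f c s)" if fF: "f \<in> Fs" for f
  proof -
    obtain c e where e: "0 < e" "?S f c e"
      using Fs(2)[OF fF] V(2) unfolding real_analytic_on_def by blast
    have "?S f c s" if se: "s < e" for s
    proof (intro ballI impI)
      fix x assume x: "x \<in> V" "\<forall>i\<in>I. \<bar>x i - q i\<bar> < s"
      from x(2) se have "\<forall>i\<in>I. \<bar>x i - q i\<bar> < e" by force
      with e(2) x(1) show "((\<lambda>\<alpha>. c \<alpha> * (\<Prod>i\<in>I. (x i - q i) ^ \<alpha> i)) has_sum f x) (PiE I (\<lambda>_. UNIV :: nat set))"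
        by blast
    qed
    then show ?thesis using e(1) by blast
  qed
  then have "\<exists>d>0. \<forall>f\<in>Fs. \<forall>s. 0 < s \<and> s < d \<longrightarrow> (\<exists>c. ?S f c s)"
    by (intro finite_common_bound[OF Fs(1)])
  then obtain d where d: "0 < d" "\<And>f s. f \<in> Fs \<Longrightarrow> 0 < s \<Longrightarrow> s < d \<Longrightarrow> \<exists>c. ?S f c s"
    by blast
  define \<epsilon> where "\<epsilon> = min \<epsilon>1 d / 2"
  have \<epsilon>: "0 < \<epsilon>" "\<epsilon> < d" "\<epsilon> < \<epsilon>1" using \<epsilon>1(1) d(1) by (auto simp: \<epsilon>_def)
  define c where "c f = (SOME c. ?S f c \<epsilon>)" for f
  have c: "?S f (c f) \<epsilon>" if "f \<in> Fs" for f
    unfolding c_def by (rule someI_ex[OF d(2)[OF that \<epsilon>(1,2)]])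
  have inV: "x \<in> V" if "x \<in> PiE I (\<lambda>_. UNIV)" "\<forall>i\<in>I. \<bar>x i - q i\<bar> < \<epsilon>" for x
  proof -
    have "\<forall>i\<in>I. \<bar>x i - q i\<bar> < \<epsilon>1" using that(2) \<epsilon>(3) by force
    with \<epsilon>1(2) that(1) show ?thesis by blast
  qed
  show ?thesis
  proof (rule that[OF \<epsilon>(1) inV])
    fix f x assume f: "f \<in> Fs" and x: "x \<in> PiE I (\<lambda>_. UNIV)" "\<forall>i\<in>I. \<bar>x i - q i\<bar> < \<epsilon>"
    from bspec[OF c[OF f] inV[OF x]] x(2)
    show "((\<lambda>\<alpha>. c f \<alpha> * (\<Prod>i\<in>I. (x i - q i) ^ \<alpha> i)) has_sum f x) (PiE I (\<lambda>_. UNIV :: nat set))"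
      by (rule mp)
  qed
qed

lemma positive_persists:
  fixes \<phi> :: "real \<Rightarrow> real"
  assumes "continuous_on {0<..T} \<phi>" "\<And>s. s \<in> {0<..T} \<Longrightarrow> \<phi> s \<noteq> 0" "0 < \<phi> T" "s \<in> {0<..T}"
  shows "0 < \<phi> s"
proof (rule ccontr)
  assume "\<not> 0 < \<phi> s"
  moreover have "continuous_on {s..T} \<phi>"
    by (rule continuous_on_subset[OF assms(1)]) (use assms(4) in auto)
  ultimately obtain t where "s \<le> t" "t \<le> T" "\<phi> t = 0"
    using IVT'[of \<phi> s 0 T] assms(3,4) by auto
  then show False using assms(2)[of t] assms(4) by auto
qed

lemma dist_Pair_power2:
  fixes u u0 :: "real ^ 'm"
  shows "(dist (u, r) (u0, 0))\<^sup>2 = (\<Sum>i\<in>UNIV. (u $ i - u0 $ i)\<^sup>2) + r\<^sup>2"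
proof -
  have "(dist (u, r) (u0, 0))\<^sup>2 = (dist u u0)\<^sup>2 + r\<^sup>2"
    by (simp add: dist_Pair_Pair dist_real_def)
  also have "(dist u u0)\<^sup>2 = (\<Sum>i\<in>UNIV. (u $ i - u0 $ i)\<^sup>2)"
    by (simp add: dist_vec_def L2_set_def sum_nonneg dist_real_def)
  finally show ?thesis .
qed

lemma norm_vec_eq_1_iff:
  fixes u :: "real ^ 'm"
  shows "norm u = 1 \<longleftrightarrow> (\<Sum>i\<in>UNIV. (u $ i)\<^sup>2) = 1"
  by (simp add: norm_vec_def L2_set_def)

text \<open>
The coordinates are: number \<open>0\<close> for the squared distance \<open>t\<close>, then \<open>u - u0\<close>, then the radius \<open>r\<close>, then the displacement
from \<open>q\<close> in the auxiliary variables. Curve selection is applied to the functions describing \<open>A\<close> near \<open>q\<close>, pulled back by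
\<open>(u, r, w) \<mapsto> (r u, w)\<close>, and to three more: one for \<open>t = |u - u0|\<^sup>2 + r\<^sup>2\<close>, one for \<open>|u| = 1\<close>, and \<open>r\<close>. Since
a nonvanishing continuous function on an interval has constant sign, the whole path satisfies the equations and inequalities that hold at its end.
\<close>

lemma local_descent:
  fixes u0 :: "real ^ 'm" and X :: "(real ^ 'm) set" and p :: nat
  defines "I \<equiv> (UNIV :: 'm set) <+> {..<p}"
  assumes A: "semianalytic I A"
    and proj: "\<And>x y. y \<in> A \<Longrightarrow> (\<And>i. x $ i = y (Inl i)) \<Longrightarrow> x \<in> X"
    and q: "q \<in> PiE I (\<lambda>_. UNIV)" "\<And>i. q (Inl i) = 0" and u0: "norm u0 = 1"
  shows "\<exists>\<delta>>0. \<forall>u r y. (u, r) \<in> blowup_preimage X \<longrightarrow> y \<in> A \<longrightarrow> (\<forall>i. y (Inl i) = r * u $ i) \<longrightarrow>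
     (\<forall>j<p. \<bar>y (Inr j) - q (Inr j)\<bar> < \<delta>) \<longrightarrow> dist (u, r) (u0, 0) < \<delta> \<longrightarrow> descends X u0 (u, r)"
proof -
  have finI: "finite I" by (simp add: I_def)
  have A_ext: "A \<subseteq> PiE I (\<lambda>_. UNIV)" using A unfolding semianalytic_def by simp
  have "q \<in> topspace (coord_space I)" using q(1) by simp
  then obtain V F where V: "openin (coord_space I) V" "q \<in> V" and F: "finite F"
      "\<forall>(Z, P)\<in>F. finite Z \<and> finite P \<and> (\<forall>f\<in>Z \<union> P. real_analytic_on I V f)"
      "A \<inter> V = {x\<in>V. \<exists>(Z, P)\<in>F. (\<forall>f\<in>Z. f x = 0) \<and> (\<forall>g\<in>P. 0 < g x)}"
    using A unfolding semianalytic_def by meson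
  define Fs where "Fs = (\<Union>(Z, P)\<in>F. Z \<union> P)"
  have Fs: "finite Fs" "\<And>f. f \<in> Fs \<Longrightarrow> real_analytic_on I V f"
    using F(1,2) unfolding Fs_def by (auto intro!: finite_UN_families)
  obtain \<epsilon> c where \<epsilon>: "0 < \<epsilon>" and inV: "\<And>x. x \<in> PiE I (\<lambda>_. UNIV) \<Longrightarrow> (\<forall>i\<in>I. \<bar>x i - q i\<bar> < \<epsilon>) \<Longrightarrow> x \<in> V"
    and ser: "\<And>f x. f \<in> Fs \<Longrightarrow> x \<in> PiE I (\<lambda>_. UNIV) \<Longrightarrow> (\<forall>i\<in>I. \<bar>x i - q i\<bar> < \<epsilon>) \<Longrightarrow>
        ((\<lambda>\<alpha>. c f \<alpha> * (\<Prod>i\<in>I. (x i - q i) ^ \<alpha> i)) has_sum f x) (PiE I (\<lambda>_. UNIV :: nat set))"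
    by (rule common_series_radius[OF finI Fs V]) blast+
  define m where "m = CARD('m)"
  obtain e :: "'m \<Rightarrow> nat" where e: "bij_betw e UNIV {0..<m}"
    unfolding m_def using ex_bij_betw_finite_nat[of "UNIV :: 'm set"] by auto
  have e_lt: "e i < m" for i using e by (auto simp: bij_betw_def)
  have e_inv: "inv_into UNIV e (e i) = i" for i using e by (simp add: bij_betw_def)
  define n where "n = Suc m + p"
  let ?iv = "\<lambda>i. Suc (e i)" and ?ir = "Suc m" and ?iw = "\<lambda>j. Suc (Suc (m + j))"
  have iv: "?iv i \<le> n" "?iv i \<le> m" for i using e_lt[of i] by (auto simp: n_def)
  have ir: "?ir \<le> n" by (simp add: n_def)
  have iw: "?iw j \<le> n" if "j < p" for j using that by (simp add: n_def)
  define dc where "dc k z = (case k of Inl i \<Rightarrow> z ?ir * (of_real (u0 $ i) + z (?iv i)) | Inr j \<Rightarrow> z (?iw j))"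
    for k :: "'m + nat" and z :: "nat \<Rightarrow> complex"
  define dr where "dr k b = (case k of Inl i \<Rightarrow> b ?ir * (u0 $ i + b (?iv i)) | Inr j \<Rightarrow> b (?iw j))"
    for k :: "'m + nat" and b :: "nat \<Rightarrow> real"
  \<comment> \<open>With this radius \<open>|r (u0 + v)| \<le> 2 R \<le> \<epsilon> / 2\<close> on the polydisc, as \<open>|u0| = 1\<close>.\<close>
  define R where "R = min 1 (\<epsilon> / 4)"
  have R: "0 < R" "R \<le> 1" "2 * R \<le> \<epsilon> / 2" using \<epsilon> by (auto simp: R_def)
  have dc_hol: "hol n R (dc k)" if "k \<in> I" for k
  proof (cases k)
    case (Inl i)
    then show ?thesis using hol_mult[OF hol_coord[OF ir] hol_add[OF hol_const hol_coord[OF iv(1)[of i]]]]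
      by (simp add: dc_def[abs_def])
  next
    case (Inr j)
    then have "j < p" using that by (auto simp: I_def)
    then show ?thesis using hol_coord[OF iw] Inr by (simp add: dc_def[abs_def])
  qed
  have u0_le: "\<bar>u0 $ i\<bar> \<le> 1" for i using component_le_norm_cart[of u0 i] u0 by simp
  have dc_small: "norm (dc k z) \<le> \<epsilon> / 2" if "k \<in> I" "z \<in> polydisc n R" for k z
  proof (cases k)
    case (Inl i)
    have z: "norm (z ?ir) < R" "norm (z (?iv i)) < R"
      using that(2) ir iv(1)[of i] by (auto simp: polydisc_def)
    have "norm (of_real (u0 $ i) + z (?iv i)) \<le> norm (complex_of_real (u0 $ i)) + norm (z (?iv i))"
      by (rule norm_triangle_ineq)
    also have "\<dots> \<le> 2" using u0_le[of i] z(2) R(2) by simp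
    finally have "norm (z ?ir) * norm (of_real (u0 $ i) + z (?iv i)) \<le> R * 2"
      using z(1) R(1) by (intro mult_mono) auto
    then show ?thesis using Inl R(3) by (simp add: dc_def norm_mult)
  next
    case (Inr j)
    then have "j < p" using that by (auto simp: I_def)
    then have "norm (z (?iw j)) < R" using that(2) iw by (simp add: polydisc_def)
    then show ?thesis using Inr R by (simp add: dc_def)
  qed
  have dc_dr: "dc k (cpt b) = of_real (dr k b)" for k b
    by (cases k) (auto simp: dc_def dr_def)
  define xr where "xr b = (\<lambda>k\<in>I. q k + dr k b)" for b
  have xr_V: "xr b \<in> V" if "cpt b \<in> polydisc n R" for b
  proof (rule inV)
    show "\<forall>k\<in>I. \<bar>xr b k - q k\<bar> < \<epsilon>"
    proof
      fix k assume "k \<in> I"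
      then have "\<bar>dr k b\<bar> \<le> \<epsilon> / 2" using dc_small[OF _ that] dc_dr[of k b] by (metis norm_of_real)
      then show "\<bar>xr b k - q k\<bar> < \<epsilon>" using \<epsilon> \<open>k \<in> I\<close> by (simp add: xr_def)
    qed
  qed (simp add: xr_def)
  have pullback: "\<exists>G. hol n R G \<and> (\<forall>b. cpt b \<in> polydisc n R \<longrightarrow> G (cpt b) = of_real (f (xr b)))"
    if "f \<in> Fs" for f
    unfolding xr_def
    by (rule analytic_pullback[OF finI ser[OF that] _ _ dc_hol dc_small dc_dr]) (use \<epsilon> in auto)
  define G where "G f = (SOME G. hol n R G \<and> (\<forall>b. cpt b \<in> polydisc n R \<longrightarrow> G (cpt b) = of_real (f (xr b))))" for f
  have G: "hol n R (G f)" "\<And>b. cpt b \<in> polydisc n R \<Longrightarrow> G f (cpt b) = of_real (f (xr b))" if "f \<in> Fs" for f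
    using someI_ex[OF pullback[OF that]] unfolding G_def[symmetric] by blast+
  define T1 where "T1 z = z 0 - (\<Sum>i\<in>UNIV. z (?iv i) ^ 2) - z ?ir ^ 2" for z :: "nat \<Rightarrow> complex"
  define T2 where "T2 z = (\<Sum>i\<in>UNIV. (of_real (u0 $ i) + z (?iv i)) ^ 2) - 1" for z :: "nat \<Rightarrow> complex"
  define T3 where "T3 z = z ?ir" for z :: "nat \<Rightarrow> complex"
  have T1: "T1 (cpt b) = of_real (b 0 - (\<Sum>i\<in>UNIV. b (?iv i) ^ 2) - b ?ir ^ 2)" for b by (simp add: T1_def)
  have T2: "T2 (cpt b) = of_real ((\<Sum>i\<in>UNIV. (u0 $ i + b (?iv i)) ^ 2) - 1)" for b by (simp add: T2_def)
  define \<Phi> where "\<Phi> = {T1, T2, T3} \<union> G ` Fs"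
  have fin\<Phi>: "finite \<Phi>" using Fs(1) by (simp add: \<Phi>_def)
  have hol\<Phi>: "hol n R H" if "H \<in> \<Phi>" for H
  proof -
    have "hol n R T1" unfolding T1_def[abs_def]
      by (intro hol_diff hol_sum hol_power hol_coord iv(1) ir) simp
    moreover have "hol n R T2" unfolding T2_def[abs_def]
      by (intro hol_diff hol_sum hol_power hol_add hol_const hol_coord iv(1))
    moreover have "hol n R T3" unfolding T3_def[abs_def] by (rule hol_coord[OF ir])
    ultimately show ?thesis using that G(1) by (auto simp: \<Phi>_def)
  qed
  obtain \<delta>1 where \<delta>1: "0 < \<delta>1"
      "\<And>a. 0 < a 0 \<Longrightarrow> (\<forall>i\<le>n. \<bar>a i\<bar> < \<delta>1) \<Longrightarrow> \<exists>\<gamma>. curve_down n R \<Phi> a \<gamma>"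
    using curve_selection[OF fin\<Phi> hol\<Phi> R(1) R(1)] by blast
  define \<delta> where "\<delta> = min 1 (min \<delta>1 R)"
  have \<delta>: "0 < \<delta>" "\<delta> \<le> 1" "\<delta> \<le> \<delta>1" "\<delta> \<le> R" using \<delta>1(1) R(1) by (auto simp: \<delta>_def)
  show ?thesis
  proof (intro exI[of _ \<delta>] conjI allI impI)
    fix u :: "real ^ 'm" and r y
    assume ur: "(u, r) \<in> blowup_preimage X" and yA: "y \<in> A" and yl: "\<forall>i. y (Inl i) = r * u $ i"
      and yr: "\<forall>j<p. \<bar>y (Inr j) - q (Inr j)\<bar> < \<delta>" and near: "dist (u, r) (u0, 0) < \<delta>"
    have u: "norm u = 1" "0 < r" using ur by (auto simp: blowup_preimage_iff)
    define T where "T = (dist (u, r) (u0, 0))\<^sup>2"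
    have dpos: "0 < dist (u, r) (u0, 0)" using u(2) by simp
    have T0: "0 < T" unfolding T_def using dpos by (rule zero_less_power)
    have T_lt: "T < \<delta>"
    proof -
      have "T \<le> dist (u, r) (u0, 0) * 1"
        unfolding T_def power2_eq_square using near \<delta>(2) by (intro mult_left_mono) auto
      then show ?thesis using near by simp
    qed
    define b where "b k = (if k = 0 then T else if k \<le> m then (u - u0) $ (inv_into UNIV e (k - 1)) else if k = ?ir then r
        else y (Inr (k - m - 2)) - q (Inr (k - m - 2)))" for k
    have b0: "b 0 = T" by (simp add: b_def)
    have biv: "b (?iv i) = u $ i - u0 $ i" for i using iv(2)[of i] by (simp add: b_def e_inv)
    have bir: "b ?ir = r" by (simp add: b_def)
    have biw: "b (?iw j) = y (Inr j) - q (Inr j)" for j by (simp add: b_def)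
    have comp_le: "\<bar>(u - u0) $ i\<bar> < \<delta>" for i
      using component_le_norm_cart[of "u - u0" i] dist_fst_le[of "(u, r)" "(u0, 0)"] near by (simp add: dist_norm)
    have r_lt: "\<bar>r\<bar> < \<delta>" using dist_snd_le[of "(u, r)" "(u0, 0)"] near by (simp add: dist_real_def)
    have b_small: "\<bar>b k\<bar> < \<delta>" if k: "k \<le> n" for k
    proof -
      consider "k = 0" | "k \<noteq> 0" "k \<le> m" | "k = ?ir" | "m + 2 \<le> k" by linarith
      then show ?thesis
      proof cases
        case 1
        then show ?thesis using T0 T_lt by (simp add: b0)
      next
        case 2
        then show ?thesis using comp_le[of "inv_into UNIV e (k - 1)"] by (simp add: b_def)
      next
        case 3
        then show ?thesis using r_lt by (simp add: bir)
      next
        case 4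
        then have "k - m - 2 < p" using k by (simp add: n_def)
        then show ?thesis using yr 4 by (simp add: b_def)
      qed
    qed
    have b_disc: "cpt b \<in> polydisc n R" using b_small \<delta>(4) by (force simp: polydisc_def)
    have "\<exists>\<gamma>. curve_down n R \<Phi> b \<gamma>"
    proof (rule \<delta>1(2))
      show "0 < b 0" using T0 b0 by simp
      show "\<forall>i\<le>n. \<bar>b i\<bar> < \<delta>1" using b_small \<delta>(3) by force
    qed
    then obtain \<gamma> where \<gamma>: "curve_down n R \<Phi> b \<gamma>" by blast
    let ?J = "{0<..T}"
    have g_cont: "continuous_on ?J (\<lambda>s. \<gamma> s i)" for i using \<gamma> b0 by (simp add: curve_down_def)
    have g_end: "\<gamma> T i = b i" if "i \<le> n" for i using \<gamma> b0 that by (simp add: curve_down_def)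
    have g_0: "\<gamma> s 0 = s" and g_small: "\<And>i. i \<le> n \<Longrightarrow> \<bar>\<gamma> s i\<bar> < R"
      and g_stat: "\<And>H. H \<in> \<Phi> \<Longrightarrow> H (cpt (\<gamma> s)) = 0 \<longleftrightarrow> H (cpt b) = 0" if "s \<in> ?J" for s
      using \<gamma> b0 that by (auto simp: curve_down_def)
    have g_disc: "cpt (\<gamma> s) \<in> polydisc n R" if "s \<in> ?J" for s using g_small[OF that] by (simp add: polydisc_def)
    have TJ: "T \<in> ?J" using T0 by simp
    have xr_b: "xr b = y"
    proof (rule PiE_ext)
      show "xr b \<in> PiE I (\<lambda>_. UNIV)" by (simp add: xr_def)
      show "y \<in> PiE I (\<lambda>_. UNIV)" using A_ext yA by blast
      show "xr b k = y k" if "k \<in> I" for k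
        using that q(2) yl by (cases k) (auto simp: xr_def dr_def bir biv biw)
    qed
    have "y \<in> A \<inter> V" using yA xr_V[OF b_disc] xr_b by simp
    then obtain Z P where ZP: "(Z, P) \<in> F" "\<forall>f\<in>Z. f y = 0" "\<forall>g\<in>P. 0 < g y"
      unfolding F(3) by blast
    have ZFs: "f \<in> Fs" if "f \<in> Z \<union> P" for f using that ZP(1) unfolding Fs_def by blast
    have fstat: "f (xr (\<gamma> s)) = 0 \<longleftrightarrow> f y = 0" if "s \<in> ?J" "f \<in> Fs" for s f
      using g_stat[OF that(1), of "G f"] G(2)[OF that(2) g_disc[OF that(1)]] G(2)[OF that(2) b_disc] that(2) xr_b
      by (simp add: \<Phi>_def)
    have xA: "xr (\<gamma> s) \<in> A" if s: "s \<in> ?J" for s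
    proof -
      have "f (xr (\<gamma> s)) = 0" if "f \<in> Z" for f
        using fstat[OF s ZFs[of f]] that ZP(2) by simp
      moreover have "0 < g (xr (\<gamma> s))" if "g \<in> P" for g
      proof (rule positive_persists[OF _ _ _ s, of "\<lambda>s. g (xr (\<gamma> s))"])
        have gF: "g \<in> Fs" using ZFs that by simp
        have "continuous_on ?J (\<lambda>s. G g (cpt (\<gamma> s)))"
          by (rule hol_continuous_on[OF G(1)[OF gF] _ g_disc])
             (intro continuous_on_coordinatewise_then_product continuous_on_of_real g_cont)
        then have "continuous_on ?J (\<lambda>s. Re (G g (cpt (\<gamma> s))))" by (rule continuous_on_Re)
        then show "continuous_on ?J (\<lambda>s. g (xr (\<gamma> s)))"
          by (rule continuous_on_eq) (simp add: G(2)[OF gF g_disc])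
        show "g (xr (\<gamma> s)) \<noteq> 0" if "s \<in> ?J" for s
          using fstat[OF that gF] ZP(3) \<open>g \<in> P\<close> by force
        have "complex_of_real (g (xr (\<gamma> T))) = G g (cpt (\<gamma> T))" using G(2)[OF gF g_disc[OF TJ]] by simp
        also have "\<dots> = G g (cpt b)" by (rule hol_cong_point[OF G(1)[OF gF]]) (simp add: g_end)
        also have "\<dots> = of_real (g y)" using G(2)[OF gF b_disc] xr_b by simp
        finally have "g (xr (\<gamma> T)) = g y" by simp
        then show "0 < g (xr (\<gamma> T))" using ZP(3) \<open>g \<in> P\<close> by simp
      qed
      ultimately have "xr (\<gamma> s) \<in> A \<inter> V"
        unfolding F(3) using xr_V[OF g_disc[OF s]] ZP(1) by blast
      then show ?thesis by simp
    qed
    have T1b: "T1 (cpt b) = 0"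
      unfolding T1 using dist_Pair_power2[of u r u0] by (simp add: b0 biv bir T_def)
    have T2b: "T2 (cpt b) = 0"
      unfolding T2 using u(1) norm_vec_eq_1_iff[of u] by (simp add: biv)
    have T3b: "T3 (cpt b) \<noteq> 0" using u(2) bir by (simp add: T3_def)
    define \<beta> where "\<beta> s = ((\<chi> i. u0 $ i + \<gamma> s (?iv i)), \<gamma> s ?ir)" for s
    have r_pos: "0 < \<gamma> s ?ir" if "s \<in> ?J" for s
    proof (rule positive_persists[OF g_cont _ _ that])
      show "\<gamma> s ?ir \<noteq> 0" if "s \<in> ?J" for s
        using g_stat[OF that, of T3] T3b by (auto simp: \<Phi>_def T3_def)
      show "0 < \<gamma> T ?ir" using g_end[OF ir] bir u(2) by simp
    qed
    have "T1 (cpt (\<gamma> s)) = 0" "T2 (cpt (\<gamma> s)) = 0" if "s \<in> ?J" for s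
      using g_stat[OF that, of T1] g_stat[OF that, of T2] T1b T2b by (auto simp: \<Phi>_def)
    then have E1: "\<gamma> s 0 = (\<Sum>i\<in>UNIV. \<gamma> s (?iv i) ^ 2) + \<gamma> s ?ir ^ 2"
      and E2: "(\<Sum>i\<in>UNIV. (u0 $ i + \<gamma> s (?iv i)) ^ 2) = 1" if "s \<in> ?J" for s
      using that unfolding T1 T2 of_real_eq_0_iff by force+
    show "descends X u0 (u, r)"
      unfolding descends_def T_def[symmetric]
    proof (intro exI[of _ \<beta>] conjI ballI)
      show "continuous_on ?J \<beta>"
        unfolding \<beta>_def by (intro continuous_on_Pair continuous_on_vec_lambda continuous_on_add continuous_on_const g_cont)
      show "\<beta> T = (u, r)"
        using g_end[OF iv(1)] g_end[OF ir] by (simp add: \<beta>_def biv bir vec_eq_iff)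
      fix s assume s: "s \<in> ?J"
      show "(dist (\<beta> s) (u0, 0))\<^sup>2 = s"
        unfolding \<beta>_def dist_Pair_power2 using E1[OF s] g_0[OF s] by simp
      have "norm (\<chi> i. u0 $ i + \<gamma> s (?iv i)) = 1"
        unfolding norm_vec_eq_1_iff using E2[OF s] by simp
      moreover have "\<gamma> s ?ir *\<^sub>R (\<chi> i. u0 $ i + \<gamma> s (?iv i)) \<in> X"
        by (rule proj[OF xA[OF s]]) (auto simp: xr_def dr_def I_def q(2))
      ultimately show "\<beta> s \<in> blowup_preimage X"
        using r_pos[OF s] by (simp add: \<beta>_def blowup_preimage_iff)
    qed
  qed (rule \<delta>(1))
qed

lemma compactin_coordinates_bounded:
  assumes "compactin (coord_space I) (coord_space I closure_of A)" "A \<subseteq> PiE I (\<lambda>_. UNIV)" "k \<in> I"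
  shows "\<exists>B\<ge>0. \<forall>y\<in>A. \<bar>y k\<bar> \<le> B"
proof -
  have "compactin euclideanreal ((\<lambda>y. y k) ` (coord_space I closure_of A))"
    by (rule image_compactin[OF assms(1) continuous_map_product_projection[OF assms(3)]])
  then have "bounded ((\<lambda>y. y k) ` (coord_space I closure_of A))"
    by (simp add: compact_imp_bounded)
  then obtain B where B: "\<forall>x\<in>(\<lambda>y. y k) ` (coord_space I closure_of A). norm x \<le> B"
    unfolding bounded_iff by (rule exE)
  have "A \<subseteq> coord_space I closure_of A"
    by (rule closure_of_subset) (use assms(2) in simp)
  then have "\<bar>y k\<bar> \<le> B" if "y \<in> A" for y using B that by auto
  then show ?thesis by (intro exI[of _ "max 0 B"]) (auto simp: le_max_iff_disj)
qed

text \<open>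
The auxiliary variables range over a compact box, which finitely many of the neighbourhoods from \<open>local_descent\<close> cover.
\<close>

lemma blowup_descends:
  fixes X :: "(real ^ 'm) set"
  assumes X: "subanalytic X" and u0: "norm u0 = 1"
  shows "\<exists>\<epsilon>>0. \<forall>z\<in>blowup_preimage X. dist z (u0, 0) < \<epsilon> \<longrightarrow> descends X u0 z"
proof -
  obtain U p A where U: "open U" "0 \<in> U"
    and A: "semianalytic ((UNIV :: 'm set) <+> {..<p::nat}) A"
      "compactin (coord_space ((UNIV :: 'm set) <+> {..<p})) (coord_space ((UNIV :: 'm set) <+> {..<p}) closure_of A)"
      "X \<inter> U = {x. \<exists>y\<in>A. \<forall>i. x $ i = y (Inl i)}"
    using X unfolding subanalytic_def Let_def by meson
  define I where "I = (UNIV :: 'm set) <+> {..<p}"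
  note A = A[folded I_def]
  have finI: "finite I" by (simp add: I_def)
  have A_ext: "A \<subseteq> PiE I (\<lambda>_. UNIV)" using A(1) unfolding semianalytic_def by simp
  have proj: "x \<in> X" if "y \<in> A" "\<And>i. x $ i = y (Inl i)" for x :: "real ^ 'm" and y
  proof -
    have "x \<in> X \<inter> U" unfolding A(3) using that by blast
    then show ?thesis by simp
  qed
  have "\<exists>B\<ge>0. \<forall>y\<in>A. \<bar>y (Inr j)\<bar> \<le> B" if "j \<in> {..<p}" for j
    by (rule compactin_coordinates_bounded[OF A(2) A_ext]) (use that in \<open>auto simp: I_def\<close>)
  then obtain Bj where Bj: "\<And>j. j \<in> {..<p} \<Longrightarrow> 0 \<le> Bj j" "\<And>j y. j \<in> {..<p} \<Longrightarrow> y \<in> A \<Longrightarrow> \<bar>y (Inr j)\<bar> \<le> Bj j"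
    by metis
  define B where "B = (\<Sum>j<p. Bj j)"
  have B: "\<bar>y (Inr j)\<bar> \<le> B" if "y \<in> A" "j < p" for y j
  proof -
    have "Bj j \<le> B" unfolding B_def using that(2) Bj(1) by (intro member_le_sum) auto
    then show ?thesis using Bj(2)[of j y] that by simp
  qed
  define K where "K = PiE I (case_sum (\<lambda>_. {0::real}) (\<lambda>_. {-B..B}))"
  have K_ext: "q \<in> PiE I (\<lambda>_. UNIV)" and K0: "q (Inl i) = 0" if "q \<in> K" for q i
  proof -
    show "q \<in> PiE I (\<lambda>_. UNIV)" using that unfolding K_def PiE_def by blast
    have "Inl i \<in> I" by (auto simp: I_def)
    from PiE_mem[OF that[unfolded K_def] this] show "q (Inl i) = 0" by simp
  qed
  have compK: "compactin (coord_space I) K"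
    unfolding K_def compactin_PiE by (auto split: sum.split)
  let ?good = "\<lambda>q \<delta>. \<forall>u r y. (u, r) \<in> blowup_preimage X \<longrightarrow> y \<in> A \<longrightarrow> (\<forall>i. y (Inl i) = r * u $ i) \<longrightarrow>
     (\<forall>j<p. \<bar>y (Inr j) - q (Inr j)\<bar> < \<delta>) \<longrightarrow> dist (u, r) (u0, 0) < \<delta> \<longrightarrow> descends X u0 (u, r)"
  have "\<forall>q\<in>K. \<exists>\<delta>. 0 < \<delta> \<and> ?good q \<delta>"
  proof
    fix q assume "q \<in> K"
    show "\<exists>\<delta>. 0 < \<delta> \<and> ?good q \<delta>"
      by (rule local_descent[of p A X q u0, folded I_def, OF A(1) proj K_ext[OF \<open>q \<in> K\<close>] K0[OF \<open>q \<in> K\<close>] u0])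
  qed
  from bchoice[OF this] obtain \<delta> where \<delta>: "\<forall>q\<in>K. 0 < \<delta> q \<and> ?good q (\<delta> q)" by (rule exE)
  define W where "W q = PiE I (case_sum (\<lambda>_. UNIV) (\<lambda>j. {q (Inr j) - \<delta> q<..<q (Inr j) + \<delta> q}))"
    for q :: "'m + nat \<Rightarrow> real"
  have openW: "openin (coord_space I) (W q)" for q
    unfolding W_def openin_PiE[OF finI] by (auto split: sum.split)
  have qW: "q \<in> W q" if "q \<in> K" for q
  proof -
    have "q k \<in> case_sum (\<lambda>_. UNIV) (\<lambda>j. {q (Inr j) - \<delta> q<..<q (Inr j) + \<delta> q}) k" for k
      using \<delta> that by (auto split: sum.split)
    then show ?thesis using K_ext[OF that] unfolding W_def PiE_def by blast
  qed
  have "\<exists>\<F>. finite \<F> \<and> \<F> \<subseteq> W ` K \<and> K \<subseteq> \<Union>\<F>"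
  proof -
    have "(\<forall>V\<in>W ` K. openin (coord_space I) V) \<and> K \<subseteq> \<Union>(W ` K)" using openW qW by blast
    then show ?thesis using compK unfolding compactin_def by blast
  qed
  then obtain \<F> where \<F>: "finite \<F>" "\<F> \<subseteq> W ` K" "K \<subseteq> \<Union>\<F>" by blast
  obtain Q where Q: "Q \<subseteq> K" "finite Q" "\<F> = W ` Q"
    using finite_subset_image[OF \<F>(1,2)] by blast
  obtain d0 where d0: "0 < d0" "ball 0 d0 \<subseteq> U" using U open_contains_ball by blast
  define \<epsilon> where "\<epsilon> = Min (insert d0 (\<delta> ` Q))"
  have \<epsilon>_le: "\<epsilon> \<le> d0" "\<And>q. q \<in> Q \<Longrightarrow> \<epsilon> \<le> \<delta> q"
    unfolding \<epsilon>_def using Q(2) by (auto intro: Min_le)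
  have "0 < \<epsilon>" unfolding \<epsilon>_def using Q(1,2) d0(1) \<delta> by (subst Min_gr_iff) auto
  moreover have "descends X u0 z" if z: "z \<in> blowup_preimage X" "dist z (u0, 0) < \<epsilon>" for z
  proof -
    obtain u r where ur: "z = (u, r)" by (cases z)
    have n: "norm u = 1" "0 < r" "r *\<^sub>R u \<in> X" using z(1) unfolding ur blowup_preimage_iff by auto
    have "r < d0" using dist_snd_le[of z "(u0, 0)"] z(2) \<epsilon>_le(1) n(2) by (simp add: ur dist_real_def)
    then have "r *\<^sub>R u \<in> X \<inter> U" using n d0(2) by (auto simp: subset_iff)
    then obtain y where y: "y \<in> A" "\<forall>i. (r *\<^sub>R u) $ i = y (Inl i)" unfolding A(3) by blast
    \<comment> \<open>The point \<open>y\<close> itself lies over \<open>r u\<close>; only its auxiliary variables are compared with the cover.\<close>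
    define y0 where "y0 = (\<lambda>k\<in>I. case k of Inl i \<Rightarrow> 0 | Inr j \<Rightarrow> y (Inr j))"
    have "y0 \<in> K"
      unfolding K_def y0_def using B[OF y(1)] by (auto simp: I_def abs_le_iff split: sum.split) force+
    then obtain q where q: "q \<in> Q" "y0 \<in> W q" using \<F>(3) unfolding Q(3) by blast
    have "\<bar>y (Inr j) - q (Inr j)\<bar> < \<delta> q" if "j < p" for j
    proof -
      have jI: "Inr j \<in> I" using that by (auto simp: I_def)
      have "y0 (Inr j) \<in> {q (Inr j) - \<delta> q<..<q (Inr j) + \<delta> q}"
        using PiE_mem[OF q(2)[unfolded W_def] jI] by simp
      then show ?thesis using jI by (auto simp: y0_def abs_less_iff)
    qed
    moreover have "dist (u, r) (u0, 0) < \<delta> q" using z(2) \<epsilon>_le(2)[OF q(1)] by (simp add: ur)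
    moreover have "\<forall>i. y (Inl i) = r * u $ i" using y(2) by simp
    ultimately show ?thesis
      using \<delta> q(1) Q(1) y(1) z(1) unfolding ur by blast
  qed
  ultimately show ?thesis by blast
qed


section \<open>Reduced tangent cones\<close>

theorem theorem3p10:
  fixes X :: "(real ^ 'm) set"
  assumes "subanalytic X"
    and "0 \<in> X"
    and "lipschitz_normally_embedded_at X 0"
  shows "reduced_tangent_cone X"
  unfolding reduced_tangent_cone_def
proof
  fix x assume "x \<in> simple_points X"
  then have x: "x \<in> closure (blowup_preimage X)" "x \<in> sphere 0 1 \<times> {0}"
    by (auto simp: simple_points_def blowup_boundary_def strict_transform_def)
  then obtain u0 where u0: "x = (u0, 0)" "norm u0 = 1" by auto
  obtain \<epsilon>0 where \<epsilon>0: "0 < \<epsilon>0" "\<forall>z\<in>blowup_preimage X. dist z (u0, 0) < \<epsilon>0 \<longrightarrow> descends X u0 z"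
    using blowup_descends[OF assms(1) u0(2)] by blast
  show "tangent_multiplicity X x = 1"
  proof (rule tangent_multiplicity_eq_1[OF x(1) \<epsilon>0(1)])
    fix \<epsilon> assume \<epsilon>: "0 < \<epsilon>" "\<epsilon> < \<epsilon>0"
    show "connected (blowup_preimage X \<inter> ball x \<epsilon>)"
      unfolding u0(1)
    proof (rule connected_blowup_ball[OF assms(3) _ \<epsilon>(1)])
      fix z assume "z \<in> blowup_preimage X \<inter> ball (u0, 0) \<epsilon>"
      then show "descends X u0 z" using \<epsilon>0(2) \<epsilon>(2) by (auto simp: dist_commute)
    qed
  qed
qed

end
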